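(* Let $\mathbf f=(f_1,\dots,f_d)$ be a system of $d$ formal Taylor expansions about the origin, $f_k(z)=\sum_{n\ge 0}\phi_{n,k}z^n$, $\phi_{n,k}\in\mathbb C$, and fix a multi-index $\mathbf m=(m_1,\dots,m_d)\in\mathbb N^d$. Then the following two assertions are equivalent. a) $R_0(\mathbf f)>0$ and $\mathbf f$ has exactly $|\mathbf m|$ system poles with respect to $\mathbf m$ counting multiplicities. b) The sequence of denominators $\{Q_{n,\mathbf m}\}_{n\ge|\mathbf m|}$ of the simultaneous (Hermite-)Padé approximations of $\mathbf f$ is uniquely determined for all sufficiently large $n$, and there exists a polynomial $Q_{|\mathbf m|}$ of degree $|\mathbf m|$, $Q_{|\mathbf m|}(0)\ne 0$, such that $$\limsup_{n\to\infty}\|Q_{|\mathbf m|}-Q_{n,\mathbf m}\|^{1/n}=\theta<1 .$$ Moreover, if either a) or b) takes place, then $Q_{|\mathbf m|}\equiv\mathcal Q_{|\mathbf m|}(\mathbf f,\mathbf m)$ and $$\theta=\max\left\{\frac{|\xi|}{R_\xi(\mathbf f,\mathbf m)}\,:\,\xi\in\mathcal P_{|\mathbf m|}(\mathbf f,\mathbf m)\right\}.$$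
   Context: Notation: $\mathbb N=\{1,2,\dots\}$; $|\mathbf m|=m_1+\dots+m_d$; $D_r=\{z\in\mathbb C:|z|<r\}$ and $\overline D_r=\{z\in\mathbb C:|z|\le r\}$; $\|\cdot\|$ is the coefficient norm on the space of polynomials (of degree at most $|\mathbf m|$). $R_0(\mathbf f)$ is the radius of the largest disk centered at the origin in which all the expansions $f_k$, $k=1,\dots,d$, correspond to analytic functions ($R_0(\mathbf f)=0$ if there is none). Hermite-Padé approximants. For each $n\ge\max\{m_1,\dots,m_d\}$ there exist polynomials $Q,P_1,\dots,P_d$ such that $\deg P_k\le n-m_k$ ($k=1,\dots,d$), $\deg Q\le|\mathbf m|$, $Q\not\equiv0$, and $Q(z)f_k(z)-P_k(z)=A_kz^{n+1}+\cdots$ for $k=1,\dots,d$. The vector $(P_1/Q,\dots,P_d/Q)$ is called an $(n,\mathbf m)$ Hermite-Padé approximation of $\mathbf f$. It is in general not unique; for each $n$ one solution is chosen and written $(P_{n,\mathbf m,1},\dots,P_{n,\mathbf m,d})/Q_{n,\mathbf m}$, where $Q_{n,\mathbf m}$ has no common zero simultaneously with all the $P_{n,\mathbf m,k}$ and is normalized to be monic. For a single power series $g$ and $s\in\mathbb Z_+$, $R_s(g)$ is the radius of the largest disk $D_s(g)$ centered at the origin to which $g$ extends as a meromorphic function with at most $s$ poles counting multiplicities (if $g$ has radius of convergence $0$, $R_s(g)=0$ and $D_s(g)=\emptyset$). The value $+\infty$ is allowed. System poles. $\xi\in\mathbb C\setminus\{0\}$ is a system pole of order $\tau$ of $\mathbf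 f$ with respect to $\mathbf m$ if for each $s=1,\dots,\tau$ there exists at least one polynomial combination of the form $$\sum_{k=1}^d p_kf_k,\qquad \deg p_k<m_k,\quad k=1,\dots,d,\qquad( * )$$ (with $p_k$ polynomials) which is analytic on a neighborhood of $\overline D_{|\xi|}$ except for a pole at $z=\xi$ of exact order $s$, and there is no polynomial combination of the form $( * )$ with those properties for $s$ greater than $\tau$. System poles are counted according to their order. Characteristic values. If $\xi$ is a system pole of order $\tau$, then for $s=1,\dots,\tau$ let $r_{\xi,s}(\mathbf f,\mathbf m)$ be the largest of all the numbers $R_s(g)$, where $g$ is a polynomial combination of type $( * )$ that is analytic on a neighborhood of $\overline D_{|\xi|}$ except for a pole at $z=\xi$ of order $s$. Put $R_\xi(\mathbf f,\mathbf m)=\min_{s=1,\dots,\tau}r_{\xi,s}(\mathbf f,\mathbf m)$. $\mathcal Q_{|\mathbf m|}(\mathbf f,\mathbf m)$ is the monic polynomial whose zeros are the system poles of $\mathbf f$ with respect to $\mathbf m$ taking account of their order, and $\mathcal P_{|\mathbf m|}(\mathbf f,\mathbf m)$ is the set of its distinct zeros. *)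

theory Defs
  imports "HOL-Complex_Analysis.Complex_Analysis"
begin

text \<open>
  A system \<open>f\<close> of \<open>d\<close> formal power series and a multi-index \<open>m\<close> are functions on \<open>nat\<close> of
  which only the values at \<open>1, \<dots>, d\<close> are used.
\<close>

definition mi_size :: "nat \<Rightarrow> (nat \<Rightarrow> nat) \<Rightarrow> nat" where
  "mi_size d m = (\<Sum>k=1..d. m k)"

definition analyticity_radius :: "nat \<Rightarrow> (nat \<Rightarrow> complex fps) \<Rightarrow> ereal" where
  "analyticity_radius d f =
     Sup {\<rho>. \<rho> = 0 \<or> \<rho> > 0 \<and>
              (\<forall>k\<in>{1..d}. \<exists>F. F holomorphic_on eball 0 \<rho> \<and> F has_fps_expansion f k)}"


section \<open>Hermite-Pade approximants\<close>

text \<open>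
  The degree bound on \<open>P k\<close> is \<open>degree (P k) \<le> n - m k\<close>, written without truncated subtraction;
  in particular it forces \<open>m k \<le> n\<close>.
\<close>

definition hermite_pade ::
  "nat \<Rightarrow> (nat \<Rightarrow> complex fps) \<Rightarrow> (nat \<Rightarrow> nat) \<Rightarrow> nat \<Rightarrow>
     complex poly \<Rightarrow> (nat \<Rightarrow> complex poly) \<Rightarrow> bool" where
  "hermite_pade d f m n Q P \<longleftrightarrow>
     Q \<noteq> 0 \<and> degree Q \<le> mi_size d m \<and>
     (\<forall>k\<in>{1..d}. degree (P k) + m k \<le> n \<and>
        (\<forall>j\<le>n. fps_nth (fps_of_poly Q * f k - fps_of_poly (P k)) j = 0))"

text \<open>
  \<open>q\<close> is the monic denominator of some \<open>(n, m)\<close> approximation \<open>(P\<^sub>1/Q, \<dots>, P\<^sub>d/Q)\<close> after the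
  common factor \<open>G\<close> of \<open>Q\<close> and all the \<open>P\<^sub>k\<close> is cancelled. If \<open>G\<close> vanishes at the origin, the
  reduced polynomials need not have the order of contact required in \<open>hermite_pade\<close>.
\<close>

definition hermite_pade_denom ::
  "nat \<Rightarrow> (nat \<Rightarrow> complex fps) \<Rightarrow> (nat \<Rightarrow> nat) \<Rightarrow> nat \<Rightarrow> complex poly \<Rightarrow> bool" where
  "hermite_pade_denom d f m n q \<longleftrightarrow>
     lead_coeff q = 1 \<and>
     (\<exists>Q P G p. hermite_pade d f m n Q P \<and>
        Q = G * q \<and> (\<forall>k\<in>{1..d}. P k = G * p k) \<and>
        (\<nexists>z. poly q z = 0 \<and> (\<forall>k\<in>{1..d}. poly (p k) z = 0)))"

definition coeff_norm :: "complex poly \<Rightarrow> real" where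
  "coeff_norm p = Max ((\<lambda>i. norm (coeff p i)) ` {..degree p})"

definition denoms_converge ::
  "nat \<Rightarrow> (nat \<Rightarrow> complex fps) \<Rightarrow> (nat \<Rightarrow> nat) \<Rightarrow> (nat \<Rightarrow> complex poly) \<Rightarrow>
     complex poly \<Rightarrow> ereal \<Rightarrow> bool" where
  "denoms_converge d f m Qs Q \<theta> \<longleftrightarrow>
     eventually (\<lambda>n. \<exists>!q. hermite_pade_denom d f m n q) sequentially \<and>
     degree Q = mi_size d m \<and> poly Q 0 \<noteq> 0 \<and>
     limsup (\<lambda>n. ereal (root n (coeff_norm (Q - Qs n)))) = \<theta> \<and> \<theta> < 1"


section \<open>System poles\<close>

definition poly_combs :: "nat \<Rightarrow> (nat \<Rightarrow> complex fps) \<Rightarrow> (nat \<Rightarrow> nat) \<Rightarrow> complex fps set" where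
  "poly_combs d f m =
     {(\<Sum>k=1..d. fps_of_poly (p k) * f k) | p. \<forall>k\<in>{1..d}. degree (p k) < m k}"

text \<open>
  The power series \<open>g\<close> is the germ at \<open>0\<close> of a function that is analytic on a neighbourhood of the
  closed disk of radius \<open>norm \<xi>\<close>, except for a pole of exact order \<open>s\<close> at \<open>\<xi>\<close>.
\<close>

definition single_pole_on_disk :: "complex fps \<Rightarrow> complex \<Rightarrow> nat \<Rightarrow> bool" where
  "single_pole_on_disk g \<xi> s \<longleftrightarrow>
     (\<exists>F U. open U \<and> cball 0 (norm \<xi>) \<subseteq> U \<and> F has_fps_expansion g \<and>
        F analytic_on (U - {\<xi>}) \<and> is_pole F \<xi> \<and> zorder F \<xi> = - int s)"

definition is_system_pole ::
  "nat \<Rightarrow> (nat \<Rightarrow> complex fps) \<Rightarrow> (nat \<Rightarrow> nat) \<Rightarrow> complex \<Rightarrow> nat \<Rightarrow> bool" where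
  "is_system_pole d f m \<xi> \<tau> \<longleftrightarrow>
     \<xi> \<noteq> 0 \<and> \<tau> \<ge> 1 \<and>
     (\<forall>s\<in>{1..\<tau>}. \<exists>g\<in>poly_combs d f m. single_pole_on_disk g \<xi> s) \<and>
     (\<forall>s>\<tau>. \<not> (\<exists>g\<in>poly_combs d f m. single_pole_on_disk g \<xi> s))"

lemma is_system_pole_order_unique:
  assumes "is_system_pole d f m \<xi> \<tau>" "is_system_pole d f m \<xi> \<tau>'"
  shows   "\<tau> = \<tau>'"
proof (rule ccontr)
  assume "\<tau> \<noteq> \<tau>'"
  then consider "\<tau> < \<tau>'" | "\<tau>' < \<tau>" by linarith
  then show False
    using assms unfolding is_system_pole_def by cases (metis atLeastAtMost_iff order_refl)+
qed

definition system_poles :: "nat \<Rightarrow> (nat \<Rightarrow> complex fps) \<Rightarrow> (nat \<Rightarrow> nat) \<Rightarrow> complex set" where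
  "system_poles d f m = {\<xi>. \<exists>\<tau>. is_system_pole d f m \<xi> \<tau>}"

definition system_pole_order ::
  "nat \<Rightarrow> (nat \<Rightarrow> complex fps) \<Rightarrow> (nat \<Rightarrow> nat) \<Rightarrow> complex \<Rightarrow> nat" where
  "system_pole_order d f m \<xi> = (THE \<tau>. is_system_pole d f m \<xi> \<tau>)"

definition system_pole_poly ::
  "nat \<Rightarrow> (nat \<Rightarrow> complex fps) \<Rightarrow> (nat \<Rightarrow> nat) \<Rightarrow> complex poly" where
  "system_pole_poly d f m = (\<Prod>\<xi>\<in>system_poles d f m. [:-\<xi>, 1:] ^ system_pole_order d f m \<xi>)"


section \<open>Characteristic values\<close>

text \<open>
  The radius of the largest disk about \<open>0\<close> to which \<open>g\<close> extends as a meromorphic function with at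
  most \<open>s\<close> poles counting multiplicities; it is \<open>0\<close> if \<open>g\<close> has radius of convergence \<open>0\<close>, since
  \<open>has_fps_expansion\<close> requires convergence.
\<close>

definition mero_radius :: "nat \<Rightarrow> complex fps \<Rightarrow> ereal" where
  "mero_radius s g =
     Sup {\<rho>. \<rho> = 0 \<or> \<rho> > 0 \<and>
              (\<exists>F. F meromorphic_on eball 0 \<rho> \<and> F has_fps_expansion g \<and>
                   finite {z\<in>eball 0 \<rho>. is_pole F z} \<and>
                   (\<Sum>z\<in>{z\<in>eball 0 \<rho>. is_pole F z}. nat (- zorder F z)) \<le> s)}"

definition char_radius_order ::
  "nat \<Rightarrow> (nat \<Rightarrow> complex fps) \<Rightarrow> (nat \<Rightarrow> nat) \<Rightarrow> complex \<Rightarrow> nat \<Rightarrow> ereal" where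
  "char_radius_order d f m \<xi> s =
     (SUP g\<in>{g\<in>poly_combs d f m. single_pole_on_disk g \<xi> s}. mero_radius s g)"

definition char_radius ::
  "nat \<Rightarrow> (nat \<Rightarrow> complex fps) \<Rightarrow> (nat \<Rightarrow> nat) \<Rightarrow> complex \<Rightarrow> ereal" where
  "char_radius d f m \<xi> =
     Min (char_radius_order d f m \<xi> ` {1..system_pole_order d f m \<xi>})"

end

theory Submission
  imports Defs "HOL-Computational_Algebra.Fundamental_Theorem_Algebra"
begin

text \<open>
  Let \<open>V\<close> be the space of all combinations \<open>p\<^sub>1 f\<^sub>1 + \<dots> + p\<^sub>d f\<^sub>d\<close> with \<open>deg p\<^sub>k < m\<^sub>k\<close>, let
  \<open>M = m\<^sub>1 + \<dots> + m\<^sub>d\<close>, and write \<open>[z^n] h\<close> for the coefficient of \<open>z^n\<close> in \<open>h\<close>. The whole proof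
  rests on one reformulation: for \<open>n \<ge> M\<close>, a nonzero polynomial \<open>Q\<close> with \<open>deg Q \<le> M\<close> is the
  denominator of a Hermite-Pade approximation if and only if \<open>[z^n] (Q g) = 0\<close> for every
  \<open>g \<in> V\<close>. Indeed, \<open>P\<^sub>k\<close> has to be a truncation of \<open>Q f\<^sub>k\<close>, and the \<open>m\<^sub>k\<close> coefficients of
  \<open>Q f\<^sub>k\<close> that must vanish are the numbers \<open>[z^n] (Q z^i f\<^sub>k)\<close> with \<open>i < m\<^sub>k\<close>. In other words,
  the coefficients of \<open>Q\<^sub>n\<close> define a linear recurrence that the Taylor coefficients of all
  \<open>g \<in> V\<close> satisfy at index \<open>n\<close>. Poles and radii of meromorphy are also expressed through power
  series: on the closed disk of radius \<open>|\<xi>|\<close>, \<open>g\<close> has no singularity except a pole of order \<open>s\<close> at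
  \<open>\<xi>\<close> if and only if \<open>(z - \<xi>)^s g\<close> converges on a larger disk and does not vanish at \<open>\<xi>\<close>.

  From system poles to convergence (\<open>annihilator_mod_bound\<close>, \<open>annihilator_convergence\<close>). Let
  \<open>P = \<Prod>(z - \<xi>)^\<tau>\<close> be the polynomial of the system poles. For every \<open>\<xi>\<close> and \<open>s \<le> \<tau>\<close> there is
  some \<open>g \<in> V\<close> whose only singularity in the disk of radius nearly \<open>R\<^sub>\<xi>\<close> is a pole of order \<open>s\<close>
  at \<open>\<xi>\<close>. If the remainder of \<open>Q\<^sub>n\<close> modulo a divisor \<open>N\<close> of \<open>P\<close> is already known to be small, and
  \<open>s - 1\<close> is the order of \<open>N\<close> at \<open>\<xi>\<close>, then \<open>g N\<close> has a simple pole at \<open>\<xi>\<close>, and the equation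
  \<open>[z^n] (Q\<^sub>n g) = 0\<close> forces the remainder modulo \<open>(z - \<xi>) N\<close> to be small too. Once \<open>N = P\<close> is
  reached, \<open>Q\<^sub>n\<close> is a multiple of \<open>P\<close> up to an error of order \<open>\<eta>^n\<close>, for each \<open>\<eta>\<close> above
  \<open>max |\<xi>| / R\<^sub>\<xi>\<close>. In particular no solution has degree below \<open>M\<close>, which yields uniqueness.

  From convergence to system poles (\<open>perturbed_recurrence_bounded_solution\<close>,
  \<open>recurrence_solution_in_space\<close>, \<open>combination_with_prescribed_pole\<close>). If \<open>Q\<^sub>n \<rightarrow> Q\<close>
  geometrically, the recurrence is an exponentially small perturbation of the constant recurrence
  with characteristic polynomial \<open>Q\<close>. Uniqueness of \<open>Q\<^sub>n\<close> says that the sequences coming from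
  \<open>V\<close> exhaust the solutions of the recurrence for large indices. For a zero \<open>\<xi>\<close> of \<open>Q\<close> and \<open>s\<close>
  up to its order, the coefficients of \<open>1 / (z - \<xi>)^s\<close> solve the constant recurrence, and a
  Neumann series corrects them to a solution of the perturbed one by adding the coefficients of a
  function that is analytic in a disk whose radius is as close to \<open>|\<xi>| / \<theta>\<close> as desired. The
  resulting solution is the tail of some \<open>g \<in> V\<close> with exactly one pole in that disk, of order
  \<open>s\<close> at \<open>\<xi>\<close>. Conversely,
  \<open>[z^n] (Q g) = [z^n] ((Q - Q\<^sub>n) g)\<close> shows that \<open>Q g\<close> is analytic in a larger disk than \<open>g\<close>, so no
  \<open>g \<in> V\<close> has a pole of higher order than \<open>Q\<close> has as a zero. Hence the system poles are exactly
  the zeros of \<open>Q\<close>, and \<open>|\<xi>| / R\<^sub>\<xi> \<le> \<theta>\<close>. Together with the first part, this determines \<open>\<theta>\<close>.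
\<close>

section \<open>Coefficient growth and radius of convergence\<close>

lemma coeff_bound_of_conv_radius:
  fixes A :: "complex fps"
  assumes "x > 0" "ereal (1/x) < fps_conv_radius A"
  shows "\<exists>C>0. \<forall>n. norm (fps_nth A n) \<le> C * x ^ n"
proof -
  have "summable (\<lambda>n. fps_nth A n * of_real (1/x) ^ n)"
    using assms by (intro summable_fps) (simp add: norm_divide)
  then have "Bseq (\<lambda>n. fps_nth A n * of_real (1/x) ^ n)"
    by (intro convergent_imp_Bseq) (auto dest: summable_LIMSEQ_zero simp: convergent_def)
  then obtain C where C: "C > 0" "\<And>n. norm (fps_nth A n * of_real (1/x) ^ n) \<le> C"
    by (auto simp: Bseq_def)
  have "norm (fps_nth A n) \<le> C * x ^ n" for n
    using C(2)[of n] assms(1) by (simp add: norm_mult norm_power norm_divide power_divide divide_simps)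
  with C(1) show ?thesis by blast
qed

lemma conv_radius_ge_of_coeff_bound:
  fixes A :: "complex fps"
  assumes "x > 0" "\<And>n. n \<ge> N \<Longrightarrow> norm (fps_nth A n) \<le> C * x ^ n"
  shows "fps_conv_radius A \<ge> ereal (1/x)"
  unfolding fps_conv_radius_def
proof (rule conv_radius_geI_ex')
  fix r :: real assume r: "0 < r" "ereal r < ereal (1/x)"
  then have xr: "norm (x * r) < 1" using assms(1) by (simp add: field_simps abs_mult)
  have "summable (\<lambda>n. C * (x * r) ^ n)"
    using summable_geometric[OF xr] by (rule summable_mult)
  then show "summable (\<lambda>n. fps_nth A n * of_real r ^ n)"
  proof (rule summable_comparison_test[rotated], intro exI allI impI)
    fix n assume "N \<le> n"
    from assms(2)[OF this] r(1)
    have "norm (fps_nth A n) * r ^ n \<le> C * x ^ n * r ^ n"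
      by (intro mult_right_mono) auto
    then show "norm (fps_nth A n * of_real r ^ n) \<le> C * (x * r) ^ n"
      using r(1) by (simp add: norm_mult norm_power power_mult_distrib mult_ac)
  qed
qed

text \<open>
  The sum of the moduli of the coefficients is equivalent to \<open>coeff_norm\<close> on polynomials of
  bounded degree, and it is the norm in which \<open>[z^n] (p A)\<close> is estimated by the size of the
  coefficients of \<open>A\<close>.
\<close>

definition l1_norm :: "complex poly \<Rightarrow> real" where
  "l1_norm p = (\<Sum>i\<le>degree p. norm (coeff p i))"

lemma l1_norm_eq:
  assumes "degree p \<le> M"
  shows "l1_norm p = (\<Sum>i\<le>M. norm (coeff p i))"
  unfolding l1_norm_def
  by (rule sum.mono_neutral_left) (use assms in \<open>auto simp: coeff_eq_0\<close>)

lemma l1_norm_nonneg: "l1_norm p \<ge> 0"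
  by (simp add: l1_norm_def sum_nonneg)

lemma l1_norm_0 [simp]: "l1_norm 0 = 0"
  by (simp add: l1_norm_def)

lemma l1_norm_pos:
  assumes "p \<noteq> 0"
  shows "l1_norm p > 0"
proof -
  have "0 < norm (coeff p (degree p))" using assms by simp
  also have "\<dots> \<le> l1_norm p" unfolding l1_norm_def by (rule member_le_sum) auto
  finally show ?thesis .
qed

lemma norm_coeff_le_l1_norm: "norm (coeff p i) \<le> l1_norm p"
proof (cases "i \<le> degree p")
  case True
  then show ?thesis unfolding l1_norm_def by (intro member_le_sum) auto
qed (simp add: coeff_eq_0 l1_norm_nonneg)

lemma l1_norm_add: "l1_norm (p + q) \<le> l1_norm p + l1_norm q"
proof -
  let ?M = "max (degree p) (degree q)"
  have "l1_norm (p + q) = (\<Sum>i\<le>?M. norm (coeff (p + q) i))"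
    by (rule l1_norm_eq) (rule degree_add_le_max)
  also have "\<dots> \<le> (\<Sum>i\<le>?M. norm (coeff p i) + norm (coeff q i))"
    by (intro sum_mono) (simp add: norm_triangle_ineq)
  also have "\<dots> = l1_norm p + l1_norm q"
    by (simp add: sum.distrib l1_norm_eq[of _ ?M])
  finally show ?thesis .
qed

lemma l1_norm_smult: "l1_norm (smult c p) = norm c * l1_norm p"
  by (cases "c = 0") (simp_all add: l1_norm_def norm_mult sum_distrib_left)

lemma l1_norm_sum: "l1_norm (\<Sum>i\<in>A. p i) \<le> (\<Sum>i\<in>A. l1_norm (p i))"
proof (induction A rule: infinite_finite_induct)
  case (insert x F)
  then show ?case using l1_norm_add[of "p x" "sum p F"] by simp
qed auto

lemma coeff_norm_le_l1_norm: "coeff_norm p \<le> l1_norm p"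
  unfolding coeff_norm_def
  by (subst Max_le_iff) (auto intro: norm_coeff_le_l1_norm)

lemma norm_coeff_le_coeff_norm: "norm (coeff p i) \<le> coeff_norm p"
proof (cases "i \<le> degree p")
  case True
  then show ?thesis unfolding coeff_norm_def by (intro Max_ge) auto
next
  case False
  have "norm (coeff p 0) \<le> coeff_norm p" unfolding coeff_norm_def by (intro Max_ge) auto
  then have "0 \<le> coeff_norm p" by (rule order_trans[OF norm_ge_zero])
  with False show ?thesis by (simp add: coeff_eq_0)
qed

lemma coeff_norm_nonneg: "coeff_norm p \<ge> 0"
  using norm_coeff_le_coeff_norm[of p 0] norm_ge_zero order_trans by blast

lemma l1_norm_le_coeff_norm:
  assumes "degree p \<le> M"
  shows "l1_norm p \<le> real (M + 1) * coeff_norm p"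
proof -
  have "l1_norm p \<le> (\<Sum>i\<le>M. coeff_norm p)"
    unfolding l1_norm_eq[OF assms] by (intro sum_mono norm_coeff_le_coeff_norm)
  then show ?thesis by simp
qed

text \<open>
  The images of the monomials \<open>z^0, \<dots>, z^M\<close> provide the constant. The case that matters is
  \<open>T p = p div N\<close>.
\<close>

lemma l1_norm_linear_bound:
  fixes T :: "complex poly \<Rightarrow> complex poly"
  assumes add: "\<And>p q. T (p + q) = T p + T q" and smult: "\<And>c p. T (smult c p) = smult c (T p)"
  shows "\<exists>C>0. \<forall>p. degree p \<le> M \<longrightarrow> l1_norm (T p) \<le> C * l1_norm p"
proof (intro exI conjI allI impI)
  let ?C = "1 + (\<Sum>i\<le>M. l1_norm (T (monom 1 i)))"
  show "0 < ?C" by (simp add: add_pos_nonneg sum_nonneg l1_norm_nonneg)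
  fix p :: "complex poly" assume p: "degree p \<le> M"
  have T0: "T 0 = 0" using smult[of 0 0] by simp
  have Tsum: "T (sum h A) = (\<Sum>i\<in>A. T (h i))" if "finite A" for h and A :: "nat set"
    using that by induction (simp_all add: T0 add)
  have "p = (\<Sum>i\<le>M. monom (coeff p i) i)"
    using p by (simp add: poly_as_sum_of_monoms')
  then have "p = (\<Sum>i\<le>M. smult (coeff p i) (monom 1 i))"
    by (simp add: smult_monom)
  then have "T p = (\<Sum>i\<le>M. smult (coeff p i) (T (monom 1 i)))"
    using Tsum[of "{..M}" "\<lambda>i. smult (coeff p i) (monom 1 i)"] by (simp add: smult)
  then have "l1_norm (T p) \<le> (\<Sum>i\<le>M. norm (coeff p i) * l1_norm (T (monom 1 i)))"
    using l1_norm_sum[of "\<lambda>i. smult (coeff p i) (T (monom 1 i))" "{..M}"] by (simp add: l1_norm_smult)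
  also have "\<dots> \<le> (\<Sum>i\<le>M. l1_norm p * l1_norm (T (monom 1 i)))"
    by (intro sum_mono mult_right_mono norm_coeff_le_l1_norm l1_norm_nonneg)
  also have "\<dots> = (\<Sum>i\<le>M. l1_norm (T (monom 1 i))) * l1_norm p"
    by (simp add: sum_distrib_left mult_ac)
  also have "\<dots> \<le> ?C * l1_norm p"
    by (intro mult_right_mono l1_norm_nonneg) simp
  finally show "l1_norm (T p) \<le> ?C * l1_norm p" .
qed

lemma fps_of_poly_mult_nth:
  fixes A :: "complex fps"
  assumes "degree p \<le> M"
  shows "fps_nth (fps_of_poly p * A) n = (\<Sum>i\<le>min n M. coeff p i * fps_nth A (n - i))"
proof -
  have "fps_nth (fps_of_poly p * A) n = (\<Sum>i\<le>n. coeff p i * fps_nth A (n - i))"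
    by (simp add: fps_mult_nth atLeast0AtMost)
  also have "\<dots> = (\<Sum>i\<le>min n M. coeff p i * fps_nth A (n - i))"
  proof (rule sum.mono_neutral_right)
    show "\<forall>i\<in>{..n} - {..min n M}. coeff p i * fps_nth A (n - i) = 0"
    proof
      fix i assume "i \<in> {..n} - {..min n M}"
      then have "degree p < i" using assms by auto
      then show "coeff p i * fps_nth A (n - i) = 0" by (simp add: coeff_eq_0)
    qed
  qed auto
  finally show ?thesis .
qed

text \<open>
  The factor \<open>(1 + 1/x)^M\<close> pays for the index shifts \<open>x^(n - i) = x^n (1/x)^i\<close> with \<open>i \<le> M\<close>.
\<close>

lemma norm_poly_mult_nth_le:
  fixes A :: "complex fps"
  assumes "x > 0" "degree p \<le> M" "\<And>k. k + M \<ge> n \<Longrightarrow> norm (fps_nth A k) \<le> C * x ^ k"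
  shows "norm (fps_nth (fps_of_poly p * A) n) \<le> l1_norm p * (C * (1 + 1/x) ^ M * x ^ n)"
proof -
  have C: "C \<ge> 0"
  proof -
    have "0 \<le> C * x ^ n" by (rule order_trans[OF norm_ge_zero assms(3)[of n]]) simp
    then show ?thesis using zero_less_power[OF \<open>x > 0\<close>, of n] by (auto simp: zero_le_mult_iff)
  qed
  have "norm (fps_nth (fps_of_poly p * A) n) \<le> (\<Sum>i\<le>min n M. norm (coeff p i) * norm (fps_nth A (n - i)))"
    unfolding fps_of_poly_mult_nth[OF assms(2)]
    by (rule order_trans[OF norm_sum]) (simp add: norm_mult)
  also have "\<dots> \<le> (\<Sum>i\<le>min n M. norm (coeff p i) * (C * (1 + 1/x) ^ M * x ^ n))"
  proof (intro sum_mono mult_left_mono norm_ge_zero)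
    fix i assume "i \<in> {..min n M}"
    then have i: "i \<le> n" "i \<le> M" by auto
    have "(1/x) ^ i \<le> (1 + 1/x) ^ i" using assms(1) by (intro power_mono) auto
    also have "\<dots> \<le> (1 + 1/x) ^ M" using i assms(1) by (intro power_increasing) auto
    finally have 1: "(1/x) ^ i \<le> (1 + 1/x) ^ M" .
    have "norm (fps_nth A (n - i)) \<le> C * x ^ (n - i)"
      using i by (intro assms(3)) auto
    also have "\<dots> = C * ((1/x) ^ i * x ^ n)"
    proof -
      have "x ^ n = x ^ (n - i) * x ^ i" using i by (simp flip: power_add)
      then show ?thesis using assms(1) by (simp add: power_one_over)
    qed
    also have "\<dots> \<le> C * ((1 + 1/x) ^ M * x ^ n)"
      using 1 C assms(1) by (intro mult_left_mono mult_right_mono) auto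
    finally show "norm (fps_nth A (n - i)) \<le> C * (1 + 1/x) ^ M * x ^ n" by (simp add: mult_ac)
  qed
  also have "\<dots> = (\<Sum>i\<le>min n M. norm (coeff p i)) * (C * (1 + 1/x) ^ M * x ^ n)"
    by (simp add: sum_distrib_right)
  also have "\<dots> \<le> l1_norm p * (C * (1 + 1/x) ^ M * x ^ n)"
    unfolding l1_norm_eq[OF assms(2)]
    using C assms(1) by (intro mult_right_mono sum_mono2) auto
  finally show ?thesis .
qed

section \<open>Poles in terms of power series\<close>

lemma has_fps_expansion_cong_ev:
  assumes "f has_fps_expansion F" "eventually (\<lambda>z. f z = g z) (nhds 0)"
  shows "g has_fps_expansion F"
proof -
  have "eventually (\<lambda>z. eval_fps F z = g z) (nhds 0)"
    using assms by (auto simp: has_fps_expansion_def elim: eventually_elim2)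
  with assms show ?thesis by (simp add: has_fps_expansion_def)
qed

lemma has_fps_expansion_poly: "poly p has_fps_expansion fps_of_poly p"
  for p :: "complex poly"
  using eval_fps_has_fps_expansion[of "fps_of_poly p"] by (simp add: eval_fps_of_poly[abs_def])

text \<open>
  If \<open>P\<close> had order \<open>k < s\<close>, then after cancelling \<open>(z - \<xi>)^k\<close> the left-hand side would vanish at
  \<open>\<xi>\<close> and the right-hand side would not. With \<open>A = P g\<close> and \<open>G = (z - \<xi>)^s g\<close> this says that any
  polynomial that makes \<open>g\<close> analytic beyond the pole \<open>\<xi>\<close> of order \<open>s\<close> is divisible by
  \<open>(z - \<xi>)^s\<close>.
\<close>

lemma order_ge_of_fps_eq:
  fixes P :: "complex poly"
  assumes eq: "fps_of_poly ([:-\<xi>, 1:] ^ s) * A = fps_of_poly P * G"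
    and A: "fps_conv_radius A > norm \<xi>" and G: "fps_conv_radius G > norm \<xi>"
    and nz: "eval_fps G \<xi> \<noteq> 0" and P: "P \<noteq> 0"
  shows "s \<le> order \<xi> P"
proof (rule ccontr)
  assume "\<not> s \<le> order \<xi> P"
  define k where "k = order \<xi> P"
  have k: "k < s" using \<open>\<not> s \<le> order \<xi> P\<close> by (simp add: k_def)
  obtain K where K: "P = [:-\<xi>, 1:] ^ k * K" "\<not> [:-\<xi>, 1:] dvd K"
    using order_decomp[OF P, of \<xi>] by (auto simp: k_def)
  then have "poly K \<xi> \<noteq> 0" by (simp add: poly_eq_0_iff_dvd)
  have split: "[:-\<xi>, 1:] ^ s = [:-\<xi>, 1:] ^ k * [:-\<xi>, 1:] ^ (s - k)"
    using k by (simp flip: power_add)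
  have "fps_of_poly ([:-\<xi>, 1:] ^ k) * (fps_of_poly ([:-\<xi>, 1:] ^ (s - k)) * A) =
        fps_of_poly ([:-\<xi>, 1:] ^ k) * (fps_of_poly K * G)"
    using eq unfolding K(1) split fps_of_poly_mult by (simp only: mult.assoc)
  moreover have "fps_of_poly ([:-\<xi>, 1:] ^ k) \<noteq> 0"
    by (metis fps_of_poly_0 fps_of_poly_eq_iff pCons_eq_0_iff power_not_zero zero_neq_one)
  ultimately have eq': "fps_of_poly ([:-\<xi>, 1:] ^ (s - k)) * A = fps_of_poly K * G"
    by simp
  have "poly ([:-\<xi>, 1:] ^ (s - k)) \<xi> * eval_fps A \<xi> = poly K \<xi> * eval_fps G \<xi>"
    using arg_cong[OF eq', of "\<lambda>F. eval_fps F \<xi>"] A G by (simp add: eval_fps_mult)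
  moreover have "poly ([:-\<xi>, 1:] ^ (s - k)) \<xi> = 0" using k by simp
  ultimately have "poly K \<xi> * eval_fps G \<xi> = 0" by (metis mult_zero_left)
  then show False using nz \<open>poly K \<xi> \<noteq> 0\<close> by simp
qed

lemma cball_subset_imp_ball_subset:
  fixes U :: "complex set"
  assumes "open U" "cball 0 r \<subseteq> U" "r \<ge> 0"
  obtains e where "e > 0" "ball 0 (r + e) \<subseteq> U"
proof -
  obtain e where e: "e > 0" "(\<Union>x\<in>cball 0 r. ball x e) \<subseteq> U"
    using compact_subset_open_imp_ball_epsilon_subset[OF compact_cball assms(1,2)] by blast
  have "z \<in> U" if "norm z < r + e" for z
  proof (cases "norm z \<le> r")
    case True
    then show ?thesis using assms(2) by auto
  next
    case False
    define w where "w = of_real (r / norm z) * z"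
    have nz: "norm z > 0" using False assms(3) by linarith
    have "norm w = r" using nz assms(3) by (simp add: w_def norm_mult norm_divide)
    have "w - z = of_real (r / norm z - 1) * z" by (simp add: w_def algebra_simps)
    then have "norm (w - z) = \<bar>r / norm z - 1\<bar> * norm z" by (simp only: norm_mult norm_of_real)
    also have "\<dots> = norm z - r" using nz False by (simp add: field_simps abs_if)
    finally have "z \<in> ball w e" using that by (simp add: dist_norm)
    moreover have "w \<in> cball 0 r" using \<open>norm w = r\<close> by simp
    ultimately show ?thesis using e(2) by blast
  qed
  with e(1) show ?thesis by (intro that[of e]) auto
qed

text \<open>
  Multiplication by \<open>(z - \<xi>)^s\<close> removes the singularity, and by compactness the open neighbourhood
  of the closed disk contains a concentric disk of larger radius.
\<close>

lemma single_pole_on_disk_imp_fps: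
  assumes "single_pole_on_disk g \<xi> s" "\<xi> \<noteq> 0"
  shows "fps_conv_radius (fps_of_poly ([:-\<xi>, 1:] ^ s) * g) > norm \<xi>"
    and "eval_fps (fps_of_poly ([:-\<xi>, 1:] ^ s) * g) \<xi> \<noteq> 0"
proof -
  obtain F U where U: "open U" "cball 0 (norm \<xi>) \<subseteq> U" and F: "F has_fps_expansion g"
      "F analytic_on (U - {\<xi>})" "is_pole F \<xi>" "zorder F \<xi> = - int s"
    using assms(1) unfolding single_pole_on_disk_def by blast
  have "\<xi> \<in> U" using U(2) by auto
  have holF: "F holomorphic_on U - {\<xi>}" using F(2) by (rule analytic_imp_holomorphic)
  define h where "h = zor_poly F \<xi>"
  obtain r where h: "h \<xi> \<noteq> 0" and r: "r > 0" "cball \<xi> r \<subseteq> U" "h holomorphic_on cball \<xi> r"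
      "\<And>w. w \<in> cball \<xi> r - {\<xi>} \<Longrightarrow> F w = h w / (w - \<xi>) ^ s"
    using zorder_exist_pole[OF holF U(1) \<open>\<xi> \<in> U\<close> F(3)] unfolding F(4) h_def by auto
  define H where "H w = (if w = \<xi> then h \<xi> else F w * (w - \<xi>) ^ s)" for w
  have "H holomorphic_on (ball \<xi> r) \<union> (U - {\<xi>})"
  proof (rule holomorphic_on_Un)
    have "h holomorphic_on ball \<xi> r" using r(3) by (rule holomorphic_on_subset) auto
    moreover have "H w = h w" if "w \<in> ball \<xi> r" for w
      using that r(4)[of w] by (auto simp: H_def)
    ultimately show "H holomorphic_on ball \<xi> r" using holomorphic_cong by blast
    have "(\<lambda>w. F w * (w - \<xi>) ^ s) holomorphic_on U - {\<xi>}"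
      by (intro holomorphic_intros holF)
    then show "H holomorphic_on U - {\<xi>}"
      by (rule holomorphic_transform) (auto simp: H_def)
    show "open (ball \<xi> r)" "open (U - {\<xi>})" using U(1) by auto
  qed
  moreover have "ball \<xi> r \<union> (U - {\<xi>}) = U" using r \<open>\<xi> \<in> U\<close> by (auto simp: subset_iff)
  ultimately have holH: "H holomorphic_on U" by simp
  obtain e where e: "e > 0" "ball 0 (norm \<xi> + e) \<subseteq> U"
    using cball_subset_imp_ball_subset[OF U] by auto
  have holH': "H holomorphic_on ball 0 (norm \<xi> + e)" using holH e(2) by (rule holomorphic_on_subset)
  have "(\<lambda>w. poly ([:-\<xi>, 1:] ^ s) w * F w) has_fps_expansion fps_of_poly ([:-\<xi>, 1:] ^ s) * g"
    by (intro has_fps_expansion_mult has_fps_expansion_poly F)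
  moreover have "eventually (\<lambda>w. w \<in> - {\<xi>}) (nhds 0)"
    using \<open>\<xi> \<noteq> 0\<close> by (intro eventually_nhds_in_open) auto
  then have "eventually (\<lambda>w. poly ([:-\<xi>, 1:] ^ s) w * F w = H w) (nhds 0)"
    by eventually_elim (auto simp: H_def)
  ultimately have exH: "H has_fps_expansion fps_of_poly ([:-\<xi>, 1:] ^ s) * g"
    by (rule has_fps_expansion_cong_ev)
  have "fps_conv_radius (fps_of_poly ([:-\<xi>, 1:] ^ s) * g) \<ge> ereal (norm \<xi> + e)"
    by (rule holomorphic_on_imp_fps_conv_radius_ge[OF exH]) (use holH' in simp)
  moreover have "ereal (norm \<xi>) < ereal (norm \<xi> + e)" using e(1) by simp
  ultimately show "fps_conv_radius (fps_of_poly ([:-\<xi>, 1:] ^ s) * g) > norm \<xi>"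
    by (rule less_le_trans[rotated])
  have "eval_fps (fps_of_poly ([:-\<xi>, 1:] ^ s) * g) \<xi> = H \<xi>"
    by (rule has_fps_expansion_imp_eval_fps_eq[OF exH _ holH']) (use e(1) in simp)
  then show "eval_fps (fps_of_poly ([:-\<xi>, 1:] ^ s) * g) \<xi> \<noteq> 0" using h by (simp add: H_def)
qed

text \<open>
  Conversely, dividing the sum of \<open>(z - \<xi>)^s g\<close> by \<open>(z - \<xi>)^s\<close> gives a function with germ \<open>g\<close>
  and the required pole, on the whole disk of convergence of \<open>(z - \<xi>)^s g\<close>.
\<close>

lemma fps_single_pole:
  fixes g :: "complex fps"
  defines "F \<equiv> (\<lambda>\<xi> s w. eval_fps (fps_of_poly ([:-\<xi>, 1:] ^ s) * g) w / (w - \<xi>) ^ s)"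
  assumes "fps_conv_radius (fps_of_poly ([:-\<xi>, 1:] ^ s) * g) > norm \<xi>"
    and "eval_fps (fps_of_poly ([:-\<xi>, 1:] ^ s) * g) \<xi> \<noteq> 0" "s \<ge> 1" "\<xi> \<noteq> 0"
  shows "F \<xi> s has_fps_expansion g"
    and "F \<xi> s analytic_on (eball 0 (fps_conv_radius (fps_of_poly ([:-\<xi>, 1:] ^ s) * g)) - {\<xi>})"
    and "is_pole (F \<xi> s) \<xi>" and "zorder (F \<xi> s) \<xi> = - int s"
proof -
  define G where "G = fps_of_poly ([:-\<xi>, 1:] ^ s) * g"
  define U :: "complex set" where "U = eball 0 (fps_conv_radius G)"
  have U: "\<xi> \<in> U" "open U" using assms(2) by (auto simp: U_def G_def)
  have hol: "eval_fps G holomorphic_on U" by (intro holomorphic_intros) (simp add: U_def)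
  have F: "F \<xi> s = (\<lambda>w. eval_fps G w / (w - \<xi>) ^ s)" by (simp add: F_def G_def fun_eq_iff)
  have nz: "eval_fps G \<xi> \<noteq> 0" using assms by (simp add: G_def)
  have nz0: "fps_nth (fps_of_poly ([:-\<xi>, 1:] ^ s)) 0 \<noteq> 0"
    using \<open>\<xi> \<noteq> 0\<close> by (simp add: poly_0_coeff_0[symmetric])
  have "(\<lambda>w. eval_fps G w / poly ([:-\<xi>, 1:] ^ s) w) has_fps_expansion G / fps_of_poly ([:-\<xi>, 1:] ^ s)"
  proof (rule has_fps_expansion_divide')
    have "0 < fps_conv_radius G"
      using assms(2) unfolding G_def by (rule le_less_trans[rotated]) simp
    then show "eval_fps G has_fps_expansion G" by (rule eval_fps_has_fps_expansion)
  next
    show "poly ([:-\<xi>, 1:] ^ s) has_fps_expansion fps_of_poly ([:-\<xi>, 1:] ^ s)"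
      by (rule has_fps_expansion_poly)
  qed (use nz0 in simp)
  moreover have "G / fps_of_poly ([:-\<xi>, 1:] ^ s) = g"
    unfolding G_def using nz0 by (intro nonzero_mult_div_cancel_left) auto
  ultimately show "F \<xi> s has_fps_expansion g" unfolding F by simp
  have "(\<lambda>w. eval_fps G w / (w - \<xi>) ^ s) holomorphic_on U - {\<xi>}"
    by (intro holomorphic_intros holomorphic_on_subset[OF hol]) auto
  then show "F \<xi> s analytic_on (eball 0 (fps_conv_radius (fps_of_poly ([:-\<xi>, 1:] ^ s) * g)) - {\<xi>})"
    unfolding F using U(2) by (subst analytic_on_open) (auto simp: U_def G_def)
  show "is_pole (F \<xi> s) \<xi>"
    unfolding F using is_pole_basic[OF hol U(2,1) nz, of s] \<open>s \<ge> 1\<close> by simp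
  show "zorder (F \<xi> s) \<xi> = - int s"
    by (rule zorder_eqI[OF U(2,1) hol nz]) (simp add: F power_int_minus field_simps)
qed

lemma single_pole_on_disk_iff_fps:
  assumes "\<xi> \<noteq> 0" "s \<ge> 1"
  shows "single_pole_on_disk g \<xi> s \<longleftrightarrow>
    fps_conv_radius (fps_of_poly ([:-\<xi>, 1:] ^ s) * g) > norm \<xi> \<and>
    eval_fps (fps_of_poly ([:-\<xi>, 1:] ^ s) * g) \<xi> \<noteq> 0"
proof (intro iffI conjI)
  assume *: "fps_conv_radius (fps_of_poly ([:-\<xi>, 1:] ^ s) * g) > norm \<xi> \<and>
    eval_fps (fps_of_poly ([:-\<xi>, 1:] ^ s) * g) \<xi> \<noteq> 0"
  note F = fps_single_pole[OF conjunct1[OF *] conjunct2[OF *] assms(2,1)]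
  let ?U = "eball (0 :: complex) (fps_conv_radius (fps_of_poly ([:-\<xi>, 1:] ^ s) * g))"
  have "cball 0 (norm \<xi>) \<subseteq> ?U"
  proof
    fix x :: complex assume "x \<in> cball 0 (norm \<xi>)"
    then have "ereal (norm x) \<le> ereal (norm \<xi>)" by simp
    also have "\<dots> < fps_conv_radius (fps_of_poly ([:-\<xi>, 1:] ^ s) * g)" using * by simp
    finally show "x \<in> ?U" by simp
  qed
  then show "single_pole_on_disk g \<xi> s"
    unfolding single_pole_on_disk_def using F by blast
qed (use assms single_pole_on_disk_imp_fps in auto)

lemma mero_radius_ge:
  fixes \<rho> :: ereal
  assumes "single_pole_on_disk g \<xi> s" "\<xi> \<noteq> 0" "s \<ge> 1"
    and "\<rho> \<le> fps_conv_radius (fps_of_poly ([:-\<xi>, 1:] ^ s) * g)" "norm \<xi> < \<rho>"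
  shows "\<rho> \<le> mero_radius s g"
  unfolding mero_radius_def
proof (rule Sup_upper, rule CollectI, rule disjI2)
  let ?G = "fps_of_poly ([:-\<xi>, 1:] ^ s) * g"
  let ?F = "\<lambda>w. eval_fps ?G w / (w - \<xi>) ^ s"
  note F = fps_single_pole[OF single_pole_on_disk_imp_fps[OF assms(1,2)] assms(3,2)]
  have "\<rho> > 0" using assms(5) by (rule le_less_trans[rotated]) simp
  have sub: "eball (0 :: complex) \<rho> \<subseteq> eball 0 (fps_conv_radius ?G)" using assms(4) by (rule eball_mono)
  have mero: "?F meromorphic_on eball 0 \<rho>"
    by (intro meromorphic_intros) (use sub in \<open>auto simp: subset_iff\<close>)
  have "\<not> is_pole ?F z" if "z \<in> eball 0 \<rho>" "z \<noteq> \<xi>" for z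
  proof -
    have "?F analytic_on {z}" using F(2) by (rule analytic_on_subset) (use that sub in auto)
    then show ?thesis by (rule analytic_at_imp_no_pole)
  qed
  then have "{z \<in> eball 0 \<rho>. is_pole ?F z} = {\<xi>}" using F(3) assms(5) by auto
  with \<open>\<rho> > 0\<close> mero F show "\<rho> > 0 \<and> (\<exists>F. F meromorphic_on eball 0 \<rho> \<and> F has_fps_expansion g \<and>
      finite {z \<in> eball 0 \<rho>. is_pole F z} \<and>
      (\<Sum>z\<in>{z \<in> eball 0 \<rho>. is_pole F z}. nat (- zorder F z)) \<le> s)"
    by (intro conjI exI[of _ ?F]) auto
qed

text \<open>
  \<open>P\<close> is the product of the linear factors of the poles, with multiplicities. Then \<open>P F\<close> has only
  removable singularities; \<open>remove_sings\<close> is applied because a meromorphic \<open>F\<close> may take wrong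
  values on a discrete set even where it has no pole.
\<close>

lemma mero_radius_gtE:
  fixes \<rho> :: ereal
  assumes "mero_radius s g > \<rho>" "\<rho> \<ge> 0"
  obtains P where "P \<noteq> 0" "degree P \<le> s" "fps_conv_radius (fps_of_poly P * g) > \<rho>"
proof -
  obtain \<rho>' F where \<rho>': "\<rho>' > \<rho>" and F: "F meromorphic_on eball 0 \<rho>'" "F has_fps_expansion g"
      and fin: "finite {z \<in> eball 0 \<rho>'. is_pole F z}"
      and sum: "(\<Sum>z\<in>{z \<in> eball 0 \<rho>'. is_pole F z}. nat (- zorder F z)) \<le> s"
    using assms unfolding mero_radius_def less_Sup_iff by auto
  define S where "S = {z \<in> eball 0 \<rho>'. is_pole F z}"
  define P where "P = (\<Prod>z\<in>S. [:-z, 1:] ^ nat (- zorder F z))"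
  have "degree P = (\<Sum>z\<in>S. nat (- zorder F z))"
    unfolding P_def by (subst degree_prod_eq_sum_degree) (auto simp: degree_linear_power)
  then have deg: "degree P \<le> s" using sum by (simp add: S_def)
  have "P \<noteq> 0" unfolding P_def using fin by (simp add: S_def)
  define \<Phi> where "\<Phi> = (\<lambda>z. poly P z * F z)"
  have \<Phi>: "\<Phi> meromorphic_on eball 0 \<rho>'"
    unfolding \<Phi>_def by (intro meromorphic_on_mult F(1) analytic_on_imp_meromorphic_on)
      (auto simp: analytic_on_open intro!: holomorphic_intros)
  have lim: "\<exists>c. \<Phi> \<midarrow>z\<rightarrow> c" if z: "z \<in> eball 0 \<rho>'" for z
  proof (cases "is_pole F z")
    case False
    have "F meromorphic_on {z}" using F(1) by (rule meromorphic_on_subset) (use z in auto)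
    then have "not_essential F z" by (rule meromorphic_on_not_essential)
    then obtain c where "F \<midarrow>z\<rightarrow> c" using False by (auto simp: not_essential_def)
    then have "\<Phi> \<midarrow>z\<rightarrow> poly P z * c" unfolding \<Phi>_def by (intro tendsto_intros)
    then show ?thesis ..
  next
    case True
    then have "z \<in> S" using z by (simp add: S_def)
    have "F meromorphic_on {z}" using F(1) by (rule meromorphic_on_subset) (use z in auto)
    then have "isolated_singularity_at F z" by (rule meromorphic_on_isolated_singularity)
    then obtain A where A: "open A" "z \<in> A" "F holomorphic_on (A - {z})"
      using analytic_imp_holomorphic isolated_singularity_at_iff_analytic_nhd by auto
    define h where "h = zor_poly F z"
    define n where "n = nat (- zorder F z)"
    obtain r where r: "r > 0" "h holomorphic_on cball z r"
      "\<And>w. w \<in> cball z r - {z} \<Longrightarrow> F w = h w / (w - z) ^ n"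
      using zorder_exist_pole[OF A(3,1,2) True] unfolding h_def n_def by auto
    define R where "R = (\<Prod>y\<in>S - {z}. [:-y, 1:] ^ nat (- zorder F y))"
    have PR: "P = [:-z, 1:] ^ n * R"
      unfolding P_def R_def n_def using \<open>z \<in> S\<close> fin by (intro prod.remove) (auto simp: S_def)
    have "continuous_on (cball z r) h" using r(2) by (rule holomorphic_on_imp_continuous_on)
    then have "isCont h z" using r(1) by (auto intro: continuous_on_interior)
    then have "(\<lambda>w. poly R w * h w) \<midarrow>z\<rightarrow> poly R z * h z"
      by (intro tendsto_intros) (simp add: isContD)
    moreover have "eventually (\<lambda>w. w \<in> ball z r - {z}) (at z)"
      using r(1) by (intro eventually_at_in_open) auto
    then have "eventually (\<lambda>w. poly R w * h w = \<Phi> w) (at z)"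
      by eventually_elim (use r(3) in \<open>auto simp: \<Phi>_def PR\<close>)
    ultimately have "\<Phi> \<midarrow>z\<rightarrow> poly R z * h z" by (rule Lim_transform_eventually)
    then show ?thesis ..
  qed
  have "remove_sings \<Phi> analytic_on {z}" if "z \<in> eball 0 \<rho>'" for z
  proof -
    have "\<Phi> meromorphic_on {z}" using \<Phi> by (rule meromorphic_on_subset) (use that in auto)
    then have "isolated_singularity_at \<Phi> z" by (rule meromorphic_on_isolated_singularity)
    then show ?thesis using lim[OF that] remove_sings_analytic_at by blast
  qed
  then have "remove_sings \<Phi> analytic_on eball 0 \<rho>'" by (subst analytic_on_analytic_at) blast
  then have hol: "remove_sings \<Phi> holomorphic_on eball 0 \<rho>'" by (rule analytic_imp_holomorphic)
  have ex: "\<Phi> has_fps_expansion fps_of_poly P * g"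
    unfolding \<Phi>_def by (intro has_fps_expansion_mult has_fps_expansion_poly F)
  then have "\<Phi> analytic_on {0}" by (rule has_fps_expansion_imp_analytic_0)
  then have "eventually (\<lambda>w. remove_sings \<Phi> w = \<Phi> w) (nhds 0)"
    by (rule eventually_remove_sings_eq_nhds)
  then have "remove_sings \<Phi> has_fps_expansion fps_of_poly P * g"
    by (intro has_fps_expansion_cong_ev[OF ex]) (auto elim: eventually_mono)
  then have "fps_conv_radius (fps_of_poly P * g) \<ge> \<rho>'"
    using hol by (rule holomorphic_on_imp_fps_conv_radius_ge)
  with \<rho>' have "fps_conv_radius (fps_of_poly P * g) > \<rho>" by simp
  with \<open>P \<noteq> 0\<close> deg show ?thesis by (rule that)
qed

text \<open>
  The pole at \<open>\<xi>\<close> already uses up the \<open>s\<close> poles that the disk may contain: the polynomial of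
  \<open>mero_radius_gtE\<close> is divisible by \<open>(z - \<xi>)^s\<close> and has degree at most \<open>s\<close>.
\<close>

lemma single_pole_mero_radius_gt:
  fixes \<rho> :: ereal
  assumes "single_pole_on_disk g \<xi> s" "\<xi> \<noteq> 0" "mero_radius s g > \<rho>" "norm \<xi> \<le> \<rho>"
  shows "fps_conv_radius (fps_of_poly ([:-\<xi>, 1:] ^ s) * g) > \<rho>"
proof -
  let ?G = "fps_of_poly ([:-\<xi>, 1:] ^ s) * g"
  note G = single_pole_on_disk_imp_fps[OF assms(1,2)]
  have "\<rho> \<ge> 0" using assms(4) by (rule order_trans[rotated]) simp
  with assms(3) obtain P where P: "P \<noteq> 0" "degree P \<le> s" "fps_conv_radius (fps_of_poly P * g) > \<rho>"
    by (rule mero_radius_gtE)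
  have "fps_of_poly ([:-\<xi>, 1:] ^ s) * (fps_of_poly P * g) = fps_of_poly P * ?G"
    by (simp only: mult_ac)
  then have "s \<le> order \<xi> P"
    using G P(1) le_less_trans[OF assms(4) P(3)] by (intro order_ge_of_fps_eq)
  then have "[:-\<xi>, 1:] ^ s dvd P" using P(1) by (simp add: order_divides)
  then obtain C where C: "P = [:-\<xi>, 1:] ^ s * C" ..
  with P(1) have nz: "C \<noteq> 0" by auto
  have "degree P = s + degree C"
    unfolding C using nz by (subst degree_mult_eq) (auto simp: degree_linear_power)
  with P(2) have "degree C = 0" by simp
  then obtain c where c: "C = [:c:]" by (rule degree_eq_zeroE)
  with nz have "c \<noteq> 0" by auto
  have "fps_of_poly P * g = fps_const c * ?G"
    by (simp add: C c fps_of_poly_mult fps_of_poly_const mult_ac)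
  with P(3) \<open>c \<noteq> 0\<close> show ?thesis by (simp add: fps_conv_radius_cmult_left)
qed

section \<open>Hermite-Pade denominators as annihilators\<close>

text \<open>
  This linear condition on \<open>Q\<close> replaces the existence of the numerators \<open>P\<^sub>k\<close>.
\<close>

definition annihilates :: "complex fps set \<Rightarrow> nat \<Rightarrow> complex poly \<Rightarrow> bool" where
  "annihilates V n Q \<longleftrightarrow> (\<forall>g\<in>V. fps_nth (fps_of_poly Q * g) n = 0)"

lemma annihilates_smult: "annihilates V n p \<Longrightarrow> annihilates V n (smult c p)"
  by (simp add: annihilates_def fps_of_poly_smult mult.assoc)

lemma annihilates_diff: "annihilates V n p \<Longrightarrow> annihilates V n q \<Longrightarrow> annihilates V n (p - q)"
  by (simp add: annihilates_def fps_of_poly_diff left_diff_distrib)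

lemma poly_combs_add:
  assumes "g \<in> poly_combs d f m" "h \<in> poly_combs d f m"
  shows "g + h \<in> poly_combs d f m"
proof -
  obtain p q where "g = (\<Sum>k=1..d. fps_of_poly (p k) * f k)" "\<forall>k\<in>{1..d}. degree (p k) < m k"
      "h = (\<Sum>k=1..d. fps_of_poly (q k) * f k)" "\<forall>k\<in>{1..d}. degree (q k) < m k"
    using assms unfolding poly_combs_def by blast
  then have "g + h = (\<Sum>k=1..d. fps_of_poly (p k + q k) * f k)"
      "\<forall>k\<in>{1..d}. degree (p k + q k) < m k"
    by (auto simp: fps_of_poly_add distrib_right sum.distrib intro: degree_add_less)
  then show ?thesis unfolding poly_combs_def by (intro CollectI exI[of _ "\<lambda>k. p k + q k"]) simp
qed

lemma poly_combs_scale: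
  assumes "g \<in> poly_combs d f m"
  shows "fps_const c * g \<in> poly_combs d f m"
proof -
  obtain p where "g = (\<Sum>k=1..d. fps_of_poly (p k) * f k)" "\<forall>k\<in>{1..d}. degree (p k) < m k"
    using assms unfolding poly_combs_def by blast
  then have "fps_const c * g = (\<Sum>k=1..d. fps_of_poly (smult c (p k)) * f k)"
      "\<forall>k\<in>{1..d}. degree (smult c (p k)) < m k"
    by (auto simp: fps_of_poly_smult sum_distrib_left mult.assoc intro: le_less_trans[OF degree_smult_le])
  then show ?thesis unfolding poly_combs_def by (intro CollectI exI[of _ "\<lambda>k. smult c (p k)"]) simp
qed

lemma X_power_mult_in_poly_combs:
  assumes "k \<in> {1..d}" "i < m k" "\<forall>k\<in>{1..d}. m k \<ge> 1"
  shows "fps_X ^ i * f k \<in> poly_combs d f m"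
proof -
  define p :: "nat \<Rightarrow> complex poly" where "p j = (if j = k then monom 1 i else 0)" for j
  have "(\<Sum>j=1..d. fps_of_poly (p j) * f j) = (\<Sum>j=1..d. if j = k then fps_X ^ i * f k else 0)"
    by (intro sum.cong) (auto simp: p_def fps_of_poly_monom')
  also have "\<dots> = fps_X ^ i * f k" using assms(1) by simp
  finally have "fps_X ^ i * f k = (\<Sum>j=1..d. fps_of_poly (p j) * f j)" by simp
  moreover have "\<forall>j\<in>{1..d}. degree (p j) < m j"
    using assms by (auto simp: p_def degree_monom_eq Suc_le_eq)
  ultimately show ?thesis unfolding poly_combs_def by blast
qed

text \<open>
  The degree bound on \<open>P\<^sub>k\<close> makes the coefficients of \<open>Q f\<^sub>k\<close> vanish at the indices
  \<open>n - m\<^sub>k < j \<le> n\<close>, and these are the only ones that \<open>[z^n] (p\<^sub>k Q f\<^sub>k)\<close> involves.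
\<close>

lemma hermite_pade_imp_annihilates:
  assumes "hermite_pade d f m n Q P"
  shows "annihilates (poly_combs d f m) n Q"
  unfolding annihilates_def
proof
  fix g assume "g \<in> poly_combs d f m"
  then obtain p where g: "g = (\<Sum>k=1..d. fps_of_poly (p k) * f k)" "\<forall>k\<in>{1..d}. degree (p k) < m k"
    unfolding poly_combs_def by blast
  have 0: "fps_nth (fps_of_poly (p k) * (fps_of_poly Q * f k)) n = 0" if k: "k \<in> {1..d}" for k
  proof -
    have P: "degree (P k) + m k \<le> n" "\<And>j. j \<le> n \<Longrightarrow> fps_nth (fps_of_poly Q * f k) j = coeff (P k) j"
      using assms k by (auto simp: hermite_pade_def)
    have "coeff (p k) i * fps_nth (fps_of_poly Q * f k) (n - i) = 0" if "i \<in> {..n}" for i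
    proof (cases "i < m k")
      case True
      then have "degree (P k) < n - i" using P(1) that by simp
      then show ?thesis using P(2)[of "n - i"] by (simp add: coeff_eq_0)
    next
      case False
      then have "degree (p k) < i" using bspec[OF g(2) k] by simp
      then show ?thesis by (simp add: coeff_eq_0)
    qed
    then show ?thesis
      unfolding fps_mult_nth[of "fps_of_poly (p k)"] atLeast0AtMost fps_of_poly_nth by (intro sum.neutral) blast
  qed
  have "fps_of_poly Q * g = (\<Sum>k=1..d. fps_of_poly (p k) * (fps_of_poly Q * f k))"
    by (simp add: g(1) sum_distrib_left mult_ac)
  then show "fps_nth (fps_of_poly Q * g) n = 0" using 0 by (simp add: fps_sum_nth)
qed

text \<open>
  The numerators are the truncations of \<open>Q f\<^sub>k\<close>; testing with \<open>g = z^(n - j) f\<^sub>k\<close> shows that the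
  coefficients between the truncation degree and \<open>n\<close> vanish.
\<close>

lemma annihilates_imp_hermite_pade:
  assumes "annihilates (poly_combs d f m) n Q" "Q \<noteq> 0" "degree Q \<le> mi_size d m"
    and n: "\<forall>k\<in>{1..d}. m k \<ge> 1 \<and> m k \<le> n"
  shows "\<exists>P. hermite_pade d f m n Q P"
proof -
  define P where "P k = (\<Sum>j\<le>n - m k. monom (fps_nth (fps_of_poly Q * f k) j) j)" for k
  have coeff_P: "coeff (P k) j = (if j \<le> n - m k then fps_nth (fps_of_poly Q * f k) j else 0)" for k j
    by (simp add: P_def coeff_sum)
  have "degree (P k) + m k \<le> n \<and> (\<forall>j\<le>n. fps_nth (fps_of_poly Q * f k - fps_of_poly (P k)) j = 0)"
    if k: "k \<in> {1..d}" for k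
  proof (intro conjI allI impI)
    have "degree (P k) \<le> n - m k" by (rule degree_le) (simp add: coeff_P)
    then show "degree (P k) + m k \<le> n" using n k by (simp add: le_diff_conv2)
    fix j assume j: "j \<le> n"
    have "fps_nth (fps_of_poly Q * f k) j = 0" if "\<not> j \<le> n - m k"
    proof -
      have "n - j < m k" using that j n k by auto
      then have "fps_X ^ (n - j) * f k \<in> poly_combs d f m"
        using n k by (intro X_power_mult_in_poly_combs) auto
      then have "fps_nth (fps_of_poly Q * (fps_X ^ (n - j) * f k)) n = 0"
        using assms(1) by (auto simp: annihilates_def)
      moreover have "fps_of_poly Q * (fps_X ^ (n - j) * f k) = fps_X ^ (n - j) * (fps_of_poly Q * f k)"
        by (simp only: mult_ac)
      ultimately show ?thesis using j by (auto simp: fps_X_power_mult_nth split: if_splits)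
    qed
    then show "fps_nth (fps_of_poly Q * f k - fps_of_poly (P k)) j = 0"
      by (simp add: coeff_P)
  qed
  with assms(2,3) show ?thesis unfolding hermite_pade_def by blast
qed

text \<open>
  \<open>G\<close> is a common divisor of maximal degree, up to a scalar that makes \<open>q\<close> monic.
\<close>

lemma hermite_pade_reduce:
  assumes "hermite_pade d f m n Q P"
  obtains G q where "hermite_pade_denom d f m n q" "Q = G * q" "G \<noteq> 0"
proof -
  have Q: "Q \<noteq> 0" using assms by (simp add: hermite_pade_def)
  define D where "D G \<longleftrightarrow> G dvd Q \<and> (\<forall>k\<in>{1..d}. G dvd P k)" for G
  have "D 1" by (simp add: D_def)
  moreover have "\<forall>G. D G \<longrightarrow> degree G \<le> degree Q"
    using Q by (auto simp: D_def intro: dvd_imp_degree_le)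
  ultimately obtain G where G: "D G" "\<And>G'. D G' \<Longrightarrow> degree G' \<le> degree G"
    using ex_has_greatest_nat[of D 1 degree "Suc (degree Q)"] by (auto simp: less_Suc_eq_le)
  define q where "q = Q div G"
  define p where "p k = P k div G" for k
  have q: "Q = G * q" and p: "\<And>k. k \<in> {1..d} \<Longrightarrow> P k = G * p k"
    using G(1) by (auto simp: D_def q_def p_def)
  have nz: "G \<noteq> 0" "q \<noteq> 0" using Q q by auto
  have no_root: False if "poly q z = 0" "\<forall>k\<in>{1..d}. poly (p k) z = 0" for z
  proof -
    have "[:-z, 1:] dvd q" "\<And>k. k \<in> {1..d} \<Longrightarrow> [:-z, 1:] dvd p k"
      using that by (auto simp: poly_eq_0_iff_dvd)
    then have "D (G * [:-z, 1:])" using q p by (auto simp: D_def simp del: mult_pCons_right intro!: mult_dvd_mono)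
    from G(2)[OF this] show False using nz(1) by (simp add: degree_mult_eq del: mult_pCons_right)
  qed
  define c where "c = lead_coeff q"
  have "c \<noteq> 0" using nz by (simp add: c_def)
  have "hermite_pade_denom d f m n (smult (1/c) q)"
    unfolding hermite_pade_denom_def
  proof (intro conjI exI)
    show "lead_coeff (smult (1/c) q) = 1" using \<open>c \<noteq> 0\<close> by (simp add: c_def)
    show "hermite_pade d f m n Q P" by fact
    show "Q = smult c G * smult (1/c) q" using q \<open>c \<noteq> 0\<close> by simp
    show "\<forall>k\<in>{1..d}. P k = smult c G * smult (1/c) (p k)" using p \<open>c \<noteq> 0\<close> by simp
    show "\<nexists>z. poly (smult (1/c) q) z = 0 \<and> (\<forall>k\<in>{1..d}. poly (smult (1/c) (p k)) z = 0)"
      using no_root \<open>c \<noteq> 0\<close> by auto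
  qed
  then show ?thesis by (rule that[of _ "smult c G"]) (use q nz \<open>c \<noteq> 0\<close> in auto)
qed

lemma degree_hermite_pade_denom_le:
  assumes "hermite_pade_denom d f m n q"
  shows "degree q \<le> mi_size d m" "q \<noteq> 0"
proof -
  obtain Q G where Q: "Q \<noteq> 0" "degree Q \<le> mi_size d m" "Q = G * q"
    using assms unfolding hermite_pade_denom_def hermite_pade_def by blast
  then show "degree q \<le> mi_size d m" "q \<noteq> 0" by (auto simp: degree_mult_eq)
qed

text \<open>
  A denominator of full degree leaves no room for a cancelled factor of positive degree.
\<close>

lemma hermite_pade_denom_annihilates:
  assumes "hermite_pade_denom d f m n q" "degree q = mi_size d m"
  shows "annihilates (poly_combs d f m) n q"
proof -
  obtain Q P G where Q: "Q \<noteq> 0" "degree Q \<le> mi_size d m" "Q = G * q" "hermite_pade d f m n Q P"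
    using assms unfolding hermite_pade_denom_def hermite_pade_def by blast
  then have "degree G = 0" using assms(2) by (auto simp: degree_mult_eq)
  then obtain c where c: "G = [:c:]" by (rule degree_eq_zeroE)
  with Q have "q = smult (1/c) Q" by auto
  then show ?thesis using hermite_pade_imp_annihilates[OF Q(4)] annihilates_smult by metis
qed

text \<open>
  Uniqueness of the reduced monic denominator, when it has full degree, means that the space of all
  annihilators is a line: reducing any annihilator leads to \<open>q\<close>, and the cancelled factor is
  constant for reasons of degree.
\<close>

lemma annihilator_unique_of_denom_unique:
  assumes ex1: "\<exists>!q. hermite_pade_denom d f m n q"
    and q: "hermite_pade_denom d f m n q" "degree q = mi_size d m"
    and n: "\<forall>k\<in>{1..d}. m k \<ge> 1 \<and> m k \<le> n"
    and Q: "annihilates (poly_combs d f m) n Q" "degree Q \<le> mi_size d m"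
  shows "\<exists>c. Q = smult c q"
proof (cases "Q = 0")
  case True
  then show ?thesis by (intro exI[of _ 0]) simp
next
  case False
  then obtain P where "hermite_pade d f m n Q P"
    using annihilates_imp_hermite_pade[OF Q(1) _ Q(2) n] by blast
  then obtain G q' where G: "hermite_pade_denom d f m n q'" "Q = G * q'" "G \<noteq> 0"
    by (rule hermite_pade_reduce)
  with ex1 q(1) have "q' = q" by blast
  then have "degree G = 0" using G Q(2) False q(2) by (auto simp: degree_mult_eq)
  then obtain c where "G = [:c:]" by (rule degree_eq_zeroE)
  then show ?thesis using G \<open>q' = q\<close> by auto
qed

lemma fps_mult_nth_eq_0_cancel:
  fixes A B :: "complex fps"
  assumes "fps_nth A 0 \<noteq> 0" "\<forall>j\<le>n. fps_nth (A * B) j = 0" "j \<le> n"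
  shows "fps_nth B j = 0"
proof -
  have "B = inverse A * (A * B)"
    using assms(1) by (simp add: mult.assoc[symmetric] inverse_mult_eq_1)
  then have "fps_nth B j = (\<Sum>i=0..j. fps_nth (inverse A) i * fps_nth (A * B) (j - i))"
    by (metis fps_mult_nth)
  also have "\<dots> = 0" using assms(2,3) by (intro sum.neutral) auto
  finally show ?thesis .
qed

text \<open>
  When all annihilators have full degree and do not vanish at \<open>0\<close>, nothing is ever cancelled in the
  reduction. A common zero \<open>z \<noteq> 0\<close> could be divided out without losing the order of contact at the
  origin, and this would produce an annihilator of smaller degree.
\<close>

lemma hermite_pade_denom_of_full_degree:
  assumes full: "\<And>Q. annihilates (poly_combs d f m) n Q \<Longrightarrow> degree Q \<le> mi_size d m \<Longrightarrow> Q \<noteq> 0 \<Longrightarrow>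
      degree Q = mi_size d m \<and> poly Q 0 \<noteq> 0"
    and q: "hermite_pade_denom d f m n q"
  shows "degree q = mi_size d m" "annihilates (poly_combs d f m) n q"
proof -
  let ?M = "mi_size d m"
  obtain Q P G p where Q: "hermite_pade d f m n Q P" "Q = G * q" "\<And>k. k \<in> {1..d} \<Longrightarrow> P k = G * p k"
    using q unfolding hermite_pade_denom_def by blast
  have Q': "Q \<noteq> 0" "degree Q \<le> ?M" using Q(1) by (auto simp: hermite_pade_def)
  have *: "degree Q = ?M" "poly Q 0 \<noteq> 0"
    using full[OF hermite_pade_imp_annihilates[OF Q(1)] Q'(2,1)] by auto
  have "degree G = 0"
  proof (rule ccontr)
    assume "degree G \<noteq> 0"
    then obtain z where z: "poly G z = 0" using alg_closed_imp_poly_has_root[of G] by auto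
    have "z \<noteq> 0" using *(2) z Q(2) by auto
    from z obtain G' where G': "G = [:-z, 1:] * G'" by (auto simp: poly_eq_0_iff_dvd)
    have nz: "G' \<noteq> 0" "q \<noteq> 0" using Q' Q(2) G' by auto
    have deg: "degree (G' * q) < degree Q"
      unfolding Q(2) G' using nz by (simp add: degree_mult_eq del: mult_pCons_left)
    have "hermite_pade d f m n (G' * q) (\<lambda>k. G' * p k)"
      unfolding hermite_pade_def
    proof (intro conjI ballI allI impI)
      show "G' * q \<noteq> 0" using nz by simp
      show "degree (G' * q) \<le> ?M" using deg * by simp
      fix k assume k: "k \<in> {1..d}"
      have hp: "degree (P k) + m k \<le> n"
          "\<forall>j\<le>n. fps_nth (fps_of_poly Q * f k - fps_of_poly (P k)) j = 0"
        using Q(1) k by (auto simp: hermite_pade_def)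
      have Pk: "P k = [:-z, 1:] * (G' * p k)" using Q(3)[OF k] G' by (simp only: mult.assoc)
      have "degree (G' * p k) \<le> degree (P k)"
      proof (cases "G' * p k = 0")
        case False
        then show ?thesis unfolding Pk by (subst degree_mult_eq) auto
      qed auto
      then show "degree (G' * p k) + m k \<le> n" using hp(1) by simp
      fix j assume j: "j \<le> n"
      have "fps_of_poly Q * f k - fps_of_poly (P k) =
          fps_of_poly [:-z, 1:] * (fps_of_poly (G' * q) * f k - fps_of_poly (G' * p k))"
        unfolding Q(2) G' Pk fps_of_poly_mult by (simp add: algebra_simps)
      with hp(2) have "\<forall>j\<le>n. fps_nth (fps_of_poly [:-z, 1:] *
          (fps_of_poly (G' * q) * f k - fps_of_poly (G' * p k))) j = 0" by simp
      then show "fps_nth (fps_of_poly (G' * q) * f k - fps_of_poly (G' * p k)) j = 0"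
        by (rule fps_mult_nth_eq_0_cancel[rotated]) (use \<open>z \<noteq> 0\<close> j in auto)
    qed
    then have "annihilates (poly_combs d f m) n (G' * q)" by (rule hermite_pade_imp_annihilates)
    then have "degree (G' * q) = ?M" using full nz deg *(1) by (metis less_imp_le mult_eq_0_iff)
    then show False using deg *(1) by simp
  qed
  then show "degree q = ?M" using * Q(2) Q'(1) by (auto simp: degree_mult_eq)
  then show "annihilates (poly_combs d f m) n q" by (rule hermite_pade_denom_annihilates[OF q])
qed

text \<open>
  The difference of two monic annihilators of full degree is an annihilator of smaller degree.
\<close>

lemma hermite_pade_denom_unique_of_full_degree:
  assumes full: "\<And>Q. annihilates (poly_combs d f m) n Q \<Longrightarrow> degree Q \<le> mi_size d m \<Longrightarrow> Q \<noteq> 0 \<Longrightarrow>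
      degree Q = mi_size d m \<and> poly Q 0 \<noteq> 0"
    and "mi_size d m \<ge> 1"
    and q: "hermite_pade_denom d f m n q" "hermite_pade_denom d f m n q'"
  shows "q = q'"
proof (rule ccontr)
  assume "q \<noteq> q'"
  note 1 = hermite_pade_denom_of_full_degree[OF full q(1)]
  note 2 = hermite_pade_denom_of_full_degree[OF full q(2)]
  have "coeff q (mi_size d m) = 1" "coeff q' (mi_size d m) = 1"
    using q 1 2 by (auto simp: hermite_pade_denom_def)
  then have "degree (q - q') < mi_size d m"
    using 1 2 assms(2) by (intro degree_lessI) (auto simp: coeff_eq_0 le_less)
  moreover have "annihilates (poly_combs d f m) n (q - q')" using 1 2 by (intro annihilates_diff)
  ultimately show False using full[of "q - q'"] \<open>q \<noteq> q'\<close> by simp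
qed

section \<open>Convergence of the annihilators\<close>

lemma degree_div_le:
  fixes p q :: "complex poly"
  shows "degree (p div q) \<le> degree p"
proof (cases "q = 0 \<or> p div q = 0 \<or> degree p < degree q")
  case True
  then show ?thesis by (auto simp: div_poly_less)
next
  case False
  have "degree (q * (p div q)) = degree (p - p mod q)" by (simp add: minus_mod_eq_mult_div)
  also have "\<dots> \<le> max (degree p) (degree (p mod q))" by (rule degree_diff_le_max)
  also have "\<dots> \<le> degree p" using False degree_mod_less[of q p] by auto
  finally show ?thesis using False by (simp add: degree_mult_eq)
qed

lemma fps_linear_mult_nth_Suc:
  fixes X :: "complex fps"
  shows "fps_nth (fps_of_poly [:-\<zeta>, 1:] * X) (Suc n) = fps_nth X n - \<zeta> * fps_nth X (Suc n)"
  by (simp add: fps_of_poly_pCons fps_mult_nth_1' distrib_right mult.assoc fps_mult_fps_X_commute)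

text \<open>
  \<open>T = X / (z - \<xi>)\<close> has a genuine simple pole at \<open>\<xi>\<close>. Telescoping shows that \<open>-\<xi>^(n+1) T\<^sub>n\<close> is the
  \<open>n\<close>-th partial sum of \<open>X\<close> at \<open>\<xi>\<close>, which tends to \<open>X(\<xi>) \<noteq> 0\<close>.
\<close>

lemma coeff_lower_bound_simple_pole:
  fixes T :: "complex fps"
  assumes X: "fps_of_poly [:-\<xi>, 1:] * T = X" "fps_conv_radius X > norm \<xi>" "eval_fps X \<xi> \<noteq> 0"
    and "\<xi> \<noteq> 0"
  shows "\<exists>\<kappa>>0. \<exists>n0. \<forall>n\<ge>n0. norm (fps_nth T n) \<ge> \<kappa> * (1 / norm \<xi>) ^ n"
proof -
  define e where "e = eval_fps X \<xi>"
  have X0: "fps_nth X 0 = - \<xi> * fps_nth T 0" by (simp flip: X(1))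
  have XS: "fps_nth X (Suc n) = fps_nth T n - \<xi> * fps_nth T (Suc n)" for n
    unfolding X(1)[symmetric] by (rule fps_linear_mult_nth_Suc)
  have part: "(\<Sum>k\<le>n. fps_nth X k * \<xi> ^ k) = - (\<xi> ^ Suc n * fps_nth T n)" for n
    by (induction n) (simp_all add: X0 XS algebra_simps)
  have "(\<lambda>k. fps_nth X k * \<xi> ^ k) sums e"
    unfolding e_def by (rule sums_eval_fps) (rule X(2))
  then have "(\<lambda>n. \<Sum>k\<le>n. fps_nth X k * \<xi> ^ k) \<longlonglongrightarrow> e" by (simp add: sums_def_le)
  then have "(\<lambda>n. norm (\<xi> ^ Suc n * fps_nth T n)) \<longlonglongrightarrow> norm e"
    unfolding part using tendsto_norm by fastforce
  moreover have "norm e / 2 < norm e" using X(3) by (simp add: e_def)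
  ultimately have "eventually (\<lambda>n. norm e / 2 < norm (\<xi> ^ Suc n * fps_nth T n)) sequentially"
    by (rule order_tendstoD)
  then obtain n0 where n0: "\<And>n. n \<ge> n0 \<Longrightarrow> norm e / 2 < norm (\<xi> ^ Suc n * fps_nth T n)"
    by (auto simp: eventually_at_top_linorder)
  have "norm (fps_nth T n) \<ge> norm e / (2 * norm \<xi>) * (1 / norm \<xi>) ^ n" if "n \<ge> n0" for n
    using n0[OF that] \<open>\<xi> \<noteq> 0\<close> by (simp add: norm_mult norm_power field_simps)
  moreover have "norm e / (2 * norm \<xi>) > 0" using X(3) \<open>\<xi> \<noteq> 0\<close> by (simp add: e_def)
  ultimately show ?thesis by blast
qed

lemma conv_radius_ge_of_linear_power_mult:
  fixes g :: "complex fps"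
  assumes "fps_conv_radius (fps_of_poly ([:-\<xi>, 1:] ^ s) * g) \<ge> norm \<xi>" "\<xi> \<noteq> 0"
  shows "fps_conv_radius g \<ge> norm \<xi>"
proof -
  let ?P = "fps_of_poly ([:-\<xi>, 1:] ^ s)"
  have nz: "fps_nth ?P 0 \<noteq> 0" using assms(2) by (simp add: poly_0_coeff_0[symmetric])
  have g: "g = inverse ?P * (?P * g)"
    using inverse_mult_eq_1[OF nz] by (simp only: mult.assoc[symmetric] mult_1_left)
  have "fps_conv_radius (inverse ?P) \<ge> min (norm \<xi>) (fps_conv_radius ?P)"
    by (rule fps_conv_radius_inverse) auto
  then have "ereal (norm \<xi>) \<le> fps_conv_radius (inverse ?P)" by (simp add: min_def)
  with assms(1) have "ereal (norm \<xi>) \<le> min (fps_conv_radius (inverse ?P)) (fps_conv_radius (?P * g))"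
    by simp
  also have "\<dots> \<le> fps_conv_radius (inverse ?P * (?P * g))" by (rule fps_conv_radius_mult)
  finally show ?thesis using g by simp
qed

text \<open>
  Induction on the divisor \<open>N\<close> of the polynomial \<open>Qst\<close>, one linear factor at a time. Write
  \<open>N = (z - \<xi>) N'\<close>, let \<open>s\<close> be the order of \<open>N\<close> at \<open>\<xi>\<close>, and choose \<open>g \<in> V\<close> with a pole of this
  order. With \<open>r = Q mod N'\<close>, a number \<open>c\<close> and \<open>B = Q div N\<close> one has \<open>Q = r + c N' + B N\<close>, hence
  \<open>0 = [z^n] (g r) + c [z^n] (g N') + [z^n] (B g N)\<close>. Here \<open>g N\<close> is analytic on the disk of radius
  \<open>|\<xi>| / \<eta>\<close>, so that the last term is of order \<open>(\<eta> / |\<xi>|)^n\<close>; \<open>r\<close> is small by induction; and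
  \<open>g N'\<close> has a simple pole at \<open>\<xi>\<close>, so that \<open>[z^n] (g N')\<close> is at least of order \<open>|\<xi>|^(-n)\<close>.
  Therefore \<open>c\<close>, and with it \<open>Q mod N = r + c N'\<close>, is of order \<open>\<eta>^n\<close>.
\<close>

lemma annihilator_mod_bound:
  fixes Qst :: "complex poly" and V :: "complex fps set"
  assumes Qst: "Qst \<noteq> 0" "poly Qst 0 \<noteq> 0"
    and poles: "\<And>\<xi> s \<eta>. poly Qst \<xi> = 0 \<Longrightarrow> 1 \<le> s \<Longrightarrow> s \<le> order \<xi> Qst \<Longrightarrow> \<theta> < \<eta> \<Longrightarrow> \<eta> < 1 \<Longrightarrow>
      \<exists>g\<in>V. fps_conv_radius (fps_of_poly ([:-\<xi>, 1:] ^ s) * g) > norm \<xi> / \<eta> \<and>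
            eval_fps (fps_of_poly ([:-\<xi>, 1:] ^ s) * g) \<xi> \<noteq> 0"
    and "\<theta> \<ge> 0"
    and "N dvd Qst" "\<theta> < \<eta>" "\<eta> < 1"
  shows "\<exists>C>0. \<exists>n0. \<forall>n\<ge>n0. \<forall>Q. degree Q \<le> M \<longrightarrow> annihilates V n Q \<longrightarrow>
           l1_norm (Q mod N) \<le> C * \<eta> ^ n * l1_norm Q"
  using assms(5-7)
proof (induction "degree N" arbitrary: N \<eta> rule: less_induct)
  case (less N \<eta>)
  have N: "N \<noteq> 0" using less.prems(1) Qst(1) by auto
  have \<eta>: "0 < \<eta>" "\<eta> < 1" using less.prems \<open>\<theta> \<ge> 0\<close> by auto
  show ?case
  proof (cases "degree N = 0")
    case True
    then have "N dvd 1" using N by (simp add: is_unit_iff_degree)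
    then have "Q mod N = 0" for Q by (rule unit_imp_mod_eq_0)
    then show ?thesis using \<eta> by (intro exI[of _ 1]) (simp add: l1_norm_nonneg)
  next
    case False
    then obtain \<xi> where \<xi>: "poly N \<xi> = 0" using alg_closed_imp_poly_has_root[of N] by auto
    then have "poly Qst \<xi> = 0" using less.prems(1) by (auto elim!: dvdE)
    then have "\<xi> \<noteq> 0" using Qst(2) by auto
    define x where "x = norm \<xi>"
    have x: "x > 0" using \<open>\<xi> \<noteq> 0\<close> by (simp add: x_def)
    define s where "s = order \<xi> N"
    have s: "1 \<le> s" "s \<le> order \<xi> Qst"
      using \<xi> N Qst(1) less.prems(1) by (auto simp: s_def order_root Suc_le_eq dvd_imp_order_le)
    obtain K where K: "N = [:-\<xi>, 1:] ^ s * K" "\<not> [:-\<xi>, 1:] dvd K"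
      using order_decomp[OF N, of \<xi>] by (auto simp: s_def)
    then have "poly K \<xi> \<noteq> 0" by (simp add: poly_eq_0_iff_dvd)
    define N' where "N' = [:-\<xi>, 1:] ^ (s - 1) * K"
    have NN': "N = [:-\<xi>, 1:] * N'"
      using s(1) unfolding K(1) N'_def mult.assoc[symmetric] power_Suc[symmetric] by simp
    have N': "N' \<noteq> 0" using N NN' by auto
    have degN: "degree N = Suc (degree N')" unfolding NN' using N' by (subst degree_mult_eq) auto
    obtain g where g: "g \<in> V" and G: "fps_conv_radius (fps_of_poly ([:-\<xi>, 1:] ^ s) * g) > norm \<xi> / \<eta>"
        "eval_fps (fps_of_poly ([:-\<xi>, 1:] ^ s) * g) \<xi> \<noteq> 0"
      using poles[OF \<open>poly Qst \<xi> = 0\<close> s less.prems(2,3)] by blast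
    define G where "G = fps_of_poly ([:-\<xi>, 1:] ^ s) * g"
    have "norm \<xi> \<le> norm \<xi> / \<eta>" using \<eta> by (simp add: field_simps mult_left_le_one_le)
    then have "ereal (norm \<xi>) \<le> ereal (norm \<xi> / \<eta>)" by simp
    then have G': "fps_conv_radius G > norm \<xi> / \<eta>" "fps_conv_radius G > norm \<xi>" "eval_fps G \<xi> \<noteq> 0"
      using G le_less_trans[of "ereal (norm \<xi>)" "ereal (norm \<xi> / \<eta>)"] unfolding G_def by blast+
    define X where "X = fps_of_poly K * G"
    define T where "T = fps_of_poly N' * g"
    have XN: "fps_of_poly N * g = X"
      by (simp add: X_def G_def K(1) fps_of_poly_mult mult_ac)
    have XT: "fps_of_poly [:-\<xi>, 1:] * T = X"
      unfolding XN[symmetric] T_def NN' fps_of_poly_mult by (simp only: mult.assoc)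
    have "min (fps_conv_radius (fps_of_poly K)) (fps_conv_radius G) \<le> fps_conv_radius X"
      unfolding X_def by (rule fps_conv_radius_mult)
    then have convX: "fps_conv_radius G \<le> fps_conv_radius X" by simp
    then have X: "fps_conv_radius X > norm \<xi> / \<eta>" "fps_conv_radius X > norm \<xi>"
      using G' less_le_trans by blast+
    have "eval_fps X \<xi> = poly K \<xi> * eval_fps G \<xi>"
      unfolding X_def using G' by (subst eval_fps_mult) auto
    then have "eval_fps X \<xi> \<noteq> 0" using G' \<open>poly K \<xi> \<noteq> 0\<close> by simp
    from coeff_lower_bound_simple_pole[OF XT X(2) this \<open>\<xi> \<noteq> 0\<close>]
    obtain \<kappa> n1 where \<kappa>: "\<kappa> > 0" "\<And>n. n \<ge> n1 \<Longrightarrow> norm (fps_nth T n) \<ge> \<kappa> * (1 / x) ^ n"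
      unfolding x_def by blast
    \<comment> \<open>An intermediate rate leaves room for the growth of the coefficients of \<open>g\<close>.\<close>
    define \<eta>' where "\<eta>' = (\<theta> + \<eta>) / 2"
    have \<eta>': "\<theta> < \<eta>'" "\<eta>' < \<eta>" "\<eta>' < 1" "\<eta>' > 0"
      using less.prems(2,3) \<open>\<theta> \<ge> 0\<close> by (auto simp: \<eta>'_def)
    have "N' dvd Qst" using less.prems(1) NN' by (metis dvd_mult_right)
    from less.hyps[OF _ this \<eta>'(1,3)] degN obtain C3 n3 where C3: "C3 > 0"
        "\<And>n Q. n \<ge> n3 \<Longrightarrow> degree Q \<le> M \<Longrightarrow> annihilates V n Q \<Longrightarrow>
           l1_norm (Q mod N') \<le> C3 * \<eta>' ^ n * l1_norm Q" by auto
    obtain C4 where C4: "C4 > 0" "\<And>Q. degree Q \<le> M \<Longrightarrow> l1_norm (Q div N) \<le> C4 * l1_norm Q"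
      using l1_norm_linear_bound[of "\<lambda>Q. Q div N" M] by (auto simp: poly_div_add_left div_smult_left)
    have "ereal (1 / (\<eta> / x)) < fps_conv_radius X" using X(1) by (simp add: x_def)
    then obtain C1 where C1: "C1 > 0" "\<And>n. norm (fps_nth X n) \<le> C1 * (\<eta> / x) ^ n"
      using coeff_bound_of_conv_radius[of "\<eta> / x" X] \<eta> x by auto
    define y where "y = \<eta> / (\<eta>' * x)"
    have y: "y > 0" using \<eta> \<eta>' x by (simp add: y_def)
    have "ereal x \<le> fps_conv_radius g"
      unfolding x_def using less_imp_le[OF G'(2)[unfolded G_def]] \<open>\<xi> \<noteq> 0\<close>
      by (rule conv_radius_ge_of_linear_power_mult)
    moreover have "1 / y < x" using \<eta> \<eta>' x by (simp add: y_def field_simps)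
    ultimately have "ereal (1 / y) < fps_conv_radius g" by (metis less_ereal.simps(1) less_le_trans)
    then obtain C2 where C2: "C2 > 0" "\<And>n. norm (fps_nth g n) \<le> C2 * y ^ n"
      using coeff_bound_of_conv_radius[of y g] y by auto
    define D where "D = degree N'"
    define C5 where "C5 = (C3 * C2 * (1 + 1/y) ^ D + C4 * C1 * (1 + 1/(\<eta>/x)) ^ M) / \<kappa>"
    have "C5 > 0"
      unfolding C5_def using C1 C2 C3 C4 \<kappa> y \<eta> x by (intro divide_pos_pos add_pos_pos mult_pos_pos zero_less_power) auto
    have main: "l1_norm (Q mod N) \<le> (C5 * l1_norm N' + C3) * \<eta> ^ n * l1_norm Q"
      if n: "n \<ge> max n1 n3" and Q: "degree Q \<le> M" "annihilates V n Q" for n Q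
    proof -
      define r where "r = Q mod N'"
      define c where "c = poly (Q div N') \<xi>"
      define B where "B = Q div N"
      have "(Q div N') mod [:-\<xi>, 1:] = [:c:]"
      proof -
        have "Q div N' = [:c:] + synthetic_div (Q div N') \<xi> * [:-\<xi>, 1:]"
          unfolding c_def by (metis synthetic_div_correct' add.commute mult.commute)
        then have "(Q div N') mod [:-\<xi>, 1:] = [:c:] mod [:-\<xi>, 1:]"
          by (metis mod_mult_self1)
        then show ?thesis by (simp add: mod_poly_less)
      qed
      then have modN: "Q mod N = smult c N' + r"
        unfolding NN' r_def using poly_mod_mult_right[of Q N' "[:-\<xi>, 1:]"] by (simp add: mult.commute)
      have r_le: "l1_norm r \<le> C3 * \<eta>' ^ n * l1_norm Q" unfolding r_def using C3(2) n Q by auto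
      have B_le: "l1_norm B \<le> C4 * l1_norm Q" unfolding B_def using C4(2) Q by auto
      have "degree r \<le> D" unfolding r_def D_def using degree_mod_less[OF N', of Q] by auto
      have "degree B \<le> M" unfolding B_def using degree_div_le[of Q N] Q by simp
      have "Q = B * N + (smult c N' + r)" using modN by (metis B_def div_mult_mod_eq)
      then have "fps_of_poly Q * g = fps_of_poly B * X + fps_const c * T + fps_of_poly r * g"
        unfolding XN[symmetric] T_def
        by (metis (no_types, opaque_lifting) fps_of_poly_add fps_of_poly_mult fps_of_poly_smult distrib_right mult.assoc add.assoc)
      moreover have "fps_nth (fps_of_poly Q * g) n = 0" using Q(2) g by (simp add: annihilates_def)
      ultimately have "c * fps_nth T n = - (fps_nth (fps_of_poly B * X) n + fps_nth (fps_of_poly r * g) n)"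
        by (simp add: add_eq_0_iff2 algebra_simps)
      then have "norm (c * fps_nth T n) \<le> norm (fps_nth (fps_of_poly B * X) n) + norm (fps_nth (fps_of_poly r * g) n)"
        by (metis norm_minus_cancel norm_triangle_ineq)
      also have "norm (fps_nth (fps_of_poly B * X) n) \<le> l1_norm B * (C1 * (1 + 1/(\<eta>/x)) ^ M * (\<eta>/x) ^ n)"
        using \<open>degree B \<le> M\<close> C1 \<eta> x by (intro norm_poly_mult_nth_le) auto
      also have "\<dots> \<le> (C4 * l1_norm Q) * (C1 * (1 + 1/(\<eta>/x)) ^ M * (\<eta>/x) ^ n)"
        using C1 \<eta> x by (intro mult_right_mono B_le) auto
      also have "norm (fps_nth (fps_of_poly r * g) n) \<le> l1_norm r * (C2 * (1 + 1/y) ^ D * y ^ n)"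
        using \<open>degree r \<le> D\<close> C2 y by (intro norm_poly_mult_nth_le) auto
      also have "\<dots> \<le> (C3 * \<eta>' ^ n * l1_norm Q) * (C2 * (1 + 1/y) ^ D * y ^ n)"
        using C2 y by (intro mult_right_mono r_le) auto
      also have "\<eta>' ^ n * y ^ n = (\<eta> / x) ^ n"
        using \<eta>' by (simp add: y_def flip: power_mult_distrib)
      then have "(C3 * \<eta>' ^ n * l1_norm Q) * (C2 * (1 + 1/y) ^ D * y ^ n) =
          C3 * l1_norm Q * (C2 * (1 + 1/y) ^ D) * (\<eta> / x) ^ n"
        by (metis (no_types, opaque_lifting) mult.assoc mult.commute)
      finally have *: "norm c * norm (fps_nth T n) \<le>
          C4 * l1_norm Q * (C1 * (1 + 1/(\<eta>/x)) ^ M * (\<eta>/x) ^ n) +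
          C3 * l1_norm Q * (C2 * (1 + 1/y) ^ D) * (\<eta>/x) ^ n"
        by (simp add: norm_mult)
      have "\<kappa> * C5 = C3 * C2 * (1 + 1/y) ^ D + C4 * C1 * (1 + 1/(\<eta>/x)) ^ M"
        using \<kappa>(1) by (simp add: C5_def)
      then have eq: "(\<kappa> * C5) * ((\<eta>/x) ^ n * l1_norm Q) =
          C4 * l1_norm Q * (C1 * (1 + 1/(\<eta>/x)) ^ M * (\<eta>/x) ^ n) +
          C3 * l1_norm Q * (C2 * (1 + 1/y) ^ D) * (\<eta>/x) ^ n"
        by (simp only: distrib_right distrib_left mult_ac add_ac)
      have "norm c * norm (fps_nth T n) \<le> (\<kappa> * C5) * ((\<eta>/x) ^ n * l1_norm Q)"
        unfolding eq by (rule *)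
      also have "(\<eta>/x) ^ n = \<eta> ^ n * (1/x) ^ n" by (simp add: power_divide)
      finally have "norm c * norm (fps_nth T n) \<le> (C5 * \<eta> ^ n * l1_norm Q) * (\<kappa> * (1/x) ^ n)"
        by (simp only: mult_ac)
      moreover have "norm c * (\<kappa> * (1 / x) ^ n) \<le> norm c * norm (fps_nth T n)"
        by (rule mult_left_mono[OF \<kappa>(2)]) (use n in auto)
      ultimately have "norm c * (\<kappa> * (1 / x) ^ n) \<le> (C5 * \<eta> ^ n * l1_norm Q) * (\<kappa> * (1/x) ^ n)"
        by (rule order_trans[rotated])
      moreover have "\<kappa> * (1 / x) ^ n > 0" using \<kappa>(1) x by simp
      ultimately have c_le: "norm c \<le> C5 * \<eta> ^ n * l1_norm Q"
        by (rule mult_right_le_imp_le)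
      have "l1_norm (Q mod N) \<le> norm c * l1_norm N' + l1_norm r"
        unfolding modN using l1_norm_add[of "smult c N'" r] by (simp add: l1_norm_smult)
      also have "\<dots> \<le> (C5 * \<eta> ^ n * l1_norm Q) * l1_norm N' + C3 * \<eta> ^ n * l1_norm Q"
      proof (intro add_mono mult_right_mono c_le l1_norm_nonneg order_trans[OF r_le] mult_left_mono)
        show "\<eta>' ^ n \<le> \<eta> ^ n" using \<eta>' by (intro power_mono) auto
      qed (use C3 in auto)
      finally show ?thesis by (simp add: algebra_simps)
    qed
    show ?thesis
    proof (intro exI[of _ "C5 * l1_norm N' + C3"] conjI exI[of _ "max n1 n3"] allI impI main)
      show "0 < C5 * l1_norm N' + C3"
        using C3 \<open>C5 > 0\<close> l1_norm_nonneg[of N'] by (intro add_nonneg_pos) auto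
    qed
  qed
qed

text \<open>
  Apply the bound to \<open>N = Qst\<close>: every annihilator \<open>Q\<close> is \<open>c Qst\<close> up to an error that is small
  compared with the norm of \<open>Q\<close>. For large \<open>n\<close> this forces \<open>c \<noteq> 0\<close>, and both the leading
  coefficient and the value at \<open>0\<close> are inherited from \<open>c Qst\<close>.
\<close>

lemma annihilator_convergence:
  fixes Qst :: "complex poly" and V :: "complex fps set"
  assumes Qst: "lead_coeff Qst = 1" "poly Qst 0 \<noteq> 0" "degree Qst = M" "M \<ge> 1"
    and poles: "\<And>\<xi> s \<eta>. poly Qst \<xi> = 0 \<Longrightarrow> 1 \<le> s \<Longrightarrow> s \<le> order \<xi> Qst \<Longrightarrow> \<theta> < \<eta> \<Longrightarrow> \<eta> < 1 \<Longrightarrow>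
      \<exists>g\<in>V. fps_conv_radius (fps_of_poly ([:-\<xi>, 1:] ^ s) * g) > norm \<xi> / \<eta> \<and>
            eval_fps (fps_of_poly ([:-\<xi>, 1:] ^ s) * g) \<xi> \<noteq> 0"
    and \<eta>: "\<theta> \<ge> 0" "\<theta> < \<eta>" "\<eta> < 1"
  shows "\<exists>C>0. \<exists>n0. \<forall>n\<ge>n0. \<forall>Q. degree Q \<le> M \<longrightarrow> annihilates V n Q \<longrightarrow> Q \<noteq> 0 \<longrightarrow>
           degree Q = M \<and> poly Q 0 \<noteq> 0 \<and> (lead_coeff Q = 1 \<longrightarrow> l1_norm (Qst - Q) \<le> C * \<eta> ^ n)"
proof -
  have "Qst \<noteq> 0" using Qst by auto
  have "\<exists>C>0. \<exists>n0. \<forall>n\<ge>n0. \<forall>Q. degree Q \<le> M \<longrightarrow> annihilates V n Q \<longrightarrow>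
      l1_norm (Q mod Qst) \<le> C * \<eta> ^ n * l1_norm Q"
    by (rule annihilator_mod_bound[where Qst = Qst and \<theta> = \<theta>])
      (fact \<open>Qst \<noteq> 0\<close> Qst(2) poles \<eta> dvd_refl)+
  then obtain C n0 where C: "C > 0" "\<And>n Q. n \<ge> n0 \<Longrightarrow> degree Q \<le> M \<Longrightarrow> annihilates V n Q \<Longrightarrow>
        l1_norm (Q mod Qst) \<le> C * \<eta> ^ n * l1_norm Q" by blast
  define L where "L = l1_norm Qst"
  have L: "L > 0" unfolding L_def using \<open>Qst \<noteq> 0\<close> by (rule l1_norm_pos)
  \<comment> \<open>The first bound keeps \<open>c\<close> away from \<open>0\<close>, the second one keeps \<open>Q(0)\<close> away from \<open>0\<close>.\<close>
  define \<epsilon> where "\<epsilon> = min (1/2) (norm (poly Qst 0) / (4 * L))"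
  have \<epsilon>: "\<epsilon> > 0" unfolding \<epsilon>_def using L Qst(2) by auto
  have "(\<lambda>n. C * \<eta> ^ n) \<longlonglongrightarrow> C * 0" using \<eta> by (intro tendsto_intros LIMSEQ_power_zero) auto
  then have "eventually (\<lambda>n. C * \<eta> ^ n < \<epsilon>) sequentially"
    by (rule order_tendstoD(2)) (use \<epsilon> in simp)
  then obtain n1 where n1: "\<And>n. n \<ge> n1 \<Longrightarrow> C * \<eta> ^ n < \<epsilon>" by (auto simp: eventually_at_top_linorder)
  have main: "degree Q = M \<and> poly Q 0 \<noteq> 0 \<and> (lead_coeff Q = 1 \<longrightarrow> l1_norm (Qst - Q) \<le> 2 * C * L * \<eta> ^ n)"
    if n: "n \<ge> max n0 n1" and Q: "degree Q \<le> M" "annihilates V n Q" "Q \<noteq> 0" for n Q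
  proof -
    define r where "r = Q mod Qst"
    have r: "l1_norm r \<le> C * \<eta> ^ n * l1_norm Q" unfolding r_def using C(2) n Q by auto
    have deg_r: "degree r < M"
      unfolding r_def using degree_mod_less[OF \<open>Qst \<noteq> 0\<close>, of Q] Qst(3,4) by auto
    have "degree (Q div Qst) = 0"
    proof (rule ccontr)
      assume nz: "degree (Q div Qst) \<noteq> 0"
      then have "Q div Qst \<noteq> 0" by auto
      have "degree (Qst * (Q div Qst)) = degree (Q - r)" by (simp add: r_def minus_mod_eq_mult_div)
      also have "\<dots> \<le> M" using degree_diff_le_max[of Q r] deg_r Q(1) by linarith
      finally show False using nz \<open>Q div Qst \<noteq> 0\<close> \<open>Qst \<noteq> 0\<close> Qst(3) by (simp add: degree_mult_eq)
    qed
    then obtain c where "Q div Qst = [:c:]" by (rule degree_eq_zeroE)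
    then have Qc: "Q = smult c Qst + r"
      unfolding r_def by (metis div_mult_mod_eq mult.commute mult_pCons_right mult_zero_right pCons_0_0 add.right_neutral)
    have "l1_norm Q \<le> norm c * L + l1_norm r"
      unfolding L_def Qc using l1_norm_add[of "smult c Qst" r] by (simp add: l1_norm_smult)
    also have "l1_norm r \<le> 1/2 * l1_norm Q"
      using n1[of n] n by (intro order_trans[OF r] mult_right_mono l1_norm_nonneg) (auto simp: \<epsilon>_def)
    finally have Q_le: "l1_norm Q \<le> 2 * norm c * L" by simp
    then have "c \<noteq> 0" using l1_norm_pos[OF Q(3)] by auto
    have coeff_M: "coeff Q M = c" using deg_r Qst(1,3) by (simp add: Qc coeff_eq_0)
    then have "degree Q = M" using Q(1) \<open>c \<noteq> 0\<close> by (metis le_antisym le_degree)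
    moreover have "poly Q 0 \<noteq> 0"
    proof
      assume "poly Q 0 = 0"
      then have "norm (poly (smult c Qst) 0) = norm (poly r 0)"
        by (simp add: Qc add_eq_0_iff2 norm_minus_commute norm_mult)
      also have "\<dots> \<le> l1_norm r" using norm_coeff_le_l1_norm[of r 0] by (simp add: poly_0_coeff_0)
      also have "\<dots> \<le> C * \<eta> ^ n * (2 * norm c * L)"
        using C(1) \<eta> by (intro order_trans[OF r] mult_left_mono Q_le) auto
      also have "\<dots> < norm (poly Qst 0) / (4 * L) * (2 * norm c * L)"
        using n1[of n] n L \<open>c \<noteq> 0\<close> by (intro mult_strict_right_mono) (auto simp: \<epsilon>_def)
      also have "\<dots> = norm c * norm (poly Qst 0) / 2" using L by simp
      finally show False using \<open>c \<noteq> 0\<close> Qst(2) by (simp add: norm_mult)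
    qed
    moreover have "l1_norm (Qst - Q) \<le> 2 * C * L * \<eta> ^ n" if "lead_coeff Q = 1"
    proof -
      have "c = 1" using that coeff_M \<open>degree Q = M\<close> by simp
      then have "Qst - Q = smult (-1) r" by (simp add: Qc)
      then have "l1_norm (Qst - Q) = l1_norm r" by (simp add: l1_norm_smult del: smult_minus_left)
      also have "\<dots> \<le> C * \<eta> ^ n * (2 * norm c * L)"
        using C(1) \<eta> by (intro order_trans[OF r] mult_left_mono Q_le) auto
      finally show ?thesis using \<open>c = 1\<close> by (simp add: mult_ac)
    qed
    ultimately show ?thesis by blast
  qed
  show ?thesis
    by (intro exI[of _ "2 * C * L"] conjI exI[of _ "max n0 n1"] allI impI main) (use C(1) L in auto)
qed

section \<open>Exponentially perturbed linear recurrences\<close>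

text \<open>
  A root \<open>\<mu>\<close> of modulus below the growth rate \<open>\<sigma>\<close> is handled by running the recurrence forwards, a
  root of modulus above it by summing backwards from infinity. Either way the solution grows no
  faster than the right-hand side. Modulus exactly \<open>\<sigma>\<close> would cost a factor \<open>n\<close>.
\<close>

lemma first_order_recurrence_bounded_solution:
  fixes \<mu> :: complex
  assumes "\<sigma> > 0" "norm \<mu> \<noteq> \<sigma>"
  shows "\<exists>C>0. \<forall>B b. (\<forall>n. norm (b n) \<le> B * \<sigma> ^ n) \<longrightarrow>
           (\<exists>y. (\<forall>n. norm (y n) \<le> C * B * \<sigma> ^ n) \<and> (\<forall>n. y (Suc n) - \<mu> * y n = b (Suc n)))"
proof (cases "norm \<mu> < \<sigma>")
  case True
  define t where "t = norm \<mu> / \<sigma>"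
  have t: "0 \<le> t" "t < 1" using True assms(1) by (auto simp: t_def)
  have nl: "norm \<mu> = t * \<sigma>" using assms(1) by (simp add: t_def)
  show ?thesis
  proof (intro exI[of _ "1 / (1 - t)"] conjI allI impI)
    show "1 / (1 - t) > 0" using t by simp
    fix B :: real and b :: "nat \<Rightarrow> complex" assume b: "\<forall>n. norm (b n) \<le> B * \<sigma> ^ n"
    have "0 \<le> B" using b[rule_format, of 0] norm_ge_zero[of "b 0"] by (simp del: norm_ge_zero)
    define y where "y = rec_nat (b 0) (\<lambda>n v. \<mu> * v + b (Suc n))"
    have y: "y 0 = b 0" "\<And>n. y (Suc n) = \<mu> * y n + b (Suc n)" by (simp_all add: y_def)
    have "norm (y n) \<le> 1 / (1 - t) * B * \<sigma> ^ n" for n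
    proof (induction n)
      case 0
      have "B * 1 \<le> B * (1 / (1 - t))" using t \<open>0 \<le> B\<close> by (intro mult_left_mono) auto
      then show ?case using b[rule_format, of 0] by (simp add: y mult.commute)
    next
      case (Suc n)
      have "norm (y (Suc n)) \<le> norm \<mu> * norm (y n) + norm (b (Suc n))"
        unfolding y by (metis norm_mult norm_triangle_ineq)
      also have "\<dots> \<le> (t * \<sigma>) * (1 / (1 - t) * B * \<sigma> ^ n) + B * \<sigma> ^ Suc n"
        unfolding nl using t assms(1) by (intro add_mono mult_left_mono Suc b[rule_format]) auto
      also have "\<dots> = (t / (1 - t) + 1) * (B * \<sigma> ^ Suc n)" by (simp add: algebra_simps)
      also have "t / (1 - t) + 1 = 1 / (1 - t)" using t by (simp add: field_simps)
      finally show ?case by (simp only: mult.assoc)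
    qed
    then show "\<exists>y. (\<forall>n. norm (y n) \<le> 1 / (1 - t) * B * \<sigma> ^ n) \<and> (\<forall>n. y (Suc n) - \<mu> * y n = b (Suc n))"
      using y by (intro exI[of _ y]) auto
  qed
next
  case False
  then have gt: "\<sigma> < norm \<mu>" using assms(2) by simp
  then have "\<mu> \<noteq> 0" using assms(1) by auto
  define t where "t = \<sigma> / norm \<mu>"
  have "norm \<mu> > 0" using \<open>\<mu> \<noteq> 0\<close> by simp
  then have t: "0 < t" "t < 1" using gt assms(1) by (simp_all add: t_def)
  have nl: "1 / norm \<mu> = t / \<sigma>" using assms(1) by (simp add: t_def)
  show ?thesis
  proof (intro exI[of _ "t / (1 - t)"] conjI allI impI)
    show "t / (1 - t) > 0" using t by simp
    fix B :: real and b :: "nat \<Rightarrow> complex" assume b: "\<forall>n. norm (b n) \<le> B * \<sigma> ^ n"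
    \<comment> \<open>Terms of the backward sum \<open>y n = - \<Sum>j. \<mu>^(-j-1) b (n + 1 + j)\<close>.\<close>
    define a where "a n j = b (Suc n + j) / \<mu> ^ Suc j" for n j
    have a_le: "norm (a n j) \<le> B * \<sigma> ^ n * t * t ^ j" for n j
    proof -
      have "norm (a n j) = norm (b (Suc n + j)) * (1 / norm \<mu>) ^ Suc j"
        by (simp add: a_def norm_divide norm_power norm_mult power_divide)
      also have "\<dots> \<le> B * \<sigma> ^ (Suc n + j) * (1 / norm \<mu>) ^ Suc j"
        by (intro mult_right_mono b[rule_format]) auto
      also have "\<dots> = B * \<sigma> ^ n * t * t ^ j"
        unfolding nl using assms(1) by (simp add: power_divide power_add field_simps)
      finally show ?thesis .
    qed
    have geo: "(\<lambda>j. B * \<sigma> ^ n * t * t ^ j) sums (B * \<sigma> ^ n * t * (1 / (1 - t)))" for n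
      by (intro sums_mult geometric_sums) (use t in auto)
    have summ: "summable (a n)" for n
      by (rule summable_comparison_test[OF _ sums_summable[OF geo[of n]]]) (use a_le in blast)
    define y where "y n = - (\<Sum>j. a n j)" for n
    have y_le: "norm (y n) \<le> t / (1 - t) * B * \<sigma> ^ n" for n
    proof -
      have "norm (\<Sum>j. a n j) \<le> (\<Sum>j. B * \<sigma> ^ n * t * t ^ j)"
        by (rule norm_suminf_le[OF _ sums_summable[OF geo]]) (rule a_le)
      also have "\<dots> = B * \<sigma> ^ n * t * (1 / (1 - t))" by (rule sums_unique[OF geo, symmetric])
      also have "\<dots> = t / (1 - t) * B * \<sigma> ^ n" by (simp add: mult_ac)
      finally show ?thesis by (simp add: y_def)
    qed
    have y_rec: "y (Suc n) - \<mu> * y n = b (Suc n)" for n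
    proof -
      have shift: "a (Suc n) j = \<mu> * a n (Suc j)" for j using \<open>\<mu> \<noteq> 0\<close> by (simp add: a_def)
      have "(\<Sum>j. a n (Suc j)) = (\<Sum>j. a n j) - a n 0" by (rule suminf_split_head[OF summ])
      then have "(\<Sum>j. a (Suc n) j) = \<mu> * ((\<Sum>j. a n j) - a n 0)"
        unfolding shift using suminf_mult[OF summable_Suc_iff[THEN iffD2, OF summ[of n]], of \<mu>] by simp
      then show ?thesis using \<open>\<mu> \<noteq> 0\<close> by (simp add: y_def a_def algebra_simps)
    qed
    show "\<exists>y. (\<forall>n. norm (y n) \<le> t / (1 - t) * B * \<sigma> ^ n) \<and> (\<forall>n. y (Suc n) - \<mu> * y n = b (Suc n))"
      using y_le y_rec by (intro exI[of _ y]) blast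
  qed
qed

text \<open>
  Peel off the linear factors of \<open>p\<close> one by one. Zeros \<open>z\<close> of \<open>p\<close> correspond to the characteristic
  roots \<open>1/z\<close> of the recurrence.
\<close>

lemma constant_recurrence_bounded_solution:
  fixes p :: "complex poly"
  assumes "\<sigma> > 0" "poly p 0 \<noteq> 0" "\<And>z. poly p z = 0 \<Longrightarrow> norm z * \<sigma> \<noteq> 1"
  shows "\<exists>C>0. \<forall>B b. (\<forall>n. norm (b n) \<le> B * \<sigma> ^ n) \<longrightarrow>
           (\<exists>Y. (\<forall>n. norm (fps_nth Y n) \<le> C * B * \<sigma> ^ n) \<and>
                (\<forall>n\<ge>degree p. fps_nth (fps_of_poly p * Y) n = b n))"
  using assms(2,3)
proof (induction "degree p" arbitrary: p)
  case 0
  then obtain c where c: "p = [:c:]" by (auto elim: degree_eq_zeroE)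
  with 0 have "c \<noteq> 0" by simp
  have "(\<exists>Y. (\<forall>n. norm (fps_nth Y n) \<le> 1 / norm c * B * \<sigma> ^ n) \<and>
      (\<forall>n\<ge>degree p. fps_nth (fps_of_poly p * Y) n = b n))"
    if b: "\<forall>n. norm (b n) \<le> B * \<sigma> ^ n" for B b
    using b \<open>c \<noteq> 0\<close>
    by (intro exI[of _ "Abs_fps (\<lambda>n. b n / c)"]) (auto simp: c fps_of_poly_const norm_divide field_simps)
  then show ?case using \<open>c \<noteq> 0\<close> by (intro exI[of _ "1 / norm c"]) auto
next
  case (Suc k)
  then obtain \<zeta> where \<zeta>: "poly p \<zeta> = 0" using alg_closed_imp_poly_has_root[of p] by auto
  then obtain p' where p': "p = [:-\<zeta>, 1:] * p'" by (auto simp: poly_eq_0_iff_dvd)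
  have "\<zeta> \<noteq> 0" using \<zeta> Suc.prems(1) by auto
  have "p' \<noteq> 0" using p' Suc.prems(1) by auto
  then have deg: "degree p = Suc (degree p')" unfolding p' by (subst degree_mult_eq) auto
  have root: "poly p z = 0" if "poly p' z = 0" for z using that by (simp add: p')
  have "poly p' 0 \<noteq> 0" using root Suc.prems(1) by blast
  from Suc.hyps(1)[OF _ this] Suc.hyps(2) deg Suc.prems(2) root obtain C1 where C1: "C1 > 0"
      "\<And>B b. (\<forall>n. norm (b n) \<le> B * \<sigma> ^ n) \<Longrightarrow>
           (\<exists>Y. (\<forall>n. norm (fps_nth Y n) \<le> C1 * B * \<sigma> ^ n) \<and>
                (\<forall>n\<ge>degree p'. fps_nth (fps_of_poly p' * Y) n = b n))"
    by auto
  have "norm (1 / \<zeta>) \<noteq> \<sigma>" using Suc.prems(2)[OF \<zeta>] \<open>\<zeta> \<noteq> 0\<close> by (auto simp: norm_divide)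
  from first_order_recurrence_bounded_solution[OF \<open>\<sigma> > 0\<close> this] obtain C2 where C2: "C2 > 0"
      "\<And>B b. (\<forall>n. norm (b n) \<le> B * \<sigma> ^ n) \<Longrightarrow>
         (\<exists>y. (\<forall>n. norm (y n) \<le> C2 * B * \<sigma> ^ n) \<and> (\<forall>n. y (Suc n) - 1 / \<zeta> * y n = b (Suc n)))"
    by blast
  show ?case
  proof (intro exI[of _ "C1 * (C2 * (1 / norm \<zeta>))"] conjI allI impI)
    show "0 < C1 * (C2 * (1 / norm \<zeta>))" using C1 C2 \<open>\<zeta> \<noteq> 0\<close> by simp
    fix B :: real and b :: "nat \<Rightarrow> complex" assume b: "\<forall>n. norm (b n) \<le> B * \<sigma> ^ n"
    have "\<forall>n. norm (- (b n / \<zeta>)) \<le> (1 / norm \<zeta> * B) * \<sigma> ^ n"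
      using b \<open>\<zeta> \<noteq> 0\<close> by (auto simp: norm_divide field_simps)
    from C2(2)[OF this] obtain x where x: "\<forall>n. norm (x n) \<le> C2 * (1 / norm \<zeta> * B) * \<sigma> ^ n"
        "\<And>n. x (Suc n) - 1 / \<zeta> * x n = - (b (Suc n) / \<zeta>)" by blast
    from C1(2)[OF x(1)] obtain Y where Y:
        "\<forall>n. norm (fps_nth Y n) \<le> C1 * (C2 * (1 / norm \<zeta> * B)) * \<sigma> ^ n"
        "\<And>n. n \<ge> degree p' \<Longrightarrow> fps_nth (fps_of_poly p' * Y) n = x n" by blast
    have "fps_nth (fps_of_poly p * Y) n = b n" if "n \<ge> degree p" for n
    proof -
      obtain k where k: "n = Suc k" "k \<ge> degree p'"
        by (rule that[of "n - 1"]) (use \<open>n \<ge> degree p\<close> deg in auto)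
      have "fps_of_poly p * Y = fps_of_poly [:-\<zeta>, 1:] * (fps_of_poly p' * Y)"
        unfolding p' fps_of_poly_mult by (simp only: mult.assoc)
      then have "fps_nth (fps_of_poly p * Y) n = x k - \<zeta> * x (Suc k)"
        unfolding k(1) using Y(2) k(2) by (simp only: fps_linear_mult_nth_Suc)
      also have "x (Suc k) = 1 / \<zeta> * x k - b (Suc k) / \<zeta>" using x(2)[of k] by (simp add: algebra_simps)
      also have "x k - \<zeta> * (1 / \<zeta> * x k - b (Suc k) / \<zeta>) = b (Suc k)"
        using \<open>\<zeta> \<noteq> 0\<close> by (simp add: right_diff_distrib)
      finally show ?thesis using k by simp
    qed
    with Y(1) show "\<exists>Y. (\<forall>n. norm (fps_nth Y n) \<le> C1 * (C2 * (1 / norm \<zeta>)) * B * \<sigma> ^ n) \<and>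
                (\<forall>n\<ge>degree p. fps_nth (fps_of_poly p * Y) n = b n)"
      by (intro exI[of _ Y]) (auto simp: mult_ac)
  qed
qed

text \<open>
  A Neumann series: solve the constant recurrence with right-hand side \<open>b\<close>, feed the error
  \<open>[z^n] ((Q - Qn n) Y)\<close> back as the next right-hand side, and sum. Ignoring all indices below a
  large \<open>N\<close> makes the error operator a contraction by \<open>1/2\<close>, since \<open>Q - Qn n\<close> tends to \<open>0\<close>.
\<close>

lemma perturbed_recurrence_bounded_solution:
  fixes Q :: "complex poly" and Qn :: "nat \<Rightarrow> complex poly"
  assumes "\<sigma> > 0" "poly Q 0 \<noteq> 0" "\<And>z. poly Q z = 0 \<Longrightarrow> norm z * \<sigma> \<noteq> 1"
    and deg: "degree Q \<le> M" "\<And>n. n \<ge> n0 \<Longrightarrow> degree (Qn n) \<le> M"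
    and conv: "(\<lambda>n. l1_norm (Q - Qn n)) \<longlonglongrightarrow> 0"
    and b: "\<And>n. norm (b n) \<le> B * \<sigma> ^ n"
  shows "\<exists>C N Y. (\<forall>n. norm (fps_nth Y n) \<le> C * \<sigma> ^ n) \<and> (\<forall>n\<ge>N. fps_nth (fps_of_poly (Qn n) * Y) n = b n)"
proof -
  obtain C where C: "C > 0"
      "\<And>B b. (\<forall>n. norm (b n) \<le> B * \<sigma> ^ n) \<Longrightarrow>
           (\<exists>Y. (\<forall>n. norm (fps_nth Y n) \<le> C * B * \<sigma> ^ n) \<and>
                (\<forall>n\<ge>degree Q. fps_nth (fps_of_poly Q * Y) n = b n))"
    using constant_recurrence_bounded_solution[OF assms(1-3)] by blast
  \<comment> \<open>Chosen so that one round trip through the error operator halves the norm.\<close>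
  define \<epsilon> where "\<epsilon> = 1 / (2 * C * (1 + 1/\<sigma>) ^ M)"
  have pos: "(1 + 1/\<sigma>) ^ M > 0" using \<open>\<sigma> > 0\<close> by (intro zero_less_power add_pos_pos) auto
  then have "\<epsilon> > 0" using C(1) by (simp add: \<epsilon>_def)
  then have "eventually (\<lambda>n. l1_norm (Q - Qn n) < \<epsilon>) sequentially"
    using order_tendstoD(2)[OF conv] by blast
  then obtain n1 where n1: "\<And>n. n \<ge> n1 \<Longrightarrow> l1_norm (Q - Qn n) < \<epsilon>" by (auto simp: eventually_at_top_linorder)
  define N where "N = max (max n0 n1) M"
  have B0: "B \<ge> 0" using order_trans[OF norm_ge_zero b[of 0]] by simp
  define E where "E Y n = (if n \<ge> N then fps_nth (fps_of_poly (Q - Qn n) * Y) n else 0)" for Y n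
  have E_le: "norm (E Y n) \<le> B' / 2 * \<sigma> ^ n" if Y: "\<forall>n. norm (fps_nth Y n) \<le> C * B' * \<sigma> ^ n" and "B' \<ge> 0" for Y B' n
  proof (cases "n \<ge> N")
    case True
    have "norm (E Y n) \<le> l1_norm (Q - Qn n) * (C * B' * (1 + 1/\<sigma>) ^ M * \<sigma> ^ n)"
      unfolding E_def using True Y \<open>\<sigma> > 0\<close> deg by (auto intro!: norm_poly_mult_nth_le degree_diff_le simp: N_def)
    also have "\<dots> \<le> \<epsilon> * (C * B' * (1 + 1/\<sigma>) ^ M * \<sigma> ^ n)"
      using True n1[of n] C(1) \<open>\<sigma> > 0\<close> \<open>B' \<ge> 0\<close> by (intro mult_right_mono mult_nonneg_nonneg) (auto simp: N_def)
    also have "\<dots> = (\<epsilon> * (C * (1 + 1/\<sigma>) ^ M)) * B' * \<sigma> ^ n" by (simp only: mult_ac)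
    also have "\<epsilon> * (C * (1 + 1/\<sigma>) ^ M) = 1/2"
      using C(1) less_imp_neq[OF pos] by (auto simp: \<epsilon>_def)
    finally show ?thesis by simp
  next
    case False
    then show ?thesis using \<open>B' \<ge> 0\<close> \<open>\<sigma> > 0\<close> by (simp add: E_def)
  qed
  define T where "T B b = (SOME Y. (\<forall>n. norm (fps_nth Y n) \<le> C * B * \<sigma> ^ n) \<and>
                (\<forall>n\<ge>degree Q. fps_nth (fps_of_poly Q * Y) n = b n))" for B b
  have T: "\<forall>n. norm (fps_nth (T B b) n) \<le> C * B * \<sigma> ^ n"
      "n \<ge> degree Q \<Longrightarrow> fps_nth (fps_of_poly Q * T B b) n = b n"
    if "\<forall>n. norm (b n) \<le> B * \<sigma> ^ n" for B b n
    using someI_ex[OF C(2)[OF that]] unfolding T_def by blast+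
  define c where "c = rec_nat b (\<lambda>k e. E (T (B / 2 ^ k) e))"
  have c: "c 0 = b" "\<And>k. c (Suc k) = E (T (B / 2 ^ k) (c k))" by (simp_all add: c_def)
  have c_le: "\<forall>n. norm (c k n) \<le> B / 2 ^ k * \<sigma> ^ n" for k
  proof (induction k)
    case (Suc k)
    show ?case unfolding c using E_le[OF T(1)[OF Suc]] B0 by (simp add: field_simps)
  qed (use b c in auto)
  define Yk where "Yk k = T (B / 2 ^ k) (c k)" for k
  have Yk: "norm (fps_nth (Yk k) n) \<le> C * B * \<sigma> ^ n * (1/2) ^ k"
      "n \<ge> degree Q \<Longrightarrow> fps_nth (fps_of_poly Q * Yk k) n = c k n" for k n
    unfolding Yk_def using T[OF c_le[of k]] by (simp_all add: power_divide mult_ac)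
  have geo: "(\<lambda>k. C * B * \<sigma> ^ n * (1/2) ^ k) sums (C * B * \<sigma> ^ n * 2)" for n
    using sums_mult[OF geometric_sums[of "1/2 :: real"], of "C * B * \<sigma> ^ n"] by simp
  have summ: "summable (\<lambda>k. fps_nth (Yk k) n)" for n
    by (rule summable_comparison_test[OF _ sums_summable[OF geo[of n]]]) (use Yk(1) in blast)
  define Y where "Y = Abs_fps (\<lambda>n. \<Sum>k. fps_nth (Yk k) n)"
  have Y_le: "norm (fps_nth Y n) \<le> 2 * C * B * \<sigma> ^ n" for n
  proof -
    have "norm (fps_nth Y n) \<le> (\<Sum>k. C * B * \<sigma> ^ n * (1/2) ^ k)"
      unfolding Y_def fps_nth_Abs_fps by (rule norm_suminf_le[OF _ sums_summable[OF geo]]) (rule Yk(1))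
    also have "\<dots> = 2 * C * B * \<sigma> ^ n" using sums_unique[OF geo[of n]] by simp
    finally show ?thesis .
  qed
  have "fps_nth (fps_of_poly (Qn n) * Y) n = b n" if n: "n \<ge> N" for n
  proof -
    have step: "fps_nth (fps_of_poly (Qn n) * Yk k) n = c k n - c (Suc k) n" for k
    proof -
      have "fps_of_poly (Qn n) * Yk k = fps_of_poly Q * Yk k - fps_of_poly (Q - Qn n) * Yk k"
        by (simp add: fps_of_poly_diff algebra_simps)
      moreover have "c (Suc k) n = fps_nth (fps_of_poly (Q - Qn n) * Yk k) n"
        using n by (simp add: c E_def Yk_def)
      ultimately show ?thesis using Yk(2)[of n k] n deg(1) by (simp add: N_def)
    qed
    have part: "(\<Sum>k<K. fps_nth (fps_of_poly (Qn n) * Yk k) n) = b n - c K n" for K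
      by (induction K) (simp_all add: step c(1))
    have "(\<lambda>K. B / 2 ^ K * \<sigma> ^ n) \<longlonglongrightarrow> 0"
    proof -
      have "(\<lambda>K. B * \<sigma> ^ n * (1/2) ^ K) \<longlonglongrightarrow> B * \<sigma> ^ n * 0"
        by (intro tendsto_intros LIMSEQ_power_zero) auto
      then show ?thesis by (simp add: power_divide)
    qed
    then have "(\<lambda>K. c K n) \<longlonglongrightarrow> 0"
      by (rule Lim_null_comparison[rotated]) (use c_le in auto)
    from tendsto_diff[OF tendsto_const this, of "b n"]
    have "(\<lambda>K. \<Sum>k<K. fps_nth (fps_of_poly (Qn n) * Yk k) n) \<longlonglongrightarrow> b n" by (simp add: part)
    then have "(\<lambda>k. fps_nth (fps_of_poly (Qn n) * Yk k) n) sums b n" by (simp add: sums_def)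
    moreover have "(\<lambda>k. fps_nth (fps_of_poly (Qn n) * Yk k) n) sums fps_nth (fps_of_poly (Qn n) * Y) n"
      unfolding fps_mult_nth fps_of_poly_nth
      by (intro sums_sum sums_mult) (auto simp: Y_def intro!: summable_sums summ)
    ultimately show ?thesis by (rule sums_unique2[symmetric])
  qed
  with Y_le show ?thesis by blast
qed


section \<open>Series annihilated by a convergent sequence of polynomials\<close>

text \<open>
  The recurrence bounds each coefficient by a fixed multiple of the sum of the \<open>M\<close> preceding ones,
  so the coefficients grow at most geometrically.
\<close>

lemma recurrence_conv_radius_pos:
  fixes g :: "complex fps" and Qn :: "nat \<Rightarrow> complex poly"
  assumes g: "\<And>n. n \<ge> n0 \<Longrightarrow> fps_nth (fps_of_poly (Qn n) * g) n = 0"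
    and deg: "\<And>n. n \<ge> n0 \<Longrightarrow> degree (Qn n) \<le> M"
    and bnd: "\<And>n. n \<ge> n0 \<Longrightarrow> l1_norm (Qn n) \<le> B"
    and low: "\<And>n. n \<ge> n0 \<Longrightarrow> norm (coeff (Qn n) 0) \<ge> \<kappa>" "\<kappa> > 0"
  shows "fps_conv_radius g > 0"
proof -
  have B: "B \<ge> 0" using order_trans[OF l1_norm_nonneg bnd[of n0]] by simp
  define A where "A = 1 + B / \<kappa>"
  have A: "A \<ge> 1" using B low(2) by (simp add: A_def)
  define D where "D = (\<Sum>k<n0. norm (fps_nth g k))"
  have D: "D \<ge> 0" by (simp add: D_def sum_nonneg)
  have bound: "norm (fps_nth g n) \<le> D * A ^ n" for n
  proof (induction n rule: less_induct)
    case (less n)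
    show ?case
    proof (cases "n < n0")
      case True
      then have "norm (fps_nth g n) \<le> D" unfolding D_def by (intro member_le_sum) auto
      also have "\<dots> \<le> D * A ^ n" using D A by (simp add: mult_le_cancel_left1 one_le_power)
      finally show ?thesis .
    next
      case False
      then have n: "n \<ge> n0" by simp
      have "{..min n M} = insert 0 {1..min n M}" by auto
      then have "fps_nth (fps_of_poly (Qn n) * g) n =
          coeff (Qn n) 0 * fps_nth g n + (\<Sum>i=1..min n M. coeff (Qn n) i * fps_nth g (n - i))"
        unfolding fps_of_poly_mult_nth[OF deg[OF n]] by simp
      then have eq0: "coeff (Qn n) 0 * fps_nth g n = - (\<Sum>i=1..min n M. coeff (Qn n) i * fps_nth g (n - i))"
        using g[OF n] by (simp add: add_eq_0_iff2)
      then have "norm (coeff (Qn n) 0 * fps_nth g n) \<le> (\<Sum>i=1..min n M. norm (coeff (Qn n) i * fps_nth g (n - i)))"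
        by (simp only: norm_minus_cancel norm_sum)
      also have "\<dots> \<le> (\<Sum>i=1..min n M. norm (coeff (Qn n) i) * (D * A ^ (n - 1)))"
      proof (intro sum_mono)
        fix i assume i: "i \<in> {1..min n M}"
        then have "norm (fps_nth g (n - i)) \<le> D * A ^ (n - i)" by (intro less.IH) auto
        also have "\<dots> \<le> D * A ^ (n - 1)" using A D i by (intro mult_left_mono power_increasing) auto
        finally show "norm (coeff (Qn n) i * fps_nth g (n - i)) \<le> norm (coeff (Qn n) i) * (D * A ^ (n - 1))"
          by (simp add: norm_mult mult_left_mono)
      qed
      also have "\<dots> = (\<Sum>i=1..min n M. norm (coeff (Qn n) i)) * (D * A ^ (n - 1))"
        by (simp add: sum_distrib_right)
      also have "(\<Sum>i=1..min n M. norm (coeff (Qn n) i)) \<le> l1_norm (Qn n)"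
        unfolding l1_norm_eq[OF deg[OF n]] by (intro sum_mono2) auto
      then have "(\<Sum>i=1..min n M. norm (coeff (Qn n) i)) * (D * A ^ (n - 1)) \<le> B * (D * A ^ (n - 1))"
        using A D bnd[OF n] by (intro mult_right_mono) auto
      finally have "norm (coeff (Qn n) 0) * norm (fps_nth g n) \<le> B * (D * A ^ (n - 1))"
        by (simp add: norm_mult)
      moreover have "\<kappa> * norm (fps_nth g n) \<le> norm (coeff (Qn n) 0) * norm (fps_nth g n)"
        by (intro mult_right_mono low n) auto
      ultimately have "\<kappa> * norm (fps_nth g n) \<le> B * (D * A ^ (n - 1))" by linarith
      then have *: "norm (fps_nth g n) \<le> (B / \<kappa>) * (D * A ^ (n - 1))"
        using low(2) by (simp add: field_simps)
      also have "\<dots> \<le> D * A ^ n"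
      proof (cases n)
        case 0
        then have "n0 = 0" using n by simp
        then show ?thesis by (simp add: D_def)
      next
        case (Suc k)
        have "(B / \<kappa>) * (D * A ^ k) \<le> A * (D * A ^ k)"
          using A D by (intro mult_right_mono) (auto simp: A_def)
        then show ?thesis using Suc by (simp add: mult_ac)
      qed
      finally show ?thesis .
    qed
  qed
  have "ereal (1 / A) \<le> fps_conv_radius g"
    by (rule conv_radius_ge_of_coeff_bound[of A 0]) (use A bound in auto)
  moreover have "0 < ereal (1 / A)" using A by simp
  ultimately show ?thesis by (rule less_le_trans[rotated])
qed

text \<open>
  For large \<open>n\<close>, \<open>[z^n] (Q g) = [z^n] ((Q - Qn n) g)\<close>, which gains a factor \<open>\<delta>^n\<close> over the
  coefficients of \<open>g\<close>.
\<close>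

lemma conv_radius_mult_limit_ge:
  fixes g :: "complex fps" and Qn :: "nat \<Rightarrow> complex poly"
  assumes g: "\<And>n. n \<ge> n0 \<Longrightarrow> fps_nth (fps_of_poly (Qn n) * g) n = 0"
    and deg: "degree Q \<le> M" "\<And>n. n \<ge> n0 \<Longrightarrow> degree (Qn n) \<le> M"
    and rate: "\<And>n. n \<ge> n0 \<Longrightarrow> l1_norm (Q - Qn n) \<le> C * \<delta> ^ n" "\<delta> > 0"
    and r: "ereal r < fps_conv_radius g" "r > 0"
  shows "fps_conv_radius (fps_of_poly Q * g) \<ge> r / \<delta>"
proof -
  obtain C2 where C2: "C2 > 0" "\<And>n. norm (fps_nth g n) \<le> C2 * (1/r) ^ n"
    using coeff_bound_of_conv_radius[of "1/r" g] r by auto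
  have "norm (fps_nth (fps_of_poly Q * g) n) \<le> (C * C2 * (1 + 1/(1/r)) ^ M) * (\<delta> / r) ^ n" if n: "n \<ge> n0" for n
  proof -
    have "fps_of_poly Q * g = fps_of_poly (Q - Qn n) * g + fps_of_poly (Qn n) * g"
      by (simp add: fps_of_poly_diff algebra_simps)
    then have "fps_nth (fps_of_poly Q * g) n = fps_nth (fps_of_poly (Q - Qn n) * g) n"
      using g[OF n] by simp
    also have "norm \<dots> \<le> l1_norm (Q - Qn n) * (C2 * (1 + 1/(1/r)) ^ M * (1/r) ^ n)"
      using deg n C2 r(2) by (intro norm_poly_mult_nth_le degree_diff_le) auto
    also have "\<dots> \<le> (C * \<delta> ^ n) * (C2 * (1 + 1/(1/r)) ^ M * (1/r) ^ n)"
      using C2 r(2) by (intro mult_right_mono rate n) auto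
    also have "\<dots> = (C * C2 * (1 + 1/(1/r)) ^ M) * (\<delta> / r) ^ n"
      by (simp add: power_divide mult_ac)
    finally show ?thesis .
  qed
  then have "fps_conv_radius (fps_of_poly Q * g) \<ge> ereal (1 / (\<delta> / r))"
    using rate(2) r(2) by (intro conv_radius_ge_of_coeff_bound) auto
  then show ?thesis by simp
qed

text \<open>
  The series \<open>g\<close> converges up to its pole \<open>\<xi>\<close>, so by the gain in radius \<open>Q g\<close> is analytic beyond \<open>\<xi>\<close>,
  and \<open>Q\<close> must cancel the pole.
\<close>

lemma pole_order_le_order_limit:
  fixes g :: "complex fps" and Qn :: "nat \<Rightarrow> complex poly"
  assumes g: "\<And>n. n \<ge> n0 \<Longrightarrow> fps_nth (fps_of_poly (Qn n) * g) n = 0"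
    and deg: "degree Q \<le> M" "\<And>n. n \<ge> n0 \<Longrightarrow> degree (Qn n) \<le> M"
    and rate: "\<And>n. n \<ge> n0 \<Longrightarrow> l1_norm (Q - Qn n) \<le> C * \<delta> ^ n" "\<delta> > 0" "\<delta> < 1"
    and pole: "fps_conv_radius (fps_of_poly ([:-\<xi>, 1:] ^ s) * g) > norm \<xi>"
      "eval_fps (fps_of_poly ([:-\<xi>, 1:] ^ s) * g) \<xi> \<noteq> 0" "\<xi> \<noteq> 0"
    and "Q \<noteq> 0"
  shows "s \<le> order \<xi> Q"
proof (rule order_ge_of_fps_eq)
  show "fps_of_poly ([:-\<xi>, 1:] ^ s) * (fps_of_poly Q * g) = fps_of_poly Q * (fps_of_poly ([:-\<xi>, 1:] ^ s) * g)"
    by (simp only: mult_ac)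
  \<comment> \<open>Any \<open>r\<close> strictly between \<open>\<delta> |\<xi>|\<close> and \<open>|\<xi>|\<close> would do.\<close>
  define r where "r = norm \<xi> * (1 + \<delta>) / 2"
  have "r < norm \<xi>" using rate pole(3) by (simp add: r_def field_simps)
  have "r > 0" using rate pole(3) by (simp add: r_def)
  have "norm \<xi> < r / \<delta>" using rate pole(3) by (simp add: r_def field_simps)
  have "ereal r < ereal (norm \<xi>)" using \<open>r < norm \<xi>\<close> by simp
  also have "ereal (norm \<xi>) \<le> fps_conv_radius g"
    using less_imp_le[OF pole(1)] pole(3) by (rule conv_radius_ge_of_linear_power_mult)
  finally have r: "ereal r < fps_conv_radius g" .
  have "ereal (norm \<xi>) < ereal (r / \<delta>)" using \<open>norm \<xi> < r / \<delta>\<close> by simp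
  also have "ereal (r / \<delta>) \<le> fps_conv_radius (fps_of_poly Q * g)"
    by (rule conv_radius_mult_limit_ge[OF g deg rate(1,2) r \<open>r > 0\<close>])
  finally show "fps_conv_radius (fps_of_poly Q * g) > norm \<xi>" .
qed (fact pole \<open>Q \<noteq> 0\<close>)+

text \<open>
  Induction on \<open>M\<close>. If the last coordinate were determined by the others on \<open>W\<close>, it would be a linear
  form in them, and the difference would be a nonzero annihilating form; otherwise \<open>W\<close> contains a
  vector that is supported on the last coordinate.
\<close>

lemma subspace_full_of_trivial_annihilator:
  fixes W :: "(nat \<Rightarrow> complex) set"
  assumes "W \<noteq> {}" and add: "\<And>v w. v \<in> W \<Longrightarrow> w \<in> W \<Longrightarrow> (\<lambda>i. v i + w i) \<in> W"
    and scale: "\<And>c w. w \<in> W \<Longrightarrow> (\<lambda>i. c * w i) \<in> W"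
    and ann: "\<And>q. (\<And>w. w \<in> W \<Longrightarrow> (\<Sum>i<M. q i * w i) = 0) \<Longrightarrow> (\<And>i. i < M \<Longrightarrow> q i = 0)"
  shows "\<exists>w\<in>W. \<forall>i<M. w i = x i"
  using ann
proof (induction M arbitrary: x)
  case 0
  then show ?case using \<open>W \<noteq> {}\<close> by auto
next
  case (Suc M)
  have full: "\<exists>w\<in>W. \<forall>i<M. w i = x i" for x
  proof (rule Suc.IH)
    fix q :: "nat \<Rightarrow> complex" and i
    assume q: "\<And>w. w \<in> W \<Longrightarrow> (\<Sum>i<M. q i * w i) = 0" and i: "i < M"
    have "(q(M := 0)) i = 0"
    proof (rule Suc.prems)
      fix w assume "w \<in> W"
      then show "(\<Sum>i<Suc M. (q(M := 0)) i * w i) = 0" using q by simp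
    qed (use i in simp)
    then show "q i = 0" using i by simp
  qed
  have "\<exists>w\<in>W. (\<forall>i<M. w i = 0) \<and> w M \<noteq> 0"
  proof (rule ccontr)
    assume *: "\<not> ?thesis"
    have "\<forall>j. \<exists>w. w \<in> W \<and> (\<forall>i<M. w i = (if i = j then 1 else 0))"
    proof
      fix j
      show "\<exists>w. w \<in> W \<and> (\<forall>i<M. w i = (if i = j then 1 else 0))"
        using full[of "\<lambda>i. if i = j then 1 else 0"] by blast
    qed
    from choice[OF this] obtain e where
      e: "\<And>j. e j \<in> W" "\<And>i j. i < M \<Longrightarrow> e j i = (if i = j then 1 else 0)" by blast
    have sum_in: "(\<lambda>i. \<Sum>j<k. c j * e j i) \<in> W" for c and k :: nat
    proof (induction k)
      case 0
      obtain w where "w \<in> W" using \<open>W \<noteq> {}\<close> by blast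
      from scale[OF this, of 0] show ?case by simp
    next
      case (Suc k)
      from add[OF Suc scale[OF e(1)[of k], of "c k"]] show ?case by (simp add: add.commute)
    qed
    \<comment> \<open>For \<open>w \<in> W\<close> the last coordinate has to be \<open>\<Sum>j<M. w j * e j M\<close>.\<close>
    define q where "q i = (if i = M then -1 else e i M)" for i
    have "q M = 0"
    proof (rule Suc.prems)
      fix w assume w: "w \<in> W"
      define v where "v = (\<lambda>i. w i + (-1) * (\<Sum>j<M. w j * e j i))"
      have "v \<in> W" unfolding v_def using w sum_in scale add by blast
      moreover have "v i = 0" if "i < M" for i
      proof -
        have "(\<Sum>j<M. w j * e j i) = (\<Sum>j<M. if j = i then w i else 0)"
          using that by (intro sum.cong) (auto simp: e(2))
        then show ?thesis using that by (simp add: v_def)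
      qed
      ultimately have "v M = 0" using * by blast
      then show "(\<Sum>i<Suc M. q i * w i) = 0" by (simp add: v_def q_def mult.commute)
    qed simp
    then show False by (simp add: q_def)
  qed
  then obtain u where u: "u \<in> W" "\<And>i. i < M \<Longrightarrow> u i = 0" "u M \<noteq> 0" by blast
  obtain w where w: "w \<in> W" "\<And>i. i < M \<Longrightarrow> w i = x i" using full[of x] by blast
  have "(\<lambda>i. w i + ((x M - w M) / u M) * u i) \<in> W" using u w add scale by blast
  moreover have "\<forall>i<Suc M. w i + ((x M - w M) / u M) * u i = x i"
    using u w by (auto simp: less_Suc_eq)
  ultimately show ?case by (intro bexI[of _ "\<lambda>i. w i + ((x M - w M) / u M) * u i"]) auto
qed

text \<open>
  A relation between the \<open>M\<close> coefficients of all \<open>g \<in> V\<close> just below an index \<open>N\<close> is an annihilator at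
  \<open>N\<close> with zero constant term. By uniqueness it is a multiple of \<open>Qn N\<close>, whose constant term is
  nonzero, so it is trivial. Hence these windows fill \<open>\<complex>^M\<close>, and since the recurrence
  determines all later coefficients, every solution agrees with some \<open>g \<in> V\<close> from some index on.
\<close>

lemma recurrence_solution_in_space:
  fixes V :: "complex fps set" and Qn :: "nat \<Rightarrow> complex poly" and w :: "complex fps"
  assumes V: "V \<noteq> {}" "\<And>g h. g \<in> V \<Longrightarrow> h \<in> V \<Longrightarrow> g + h \<in> V" "\<And>c g. g \<in> V \<Longrightarrow> fps_const c * g \<in> V"
    and deg: "\<And>n. n \<ge> n0 \<Longrightarrow> degree (Qn n) \<le> M"
    and nz: "\<And>n. n \<ge> n0 \<Longrightarrow> coeff (Qn n) 0 \<noteq> 0"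
    and ann: "\<And>n. n \<ge> n0 \<Longrightarrow> annihilates V n (Qn n)"
    and uniq: "\<And>n P. n \<ge> n0 \<Longrightarrow> annihilates V n P \<Longrightarrow> degree P \<le> M \<Longrightarrow> \<exists>c. P = smult c (Qn n)"
    and w: "\<And>n. n \<ge> n0 \<Longrightarrow> fps_nth (fps_of_poly (Qn n) * w) n = 0"
  shows "\<exists>g\<in>V. \<exists>N. \<forall>n\<ge>N. fps_nth g n = fps_nth w n"
proof -
  define N where "N = n0 + M"
  \<comment> \<open>The window of the \<open>M\<close> coefficients that precede index \<open>N\<close>.\<close>
  define W where "W = (\<lambda>g i. fps_nth g (N - Suc i)) ` V"
  have "\<exists>v\<in>W. \<forall>i<M. v i = fps_nth w (N - Suc i)"
  proof (rule subspace_full_of_trivial_annihilator)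
    show "W \<noteq> {}" using V(1) by (simp add: W_def)
    show "(\<lambda>i. u i + v i) \<in> W" if uv: "u \<in> W" "v \<in> W" for u v
    proof -
      obtain g h where gh: "g \<in> V" "h \<in> V" "u = (\<lambda>i. fps_nth g (N - Suc i))" "v = (\<lambda>i. fps_nth h (N - Suc i))"
        using uv unfolding W_def by blast
      show ?thesis unfolding W_def
        by (rule image_eqI[of _ _ "g + h"]) (use gh V(2) in auto)
    qed
    show "(\<lambda>i. c * u i) \<in> W" if uv: "u \<in> W" for u c
    proof -
      obtain g where g: "g \<in> V" "u = (\<lambda>i. fps_nth g (N - Suc i))"
        using uv unfolding W_def by blast
      show ?thesis unfolding W_def
        by (rule image_eqI[of _ _ "fps_const c * g"]) (use g V(3) in auto)
    qed
    fix q :: "nat \<Rightarrow> complex" and i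
    assume q: "\<And>v. v \<in> W \<Longrightarrow> (\<Sum>i<M. q i * v i) = 0" and i: "i < M"
    define P where "P = (\<Sum>i<M. monom (q i) (Suc i))"
    have coeff_P: "coeff P j = (if 1 \<le> j \<and> j \<le> M then q (j - 1) else 0)" for j
    proof -
      have "coeff P j = (\<Sum>i<M. if i = j - 1 \<and> 1 \<le> j then q i else 0)"
        unfolding P_def coeff_sum by (intro sum.cong) auto
      also have "\<dots> = (if 1 \<le> j \<and> j \<le> M then q (j - 1) else 0)" by auto
      finally show ?thesis .
    qed
    have degP: "degree P \<le> M" by (rule degree_le) (simp add: coeff_P)
    have "annihilates V N P" unfolding annihilates_def
    proof
      fix g assume "g \<in> V"
      have "fps_nth (fps_of_poly P * g) N = (\<Sum>i\<le>M. coeff P i * fps_nth g (N - i))"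
        unfolding fps_of_poly_mult_nth[OF degP] by (simp add: N_def)
      also have "\<dots> = coeff P 0 * fps_nth g N + (\<Sum>i<M. coeff P (Suc i) * fps_nth g (N - Suc i))"
        by (simp only: lessThan_Suc_atMost[symmetric] sum.lessThan_Suc_shift diff_zero)
      also have "\<dots> = (\<Sum>i<M. q i * fps_nth g (N - Suc i))" by (simp add: coeff_P)
      also have "\<dots> = 0" using q[of "\<lambda>i. fps_nth g (N - Suc i)"] \<open>g \<in> V\<close> by (simp add: W_def)
      finally show "fps_nth (fps_of_poly P * g) N = 0" .
    qed
    with degP obtain c where c: "P = smult c (Qn N)" using uniq[of N P] by (auto simp: N_def)
    then have "c * coeff (Qn N) 0 = 0" using coeff_P[of 0] by simp
    then have "c = 0" using nz[of N] by (simp add: N_def)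
    with c have "coeff P (Suc i) = 0" by simp
    then show "q i = 0" using i by (simp add: coeff_P)
  qed
  then obtain g where g: "g \<in> V" "\<And>i. i < M \<Longrightarrow> fps_nth g (N - Suc i) = fps_nth w (N - Suc i)"
    by (auto simp: W_def)
  have "fps_nth g n = fps_nth w n" if "n \<ge> n0" for n
    using that
  proof (induction n rule: less_induct)
    case (less n)
    show ?case
    proof (cases "n < N")
      case True
      then have "n = N - Suc (N - Suc n)" "N - Suc n < M" using less.prems by (auto simp: N_def)
      then show ?thesis using g(2) by metis
    next
      case False
      have eq: "coeff (Qn n) 0 * fps_nth v n + (\<Sum>i<M. coeff (Qn n) (Suc i) * fps_nth v (n - Suc i)) =
          fps_nth (fps_of_poly (Qn n) * v) n" for v
      proof -
        have "min n M = M" using False by (simp add: N_def)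
        then show ?thesis
          unfolding fps_of_poly_mult_nth[OF deg[OF less.prems]]
          by (simp only: lessThan_Suc_atMost[symmetric] sum.lessThan_Suc_shift diff_zero)
      qed
      have "(\<Sum>i<M. coeff (Qn n) (Suc i) * fps_nth g (n - Suc i)) = (\<Sum>i<M. coeff (Qn n) (Suc i) * fps_nth w (n - Suc i))"
      proof (intro sum.cong refl)
        fix i assume "i \<in> {..<M}"
        then have "fps_nth g (n - Suc i) = fps_nth w (n - Suc i)"
          using False by (intro less.IH) (auto simp: N_def)
        then show "coeff (Qn n) (Suc i) * fps_nth g (n - Suc i) = coeff (Qn n) (Suc i) * fps_nth w (n - Suc i)"
          by simp
      qed
      moreover have "fps_nth (fps_of_poly (Qn n) * g) n = 0"
        using ann[OF less.prems] g(1) by (simp add: annihilates_def)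
      ultimately have "coeff (Qn n) 0 * fps_nth g n = coeff (Qn n) 0 * fps_nth w n"
        using eq[of g] eq[of w] w[OF less.prems] by (metis add_right_imp_eq)
      then show ?thesis using nz[OF less.prems] by simp
    qed
  qed
  with g(1) show ?thesis by blast
qed

text \<open>
  Start from \<open>U = 1 / (z - \<xi>)^s\<close>. As \<open>Q U\<close> is a polynomial, the coefficients of \<open>U\<close> violate the
  recurrence at \<open>n\<close> only by \<open>[z^n] ((Q - Qn n) U)\<close>, which is of order \<open>\<rho>^(-n)\<close>. The
  Neumann series supplies a correction \<open>Y\<close> with coefficients of the same order, and \<open>U + Y\<close> is a
  solution, hence agrees with some \<open>g \<in> V\<close> up to a polynomial.
\<close>

lemma combination_with_prescribed_pole:
  fixes V :: "complex fps set" and Qn :: "nat \<Rightarrow> complex poly"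
  assumes V: "V \<noteq> {}" "\<And>g h. g \<in> V \<Longrightarrow> h \<in> V \<Longrightarrow> g + h \<in> V" "\<And>c g. g \<in> V \<Longrightarrow> fps_const c * g \<in> V"
    and deg: "degree Q \<le> M" "\<And>n. n \<ge> n0 \<Longrightarrow> degree (Qn n) \<le> M"
    and nz: "\<And>n. n \<ge> n0 \<Longrightarrow> coeff (Qn n) 0 \<noteq> 0"
    and ann: "\<And>n. n \<ge> n0 \<Longrightarrow> annihilates V n (Qn n)"
    and uniq: "\<And>n P. n \<ge> n0 \<Longrightarrow> annihilates V n P \<Longrightarrow> degree P \<le> M \<Longrightarrow> \<exists>c. P = smult c (Qn n)"
    and rate: "\<And>n. n \<ge> n0 \<Longrightarrow> l1_norm (Q - Qn n) \<le> C * \<delta> ^ n" "0 < \<delta>" "\<delta> < 1"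
    and Q0: "poly Q 0 \<noteq> 0" and s: "1 \<le> s" "s \<le> order \<xi> Q" "\<xi> \<noteq> 0"
    and \<rho>: "norm \<xi> < \<rho>" "\<rho> * \<delta> < norm \<xi>" "\<And>z. poly Q z = 0 \<Longrightarrow> norm z \<noteq> \<rho>"
  shows "\<exists>g\<in>V. fps_conv_radius (fps_of_poly ([:-\<xi>, 1:] ^ s) * g) \<ge> \<rho> \<and>
               eval_fps (fps_of_poly ([:-\<xi>, 1:] ^ s) * g) \<xi> \<noteq> 0"
proof -
  let ?L = "fps_of_poly ([:-\<xi>, 1:] ^ s)"
  have "\<rho> > 0" using \<rho>(1) by (rule le_less_trans[rotated]) simp
  have L0: "fps_nth ?L 0 \<noteq> 0" using s(3) by (simp add: poly_0_coeff_0[symmetric])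
  define U where "U = inverse ?L"
  have LU: "?L * U = 1" unfolding U_def using inverse_mult_eq_1[OF L0] by (simp only: mult.commute)
  have "fps_conv_radius (?L * U) \<ge> norm \<xi>" by (simp add: LU)
  then have convU: "fps_conv_radius U \<ge> norm \<xi>" using s(3) by (rule conv_radius_ge_of_linear_power_mult)
  \<comment> \<open>The rates match: \<open>\<delta> / r = 1 / \<rho>\<close>.\<close>
  define r where "r = \<rho> * \<delta>"
  have r: "r > 0" using \<open>\<rho> > 0\<close> rate(2) by (simp add: r_def)
  have "ereal (1 / (1 / r)) < ereal (norm \<xi>)" using \<rho>(2) by (simp add: r_def)
  also note convU
  finally obtain C2 where C2: "C2 > 0" "\<And>n. norm (fps_nth U n) \<le> C2 * (1 / r) ^ n"
    using coeff_bound_of_conv_radius[of "1 / r" U] r by auto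
  have "[:-\<xi>, 1:] ^ s dvd Q" using s(2) by (simp add: order_divides)
  then obtain K where K: "Q = [:-\<xi>, 1:] ^ s * K" ..
  have QU: "fps_nth (fps_of_poly Q * U) n = 0" if "n > M" for n
  proof -
    have "fps_of_poly Q * U = fps_of_poly K * (?L * U)" unfolding K fps_of_poly_mult by (simp only: mult_ac)
    then have eq: "fps_of_poly Q * U = fps_of_poly K" by (simp add: LU)
    have "Q \<noteq> 0" using Q0 by auto
    then have "degree K \<le> degree Q" by (intro dvd_imp_degree_le) (simp_all add: K)
    then show ?thesis using that deg(1) by (simp add: eq coeff_eq_0)
  qed
  \<comment> \<open>Beyond index \<open>M\<close> the polynomial \<open>Q U\<close> has no coefficients left.\<close>
  define n1 where "n1 = max n0 (Suc M)"
  define b where "b n = (if n \<ge> n1 then fps_nth (fps_of_poly (Q - Qn n) * U) n else 0)" for n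
  define B where "B = C * C2 * (1 + 1 / (1 / r)) ^ M"
  have C: "C \<ge> 0"
  proof -
    have "0 \<le> C * \<delta> ^ n0" using order_trans[OF l1_norm_nonneg rate(1)[of n0]] by simp
    then show ?thesis using zero_less_power[OF rate(2), of n0] by (auto simp: zero_le_mult_iff)
  qed
  have b_le: "norm (b n) \<le> B * (1 / \<rho>) ^ n" for n
  proof (cases "n \<ge> n1")
    case True
    then have n: "n \<ge> n0" by (simp add: n1_def)
    have "norm (b n) \<le> l1_norm (Q - Qn n) * (C2 * (1 + 1 / (1 / r)) ^ M * (1 / r) ^ n)"
    proof -
      have bn: "b n = fps_nth (fps_of_poly (Q - Qn n) * U) n" using True by (simp add: b_def)
      show ?thesis unfolding bn using C2 r deg n by (intro norm_poly_mult_nth_le degree_diff_le) auto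
    qed
    also have "\<dots> \<le> (C * \<delta> ^ n) * (C2 * (1 + 1 / (1 / r)) ^ M * (1 / r) ^ n)"
      using C2 r by (intro mult_right_mono rate n) auto
    also have "\<dots> = B * (\<delta> ^ n * (1 / r) ^ n)" by (simp only: B_def mult_ac)
    also have "\<delta> ^ n * (1 / r) ^ n = (1 / \<rho>) ^ n"
      using rate(2) by (simp add: r_def flip: power_mult_distrib)
    finally show ?thesis .
  next
    case False
    have "B \<ge> 0" unfolding B_def using C C2(1) r by (intro mult_nonneg_nonneg zero_le_power) auto
    with False show ?thesis using \<open>\<rho> > 0\<close> by (simp add: b_def)
  qed
  have "(\<lambda>n. C * \<delta> ^ n) \<longlonglongrightarrow> C * 0" using rate(2,3) by (intro tendsto_intros LIMSEQ_power_zero) auto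
  then have "(\<lambda>n. C * \<delta> ^ n) \<longlonglongrightarrow> 0" by simp
  moreover have "eventually (\<lambda>n. norm (l1_norm (Q - Qn n)) \<le> C * \<delta> ^ n) sequentially"
    using eventually_ge_at_top[of n0]
    by eventually_elim (use rate(1) in \<open>simp add: l1_norm_nonneg\<close>)
  ultimately have conv: "(\<lambda>n. l1_norm (Q - Qn n)) \<longlonglongrightarrow> 0"
    by (rule Lim_null_comparison[rotated])
  have "1 / \<rho> > 0" using \<open>\<rho> > 0\<close> by simp
  moreover have "norm z * (1 / \<rho>) \<noteq> 1" if "poly Q z = 0" for z using \<rho>(3)[OF that] \<open>\<rho> > 0\<close> by simp
  ultimately obtain C' N Y where Y: "\<And>n. norm (fps_nth Y n) \<le> C' * (1 / \<rho>) ^ n"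
      "\<And>n. n \<ge> N \<Longrightarrow> fps_nth (fps_of_poly (Qn n) * Y) n = b n"
    using perturbed_recurrence_bounded_solution[OF _ Q0 _ deg conv b_le] by blast
  define n2 where "n2 = max n1 N"
  have w: "fps_nth (fps_of_poly (Qn n) * (U + Y)) n = 0" if "n \<ge> n2" for n
  proof -
    have "fps_of_poly (Qn n) * (U + Y) =
        fps_of_poly Q * U - fps_of_poly (Q - Qn n) * U + fps_of_poly (Qn n) * Y"
      by (simp add: fps_of_poly_diff algebra_simps)
    then show ?thesis using that QU[of n] Y(2)[of n] by (simp add: n2_def n1_def b_def)
  qed
  have n2: "n \<ge> n0" if "n \<ge> n2" for n using that by (simp add: n2_def n1_def)
  obtain g N2 where g: "g \<in> V" "\<And>n. n \<ge> N2 \<Longrightarrow> fps_nth g n = fps_nth (U + Y) n"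
    using recurrence_solution_in_space[OF V deg(2)[OF n2] nz[OF n2] ann[OF n2] uniq[OF n2] w] by blast
  define Z where "Z = g - U"
  have "ereal (1 / (1 / \<rho>)) \<le> fps_conv_radius Z"
    by (rule conv_radius_ge_of_coeff_bound[of _ N2 _ C']) (use \<open>\<rho> > 0\<close> g(2) Y(1) in \<open>auto simp: Z_def\<close>)
  then have Z: "ereal \<rho> \<le> fps_conv_radius Z" by simp
  have Lg: "?L * g = 1 + ?L * Z" by (simp add: Z_def right_diff_distrib LU)
  have "min (fps_conv_radius ?L) (fps_conv_radius Z) \<le> fps_conv_radius (?L * Z)"
    by (rule fps_conv_radius_mult)
  with Z have LZ: "ereal \<rho> \<le> fps_conv_radius (?L * Z)" by simp
  have "min (fps_conv_radius (1 :: complex fps)) (fps_conv_radius (?L * Z)) \<le> fps_conv_radius (?L * g)"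
    unfolding Lg by (rule fps_conv_radius_add)
  with LZ have 1: "ereal \<rho> \<le> fps_conv_radius (?L * g)" by simp
  have *: "ereal (norm \<xi>) < ereal \<rho>" using \<rho>(1) by simp
  have "eval_fps (?L * g) \<xi> = 1 + eval_fps (?L * Z) \<xi>"
    unfolding Lg using less_le_trans[OF * LZ] by (subst eval_fps_add) auto
  also have "eval_fps (?L * Z) \<xi> = eval_fps ?L \<xi> * eval_fps Z \<xi>"
    using less_le_trans[OF * Z] by (intro eval_fps_mult) auto
  also have "eval_fps ?L \<xi> = 0" using s(1) by simp
  finally have "eval_fps (?L * g) \<xi> \<noteq> 0" by simp
  with 1 g(1) show ?thesis by blast
qed

section \<open>Rates of convergence\<close>

lemma limsup_root_le:
  assumes "\<And>n. n \<ge> n0 \<Longrightarrow> a n \<le> C * \<eta> ^ n" "C > 0" "\<eta> > 0"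
  shows "limsup (\<lambda>n. ereal (root n (a n))) \<le> ereal \<eta>"
proof -
  have "(\<lambda>n. ereal (root n C * \<eta>)) \<longlonglongrightarrow> ereal (1 * \<eta>)"
    by (intro tendsto_intros LIMSEQ_root_const assms)
  then have lim: "limsup (\<lambda>n. ereal (root n C * \<eta>)) = ereal \<eta>"
    by (subst lim_imp_Limsup) auto
  have "eventually (\<lambda>n. ereal (root n (a n)) \<le> ereal (root n C * \<eta>)) sequentially"
    using eventually_ge_at_top[of "max 1 n0"]
  proof eventually_elim
    case (elim n)
    have "root n (a n) \<le> root n (C * \<eta> ^ n)" using elim assms(1)[of n] by simp
    also have "\<dots> = root n C * \<eta>" using elim assms(3) by (simp add: real_root_mult real_root_power_cancel)
    finally show ?case by simp
  qed
  then show ?thesis unfolding lim[symmetric] by (rule Limsup_mono)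
qed

lemma eventually_le_power_of_limsup_root:
  assumes "limsup (\<lambda>n. ereal (root n (a n))) < ereal \<delta>" "\<And>n. a n \<ge> 0"
  shows "eventually (\<lambda>n. a n \<le> \<delta> ^ n) sequentially"
  using Limsup_lessD[OF assms(1)] eventually_gt_at_top[of 0]
proof eventually_elim
  case (elim n)
  then have "root n (a n) ^ n \<le> \<delta> ^ n" using assms(2)[of n] by (intro power_mono) auto
  then show ?case using elim assms(2)[of n] by simp
qed

lemma ereal_ratio_less_iff:
  assumes "x > 0" "y > 0" "R > 0"
  shows "ereal x / R < ereal y \<longleftrightarrow> ereal (x / y) < R"
proof (cases R)
  case (real r)
  with assms have "r > 0" by simp
  have "x / r < y \<longleftrightarrow> x < y * r" using \<open>r > 0\<close> by (rule pos_divide_less_eq)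
  also have "\<dots> \<longleftrightarrow> x / y < r"
    using pos_divide_less_eq[OF assms(2), of x r] by (simp only: mult.commute)
  finally show ?thesis using real \<open>r > 0\<close> by simp
qed (use assms in auto)

section \<open>System poles and characteristic values\<close>

lemma system_pole_order_eq:
  assumes "is_system_pole d f m \<xi> \<tau>"
  shows "system_pole_order d f m \<xi> = \<tau>"
  unfolding system_pole_order_def
  by (rule the_equality) (use assms is_system_pole_order_unique in blast)+

lemma is_system_pole_order:
  assumes "\<xi> \<in> system_poles d f m"
  shows "is_system_pole d f m \<xi> (system_pole_order d f m \<xi>)"
proof -
  obtain \<tau> where "is_system_pole d f m \<xi> \<tau>" using assms by (auto simp: system_poles_def)
  then show ?thesis using system_pole_order_eq by metis
qed

lemma system_pole_poly_props:
  assumes "finite (system_poles d f m)"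
  shows "lead_coeff (system_pole_poly d f m) = 1"
    and "poly (system_pole_poly d f m) z = 0 \<longleftrightarrow> z \<in> system_poles d f m"
    and "degree (system_pole_poly d f m) = (\<Sum>\<xi>\<in>system_poles d f m. system_pole_order d f m \<xi>)"
    and "poly (system_pole_poly d f m) 0 \<noteq> 0"
    and "\<xi> \<in> system_poles d f m \<Longrightarrow> order \<xi> (system_pole_poly d f m) = system_pole_order d f m \<xi>"
proof -
  let ?S = "system_poles d f m" and ?o = "system_pole_order d f m"
  let ?P = "system_pole_poly d f m"
  have pos: "?o \<xi> \<ge> 1" "\<xi> \<noteq> 0" if "\<xi> \<in> ?S" for \<xi>
    using is_system_pole_order[OF that] by (auto simp: is_system_pole_def)
  show "lead_coeff ?P = 1" by (simp add: system_pole_poly_def lead_coeff_prod lead_coeff_power)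
  show root: "poly ?P z = 0 \<longleftrightarrow> z \<in> ?S" for z
    using assms pos by (fastforce simp: system_pole_poly_def poly_prod)
  show "degree ?P = (\<Sum>\<xi>\<in>?S. ?o \<xi>)"
    unfolding system_pole_poly_def
    by (subst degree_prod_eq_sum_degree) (auto simp: degree_linear_power)
  show "poly ?P 0 \<noteq> 0" using root pos by blast
  assume \<xi>: "\<xi> \<in> ?S"
  have split: "?P = [:-\<xi>, 1:] ^ ?o \<xi> * (\<Prod>z\<in>?S - {\<xi>}. [:-z, 1:] ^ ?o z)"
    unfolding system_pole_poly_def by (rule prod.remove[OF assms \<xi>])
  have nz: "poly (\<Prod>z\<in>?S - {\<xi>}. [:-z, 1:] ^ ?o z) \<xi> \<noteq> 0"
    using assms by (auto simp: poly_prod)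
  have "?P \<noteq> 0" using \<open>lead_coeff ?P = 1\<close> by auto
  then show "order \<xi> ?P = ?o \<xi>"
    unfolding split using nz by (subst order_mult) (auto simp: order_power_n_n order_0I)
qed

text \<open>
  A function with germ \<open>g\<close> and a single pole on the closed disk through \<open>\<xi>\<close> keeps this property on
  a slightly larger disk.
\<close>

lemma char_radius_gt_norm:
  assumes "\<xi> \<in> system_poles d f m"
  shows "char_radius d f m \<xi> > norm \<xi>"
proof -
  let ?\<tau> = "system_pole_order d f m \<xi>"
  have sp: "is_system_pole d f m \<xi> ?\<tau>" using assms by (rule is_system_pole_order)
  have "ereal (norm \<xi>) < char_radius_order d f m \<xi> s" if s: "s \<in> {1..?\<tau>}" for s
  proof -
    obtain g where g: "g \<in> poly_combs d f m" "single_pole_on_disk g \<xi> s"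
      using sp s unfolding is_system_pole_def by blast
    have "\<xi> \<noteq> 0" using sp by (simp add: is_system_pole_def)
    obtain \<rho> where \<rho>: "ereal (norm \<xi>) < \<rho>" "\<rho> < fps_conv_radius (fps_of_poly ([:-\<xi>, 1:] ^ s) * g)"
      using single_pole_on_disk_imp_fps(1)[OF g(2) \<open>\<xi> \<noteq> 0\<close>] dense by blast
    note \<rho>(1)
    also have "\<rho> \<le> mero_radius s g"
      using g \<open>\<xi> \<noteq> 0\<close> s \<rho> by (intro mero_radius_ge[of _ \<xi>]) auto
    also have "\<dots> \<le> char_radius_order d f m \<xi> s"
      unfolding char_radius_order_def using g by (intro SUP_upper) auto
    finally show ?thesis .
  qed
  moreover have "{1..?\<tau>} \<noteq> {}" using sp by (auto simp: is_system_pole_def)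
  ultimately show ?thesis unfolding char_radius_def by (subst Min_gr_iff) auto
qed

text \<open>
  The characteristic radius is a minimum over \<open>s\<close> of suprema that need not be attained. A
  combination whose radius is as close to the supremum as desired suffices, because rates
  \<open>\<eta>\<close> strictly above \<open>|\<xi>| / R\<^sub>\<xi>\<close> are considered.
\<close>

lemma system_pole_combination_of_char_radius:
  assumes \<xi>: "\<xi> \<in> system_poles d f m" and s: "1 \<le> s" "s \<le> system_pole_order d f m \<xi>"
    and \<eta>: "ereal (norm \<xi>) / char_radius d f m \<xi> < ereal \<eta>" "0 < \<eta>" "\<eta> < 1"
  shows "\<exists>g\<in>poly_combs d f m. fps_conv_radius (fps_of_poly ([:-\<xi>, 1:] ^ s) * g) > norm \<xi> / \<eta> \<and>
           eval_fps (fps_of_poly ([:-\<xi>, 1:] ^ s) * g) \<xi> \<noteq> 0"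
proof -
  have "\<xi> \<noteq> 0" using is_system_pole_order[OF \<xi>] by (simp add: is_system_pole_def)
  have "ereal (norm \<xi> / \<eta>) < char_radius d f m \<xi>"
    using \<eta> \<open>\<xi> \<noteq> 0\<close> char_radius_gt_norm[OF \<xi>]
    by (subst ereal_ratio_less_iff[symmetric]) (auto intro: le_less_trans[of _ "ereal (norm \<xi>)"])
  also have "\<dots> \<le> char_radius_order d f m \<xi> s"
    unfolding char_radius_def using s by (intro Min_le) auto
  finally obtain g where g: "g \<in> poly_combs d f m" "single_pole_on_disk g \<xi> s"
      "ereal (norm \<xi> / \<eta>) < mero_radius s g"
    unfolding char_radius_order_def less_SUP_iff by auto
  have "ereal (norm \<xi>) \<le> ereal (norm \<xi> / \<eta>)"
    using \<eta> by (simp add: field_simps mult_left_le_one_le)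
  from single_pole_mero_radius_gt[OF g(2) \<open>\<xi> \<noteq> 0\<close> g(3) this]
    single_pole_on_disk_imp_fps(2)[OF g(2) \<open>\<xi> \<noteq> 0\<close>] g(1) show ?thesis by blast
qed

definition pole_ratios :: "nat \<Rightarrow> (nat \<Rightarrow> complex fps) \<Rightarrow> (nat \<Rightarrow> nat) \<Rightarrow> ereal set" where
  "pole_ratios d f m = {ereal (norm \<xi>) / char_radius d f m \<xi> | \<xi>. poly (system_pole_poly d f m) \<xi> = 0}"

lemma pole_ratios_props:
  assumes "finite (system_poles d f m)" "(\<Sum>\<xi>\<in>system_poles d f m. system_pole_order d f m \<xi>) = M" "M \<ge> 1"
  shows "finite (pole_ratios d f m)" "pole_ratios d f m \<noteq> {}"
    and "0 \<le> Max (pole_ratios d f m)" "Max (pole_ratios d f m) < 1"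
proof -
  have eq: "pole_ratios d f m = (\<lambda>\<xi>. ereal (norm \<xi>) / char_radius d f m \<xi>) ` system_poles d f m"
    unfolding pole_ratios_def system_pole_poly_props(2)[OF assms(1)] by auto
  show fin: "finite (pole_ratios d f m)" unfolding eq using assms(1) by simp
  have "system_poles d f m \<noteq> {}" using assms(2,3) by auto
  then show ne: "pole_ratios d f m \<noteq> {}" unfolding eq by simp
  have ratio: "0 \<le> x \<and> x < 1" if x: "x \<in> pole_ratios d f m" for x
  proof -
    obtain \<xi> where \<xi>: "\<xi> \<in> system_poles d f m" "x = ereal (norm \<xi>) / char_radius d f m \<xi>"
      using x unfolding eq by blast
    show ?thesis
    proof (cases "char_radius d f m \<xi>")
      case (real r)
      then have "norm \<xi> < r" using char_radius_gt_norm[OF \<xi>(1)] by simp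
      then have "0 < r" by (rule le_less_trans[OF norm_ge_zero])
      with \<open>norm \<xi> < r\<close> real show ?thesis by (simp add: \<xi>(2) one_ereal_def)
    qed (use char_radius_gt_norm[OF \<xi>(1)] \<xi>(2) in auto)
  qed
  show "Max (pole_ratios d f m) < 1" using fin ne ratio by (subst Max_less_iff) auto
  show "0 \<le> Max (pole_ratios d f m)" using Max_in[OF fin ne] ratio by blast
qed

section \<open>From system poles to convergence\<close>

lemma le_of_mi_size_le:
  assumes "\<forall>k\<in>{1..d}. m k \<ge> 1" "n \<ge> mi_size d m"
  shows "\<forall>k\<in>{1..d}. m k \<ge> 1 \<and> m k \<le> n"
proof
  fix k assume k: "k \<in> {1..d}"
  then have "m k \<le> mi_size d m" unfolding mi_size_def by (intro member_le_sum) auto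
  then show "m k \<ge> 1 \<and> m k \<le> n" using assms k by auto
qed

text \<open>
  The inequality \<open>\<theta> \<le> Max\<close> comes from the error bound \<open>\<eta>^n\<close> for every \<open>\<eta>\<close> between \<open>Max\<close> and \<open>1\<close>.
\<close>

lemma denoms_converge_of_system_poles:
  assumes Qs: "\<forall>n\<ge>mi_size d m. hermite_pade_denom d f m n (Qs n)"
    and M: "mi_size d m \<ge> 1"
    and poles: "finite (system_poles d f m)"
      "(\<Sum>\<xi>\<in>system_poles d f m. system_pole_order d f m \<xi>) = mi_size d m"
  shows "\<exists>\<theta>\<le>Max (pole_ratios d f m). denoms_converge d f m Qs (system_pole_poly d f m) \<theta>"
proof -
  let ?M = "mi_size d m" and ?P = "system_pole_poly d f m" and ?V = "poly_combs d f m"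
  note P = system_pole_poly_props[OF poles(1)]
  note R = pole_ratios_props[OF poles M]
  define \<theta> where "\<theta> = real_of_ereal (Max (pole_ratios d f m))"
  have \<theta>: "ereal \<theta> = Max (pole_ratios d f m)"
    unfolding \<theta>_def using R(3,4) by (cases "Max (pole_ratios d f m)") auto
  have \<theta>01: "0 \<le> \<theta>" "\<theta> < 1" using R(3,4) by (auto simp flip: \<theta>)
  have comb: "\<exists>g\<in>?V. fps_conv_radius (fps_of_poly ([:-\<xi>, 1:] ^ s) * g) > norm \<xi> / \<eta> \<and>
            eval_fps (fps_of_poly ([:-\<xi>, 1:] ^ s) * g) \<xi> \<noteq> 0"
    if "poly ?P \<xi> = 0" "1 \<le> s" "s \<le> order \<xi> ?P" "\<theta> < \<eta>" "\<eta> < 1" for \<xi> s \<eta>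
  proof (rule system_pole_combination_of_char_radius)
    show \<xi>: "\<xi> \<in> system_poles d f m" using that P(2) by blast
    show "s \<le> system_pole_order d f m \<xi>" using that P(5)[OF \<xi>] by simp
    have "ereal (norm \<xi>) / char_radius d f m \<xi> \<le> ereal \<theta>"
      unfolding \<theta> using R(1) that(1) by (intro Max_ge) (auto simp: pole_ratios_def)
    also have "\<dots> < ereal \<eta>" using that by simp
    finally show "ereal (norm \<xi>) / char_radius d f m \<xi> < ereal \<eta>" .
  qed (use that \<theta>01 in auto)
  have main: "\<exists>C>0. \<exists>n0. \<forall>n\<ge>n0. \<forall>Q. degree Q \<le> ?M \<longrightarrow> annihilates ?V n Q \<longrightarrow> Q \<noteq> 0 \<longrightarrow>
      degree Q = ?M \<and> poly Q 0 \<noteq> 0 \<and> (lead_coeff Q = 1 \<longrightarrow> l1_norm (?P - Q) \<le> C * \<eta> ^ n)"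
    if "\<theta> < \<eta>" "\<eta> < 1" for \<eta>
    by (rule annihilator_convergence[OF P(1,4) _ M comb \<theta>01(1) that]) (use P(3) poles(2) in auto)
  define \<eta>0 where "\<eta>0 = (\<theta> + 1) / 2"
  have "\<theta> < \<eta>0" "\<eta>0 < 1" using \<theta>01 by (auto simp: \<eta>0_def)
  from main[OF this] obtain n0 where full: "\<And>n Q. n \<ge> n0 \<Longrightarrow> annihilates ?V n Q \<Longrightarrow> degree Q \<le> ?M \<Longrightarrow>
      Q \<noteq> 0 \<Longrightarrow> degree Q = ?M \<and> poly Q 0 \<noteq> 0" by blast
  have "eventually (\<lambda>n. \<exists>!q. hermite_pade_denom d f m n q) sequentially"
    using eventually_ge_at_top[of "max n0 ?M"]
  proof eventually_elim
    case (elim n)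
    then have n: "n \<ge> n0" and hp: "hermite_pade_denom d f m n (Qs n)" using Qs by auto
    show ?case
      using hp hermite_pade_denom_unique_of_full_degree[OF full[OF n] M _ hp] by blast
  qed
  moreover have "limsup (\<lambda>n. ereal (root n (coeff_norm (?P - Qs n)))) \<le> ereal \<eta>" if \<eta>: "\<theta> < \<eta>" "\<eta> < 1" for \<eta>
  proof -
    obtain C n1 where C: "C > 0" "\<And>n Q. n \<ge> n1 \<Longrightarrow> degree Q \<le> ?M \<Longrightarrow> annihilates ?V n Q \<Longrightarrow> Q \<noteq> 0 \<Longrightarrow>
        lead_coeff Q = 1 \<Longrightarrow> l1_norm (?P - Q) \<le> C * \<eta> ^ n"
      using main[OF \<eta>] by blast
    show ?thesis
    proof (rule limsup_root_le)
      fix n assume n: "n \<ge> max (max n0 n1) ?M"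
      then have hp: "hermite_pade_denom d f m n (Qs n)" using Qs by simp
      have "degree (Qs n) = ?M" "annihilates ?V n (Qs n)"
        using hermite_pade_denom_of_full_degree[OF full hp] n by auto
      moreover have "lead_coeff (Qs n) = 1" using hp by (simp add: hermite_pade_denom_def)
      ultimately have "l1_norm (?P - Qs n) \<le> C * \<eta> ^ n" using n by (intro C(2)) auto
      then show "coeff_norm (?P - Qs n) \<le> C * \<eta> ^ n" using coeff_norm_le_l1_norm order_trans by blast
    qed (use C(1) \<eta> \<theta>01 in auto)
  qed
  note limsup_le = this
  have "limsup (\<lambda>n. ereal (root n (coeff_norm (?P - Qs n)))) \<le> ereal \<theta>"
  proof (rule ereal_le_epsilon2)
    fix e :: real assume "e > 0"
    define \<eta> where "\<eta> = min (\<theta> + e) \<eta>0"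
    have "limsup (\<lambda>n. ereal (root n (coeff_norm (?P - Qs n)))) \<le> ereal \<eta>"
      using \<open>e > 0\<close> \<open>\<theta> < \<eta>0\<close> \<open>\<eta>0 < 1\<close> by (intro limsup_le) (auto simp: \<eta>_def)
    also have "ereal \<eta> \<le> ereal \<theta> + ereal e" by (simp add: \<eta>_def)
    finally show "limsup (\<lambda>n. ereal (root n (coeff_norm (?P - Qs n)))) \<le> ereal \<theta> + ereal e" .
  qed
  moreover from this have "limsup (\<lambda>n. ereal (root n (coeff_norm (?P - Qs n)))) < 1"
    using \<theta>01(2) by (simp add: le_less_trans one_ereal_def)
  ultimately show ?thesis
    unfolding denoms_converge_def \<theta>[symmetric] using P(3,4) poles(2) by auto
qed

section \<open>From convergence to system poles\<close>

lemma poly_combs_nonempty: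
  assumes "\<forall>k\<in>{1..d}. m k \<ge> 1"
  shows "poly_combs d f m \<noteq> {}"
proof -
  have "(\<Sum>k=1..d. fps_of_poly 0 * f k) \<in> poly_combs d f m"
    unfolding poly_combs_def using assms by (intro CollectI exI[of _ "\<lambda>_. 0"]) (auto simp: Suc_le_eq)
  then show ?thesis by blast
qed

text \<open>
  Since the monic \<open>Qs n\<close> have degree at most \<open>|m|\<close> and converge to a polynomial of degree \<open>|m|\<close>, they
  eventually have degree \<open>|m|\<close> themselves; this is why uniqueness of the reduced denominator passes
  to the annihilators. The other bounds are consequences of the convergence of the coefficients.
\<close>

lemma denoms_converge_regularity:
  assumes m: "\<forall>k\<in>{1..d}. m k \<ge> 1"
    and Qs: "\<forall>n\<ge>mi_size d m. hermite_pade_denom d f m n (Qs n)"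
    and conv: "denoms_converge d f m Qs Q \<theta>"
  shows "lead_coeff Q = 1"
    and "\<And>\<delta>. \<theta> < ereal \<delta> \<Longrightarrow> 0 < \<delta> \<Longrightarrow> \<delta> < 1 \<Longrightarrow>
      \<exists>n0 C. (\<forall>n\<ge>n0. l1_norm (Q - Qs n) \<le> C * \<delta> ^ n \<and> degree (Qs n) \<le> mi_size d m \<and>
        norm (coeff (Qs n) 0) \<ge> norm (poly Q 0) / 2 \<and> l1_norm (Qs n) \<le> l1_norm Q + 1 \<and>
        annihilates (poly_combs d f m) n (Qs n) \<and>
        (\<forall>P. annihilates (poly_combs d f m) n P \<longrightarrow> degree P \<le> mi_size d m \<longrightarrow> (\<exists>c. P = smult c (Qs n))))"
proof -
  let ?M = "mi_size d m" and ?V = "poly_combs d f m"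
  have ex1: "eventually (\<lambda>n. \<exists>!q. hermite_pade_denom d f m n q) sequentially"
    and Q: "degree Q = ?M" "poly Q 0 \<noteq> 0"
    and lim: "limsup (\<lambda>n. ereal (root n (coeff_norm (Q - Qs n)))) = \<theta>" "\<theta> < 1"
    using conv by (auto simp: denoms_converge_def)
  have deg: "degree (Qs n) \<le> ?M" if "n \<ge> ?M" for n
    using Qs that by (intro degree_hermite_pade_denom_le(1)) auto
  have rate: "eventually (\<lambda>n. l1_norm (Q - Qs n) \<le> real (?M + 1) * \<delta> ^ n) sequentially"
    if \<delta>: "\<theta> < ereal \<delta>" for \<delta>
    using eventually_le_power_of_limsup_root[of "\<lambda>n. coeff_norm (Q - Qs n)" \<delta>, unfolded lim(1), OF \<delta> coeff_norm_nonneg]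
      eventually_ge_at_top[of ?M]
  proof eventually_elim
    case (elim n)
    have "l1_norm (Q - Qs n) \<le> real (?M + 1) * coeff_norm (Q - Qs n)"
      using Q(1) deg[OF elim(2)] by (intro l1_norm_le_coeff_norm degree_diff_le) auto
    also have "\<dots> \<le> real (?M + 1) * \<delta> ^ n" using elim(1) by (intro mult_left_mono) auto
    finally show ?case .
  qed
  obtain \<delta>1 where \<delta>1: "\<theta> < ereal \<delta>1" "ereal \<delta>1 < 1" using ereal_dense2[OF lim(2)] by blast
  define \<delta>0 where "\<delta>0 = max \<delta>1 (1/2)"
  have \<delta>0: "\<theta> < ereal \<delta>0" "0 < \<delta>0" "\<delta>0 < 1"
    using \<delta>1 by (auto simp: \<delta>0_def one_ereal_def intro: less_le_trans)
  have "(\<lambda>n. real (?M + 1) * \<delta>0 ^ n) \<longlonglongrightarrow> real (?M + 1) * 0"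
    using \<delta>0 by (intro tendsto_intros LIMSEQ_power_zero) auto
  then have "(\<lambda>n. real (?M + 1) * \<delta>0 ^ n) \<longlonglongrightarrow> 0" by simp
  moreover have "eventually (\<lambda>n. norm (l1_norm (Q - Qs n)) \<le> real (?M + 1) * \<delta>0 ^ n) sequentially"
    using rate[OF \<delta>0(1)] by eventually_elim (simp add: l1_norm_nonneg)
  ultimately have tend: "(\<lambda>n. l1_norm (Q - Qs n)) \<longlonglongrightarrow> 0"
    by (rule Lim_null_comparison[rotated])
  have coeff_lim: "(\<lambda>n. coeff (Qs n) i) \<longlonglongrightarrow> coeff Q i" for i
  proof (rule LIM_zero_cancel, rule Lim_null_comparison[OF _ tend], rule always_eventually, rule allI)
    fix n
    show "norm (coeff (Qs n) i - coeff Q i) \<le> l1_norm (Q - Qs n)"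
      using norm_coeff_le_l1_norm[of "Q - Qs n" i] by (simp add: norm_minus_commute)
  qed
  have "Q \<noteq> 0" using Q(2) by auto
  then have "coeff Q (degree Q) \<noteq> 0" by simp
  then have "coeff Q ?M \<noteq> 0" by (simp only: Q(1) not_False_eq_True)
  have "eventually (\<lambda>n. coeff (Qs n) ?M \<noteq> 0) sequentially"
    using tendsto_imp_eventually_ne[OF coeff_lim \<open>coeff Q ?M \<noteq> 0\<close>] .
  then have full: "eventually (\<lambda>n. degree (Qs n) = ?M \<and> coeff (Qs n) ?M = 1) sequentially"
    using eventually_ge_at_top[of ?M]
  proof eventually_elim
    case (elim n)
    then have "degree (Qs n) = ?M" using deg[of n] le_degree[of "Qs n" ?M] by simp
    moreover have "lead_coeff (Qs n) = 1" using Qs elim by (auto simp: hermite_pade_denom_def)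
    ultimately show ?case by simp
  qed
  then have "(\<lambda>n. coeff (Qs n) ?M) \<longlonglongrightarrow> 1"
    by (intro tendsto_eventually) (auto elim: eventually_mono)
  from LIMSEQ_unique[OF coeff_lim this] show "lead_coeff Q = 1" by (simp only: Q(1))
  have "norm (poly Q 0) / 2 < norm (coeff Q 0)" using Q(2) by (simp add: poly_0_coeff_0)
  then have low: "eventually (\<lambda>n. norm (poly Q 0) / 2 < norm (coeff (Qs n) 0)) sequentially"
    by (rule order_tendstoD[OF tendsto_norm[OF coeff_lim]])
  have small: "eventually (\<lambda>n. l1_norm (Q - Qs n) < 1) sequentially"
    by (rule order_tendstoD[OF tend]) simp
  show "\<exists>n0 C. (\<forall>n\<ge>n0. l1_norm (Q - Qs n) \<le> C * \<delta> ^ n \<and> degree (Qs n) \<le> ?M \<and>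
        norm (coeff (Qs n) 0) \<ge> norm (poly Q 0) / 2 \<and> l1_norm (Qs n) \<le> l1_norm Q + 1 \<and>
        annihilates ?V n (Qs n) \<and>
        (\<forall>P. annihilates ?V n P \<longrightarrow> degree P \<le> ?M \<longrightarrow> (\<exists>c. P = smult c (Qs n))))"
    if \<delta>: "\<theta> < ereal \<delta>" "0 < \<delta>" "\<delta> < 1" for \<delta>
  proof -
    have "eventually (\<lambda>n. l1_norm (Q - Qs n) \<le> real (?M + 1) * \<delta> ^ n \<and> degree (Qs n) \<le> ?M \<and>
        norm (coeff (Qs n) 0) \<ge> norm (poly Q 0) / 2 \<and> l1_norm (Qs n) \<le> l1_norm Q + 1 \<and>
        annihilates ?V n (Qs n) \<and>
        (\<forall>P. annihilates ?V n P \<longrightarrow> degree P \<le> ?M \<longrightarrow> (\<exists>c. P = smult c (Qs n)))) sequentially"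
      using rate[OF \<delta>(1)] full low small ex1 eventually_ge_at_top[of ?M]
    proof eventually_elim
      case (elim n)
      have hp: "hermite_pade_denom d f m n (Qs n)" using Qs elim(6) by simp
      have degQs: "degree (Qs n) = ?M" using elim(2) by simp
      have "l1_norm (Qs n) \<le> l1_norm Q + l1_norm (smult (-1) (Q - Qs n))"
        using l1_norm_add[of Q "smult (-1) (Q - Qs n)"] by simp
      also have "\<dots> \<le> l1_norm Q + 1" unfolding l1_norm_smult using elim(4) by simp
      finally have "l1_norm (Qs n) \<le> l1_norm Q + 1" .
      moreover have "annihilates ?V n (Qs n)" by (rule hermite_pade_denom_annihilates[OF hp degQs])
      moreover have "\<exists>c. P = smult c (Qs n)" if "annihilates ?V n P" "degree P \<le> ?M" for P
        by (rule annihilator_unique_of_denom_unique[OF elim(5) hp degQs le_of_mi_size_le[OF m elim(6)] that])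
      ultimately show ?case using elim(1,3) degQs by simp
    qed
    then show ?thesis unfolding eventually_at_top_linorder by blast
  qed
qed

text \<open>
  \<open>lower\<close> realizes every order up to that of the zero \<open>\<xi>\<close> of \<open>Q\<close>, with radius of meromorphy at
  least \<open>|\<xi>| / t\<close> for any \<open>t > \<theta>\<close>; \<open>upper\<close> excludes higher orders. This identifies the
  system poles with the zeros of \<open>Q\<close> and bounds the characteristic radii from below.
\<close>

lemma system_poles_of_denoms_converge:
  assumes m: "\<forall>k\<in>{1..d}. m k \<ge> 1"
    and Qs: "\<forall>n\<ge>mi_size d m. hermite_pade_denom d f m n (Qs n)"
    and conv: "denoms_converge d f m Qs Q \<theta>"
  shows "analyticity_radius d f > 0" "finite (system_poles d f m)"
    and "(\<Sum>\<xi>\<in>system_poles d f m. system_pole_order d f m \<xi>) = mi_size d m"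
    and "Q = system_pole_poly d f m"
    and "\<And>\<xi>. poly Q \<xi> = 0 \<Longrightarrow> ereal (norm \<xi>) / char_radius d f m \<xi> \<le> \<theta>"
proof -
  let ?M = "mi_size d m" and ?V = "poly_combs d f m"
  note reg = denoms_converge_regularity[OF m Qs conv]
  have Q: "degree Q = ?M" "poly Q 0 \<noteq> 0"
    and lim: "limsup (\<lambda>n. ereal (root n (coeff_norm (Q - Qs n)))) = \<theta>" "\<theta> < 1"
    using conv by (auto simp: denoms_converge_def)
  have "Q \<noteq> 0" using Q(2) by auto
  have "\<theta> \<ge> 0"
    unfolding lim(1)[symmetric]
    by (intro le_Limsup always_eventually) (auto simp: coeff_norm_nonneg intro: real_root_ge_zero)
  obtain \<delta>1 where \<delta>1: "\<theta> < ereal \<delta>1" "ereal \<delta>1 < 1" using ereal_dense2[OF lim(2)] by blast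
  have "0 < ereal \<delta>1" using \<open>\<theta> \<ge> 0\<close> \<delta>1(1) by (rule le_less_trans)
  then have \<delta>1': "0 < \<delta>1" "\<delta>1 < 1" using \<delta>1 by (auto simp: one_ereal_def)
  obtain n0 C where reg1: "\<And>n. n \<ge> n0 \<Longrightarrow> l1_norm (Q - Qs n) \<le> C * \<delta>1 ^ n"
      "\<And>n. n \<ge> n0 \<Longrightarrow> degree (Qs n) \<le> ?M"
      "\<And>n. n \<ge> n0 \<Longrightarrow> norm (coeff (Qs n) 0) \<ge> norm (poly Q 0) / 2"
      "\<And>n. n \<ge> n0 \<Longrightarrow> l1_norm (Qs n) \<le> l1_norm Q + 1"
      "\<And>n. n \<ge> n0 \<Longrightarrow> annihilates ?V n (Qs n)"
    using reg(2)[OF \<delta>1(1) \<delta>1'] by blast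
  have zero: "fps_nth (fps_of_poly (Qs n) * g) n = 0" if "g \<in> ?V" "n \<ge> n0" for g n
    using reg1(5)[OF that(2)] that(1) by (simp add: annihilates_def)
  have pos: "fps_conv_radius (f k) > 0" if k: "k \<in> {1..d}" for k
  proof -
    have "m k \<ge> 1" using m k by blast
    then have "fps_X ^ 0 * f k \<in> ?V" using m by (intro X_power_mult_in_poly_combs[OF k]) auto
    then have "f k \<in> ?V" by simp
    then show ?thesis
      by (intro recurrence_conv_radius_pos[OF zero reg1(2) reg1(4) reg1(3)]) (use Q(2) in auto)
  qed
  show "analyticity_radius d f > 0"
  proof -
    define \<rho> where "\<rho> = Min (insert \<infinity> ((\<lambda>k. fps_conv_radius (f k)) ` {1..d}))"
    have "\<rho> > 0" unfolding \<rho>_def using pos by (subst Min_gr_iff) auto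
    also have "\<rho> \<le> analyticity_radius d f"
      unfolding analyticity_radius_def
    proof (intro Sup_upper CollectI disjI2 conjI ballI)
      fix k assume k: "k \<in> {1..d}"
      then have "\<rho> \<le> fps_conv_radius (f k)" unfolding \<rho>_def by (intro Min_le) auto
      then have "eval_fps (f k) holomorphic_on eball 0 \<rho>"
        by (intro holomorphic_on_eval_fps eball_mono)
      then show "\<exists>F. F holomorphic_on eball 0 \<rho> \<and> F has_fps_expansion f k"
        using eval_fps_has_fps_expansion[OF pos[OF k]] by blast
    qed fact
    finally show ?thesis .
  qed
  have upper: "s \<le> order \<xi> Q" if "g \<in> ?V" "single_pole_on_disk g \<xi> s" "\<xi> \<noteq> 0" for g \<xi> s
    using pole_order_le_order_limit[OF zero[OF that(1)] _ reg1(2) reg1(1) \<delta>1'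
        single_pole_on_disk_imp_fps[OF that(2,3)] that(3) \<open>Q \<noteq> 0\<close>] Q(1) by simp
  have lower: "\<exists>g\<in>?V. single_pole_on_disk g \<xi> s \<and> ereal (norm \<xi> / t) \<le> mero_radius s g"
    if s: "1 \<le> s" "s \<le> order \<xi> Q" and t: "\<theta> < ereal t" "t < 1" for \<xi> s t
  proof -
    have "poly Q \<xi> = 0" using s \<open>Q \<noteq> 0\<close> order_root[of Q \<xi>] by auto
    then have "\<xi> \<noteq> 0" using Q(2) by auto
    obtain t1 where t1: "\<theta> < ereal t1" "ereal t1 < ereal t" using ereal_dense2[OF t(1)] by blast
    have "0 < ereal t1" using \<open>\<theta> \<ge> 0\<close> t1(1) by (rule le_less_trans)
    then have "0 < t1" "t1 < t" using t1 by auto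
    \<comment> \<open>The circle of radius \<open>norm \<xi> / t2\<close> has to avoid the zeros of \<open>Q\<close>.\<close>
    have "finite ((\<lambda>z. norm \<xi> / norm z) ` {z. poly Q z = 0})"
      using poly_roots_finite[OF \<open>Q \<noteq> 0\<close>] by simp
    moreover have "infinite {t1<..<t}" using \<open>t1 < t\<close> by simp
    ultimately obtain t2 where t2: "t2 \<in> {t1<..<t}" "t2 \<notin> (\<lambda>z. norm \<xi> / norm z) ` {z. poly Q z = 0}"
      by (meson finite_subset subsetI)
    define \<rho> where "\<rho> = norm \<xi> / t2"
    have t2': "t1 < t2" "t2 < t" "0 < t2" using t2(1) \<open>0 < t1\<close> by auto
    have \<rho>: "norm \<xi> < \<rho>" "\<rho> * t1 < norm \<xi>" "norm \<xi> / t \<le> \<rho>"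
    proof -
      have x: "norm \<xi> > 0" using \<open>\<xi> \<noteq> 0\<close> by simp
      have "norm \<xi> * t2 < norm \<xi> * 1" using x t2' t(2) by (intro mult_strict_left_mono) auto
      then show "norm \<xi> < \<rho>" unfolding \<rho>_def using t2'(3) by (simp add: pos_less_divide_eq)
      have "norm \<xi> * t1 < norm \<xi> * t2" using x t2' by (intro mult_strict_left_mono) auto
      then have "norm \<xi> * t1 / t2 < norm \<xi>" using t2'(3) by (simp add: pos_divide_less_eq)
      then show "\<rho> * t1 < norm \<xi>" by (simp add: \<rho>_def)
      show "norm \<xi> / t \<le> \<rho>" unfolding \<rho>_def using t2' by (intro divide_left_mono) auto
    qed
    have avoid: "norm z \<noteq> \<rho>" if z: "poly Q z = 0" for z
    proof
      assume "norm z = \<rho>"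
      then have "t2 = norm \<xi> / norm z" using \<open>\<xi> \<noteq> 0\<close> by (simp add: \<rho>_def)
      then show False using t2(2) z by blast
    qed
    have "t1 < 1" using \<open>t1 < t\<close> t(2) by simp
    obtain n1 C1 where reg2: "\<And>n. n \<ge> n1 \<Longrightarrow> l1_norm (Q - Qs n) \<le> C1 * t1 ^ n"
        "\<And>n. n \<ge> n1 \<Longrightarrow> degree (Qs n) \<le> ?M"
        "\<And>n. n \<ge> n1 \<Longrightarrow> norm (coeff (Qs n) 0) \<ge> norm (poly Q 0) / 2"
        "\<And>n. n \<ge> n1 \<Longrightarrow> annihilates ?V n (Qs n)"
        "\<And>n P. n \<ge> n1 \<Longrightarrow> annihilates ?V n P \<Longrightarrow> degree P \<le> ?M \<Longrightarrow> \<exists>c. P = smult c (Qs n)"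
      using reg(2)[OF t1(1) \<open>0 < t1\<close> \<open>t1 < 1\<close>] by blast
    have nz: "coeff (Qs n) 0 \<noteq> 0" if "n \<ge> n1" for n
      using reg2(3)[OF that] Q(2) by auto
    have "degree Q \<le> ?M" using Q(1) by simp
    from combination_with_prescribed_pole[OF poly_combs_nonempty[OF m] poly_combs_add poly_combs_scale
        this reg2(2) nz reg2(4,5) reg2(1) \<open>0 < t1\<close> \<open>t1 < 1\<close> Q(2) s \<open>\<xi> \<noteq> 0\<close> \<rho>(1,2) avoid]
    obtain g where g: "g \<in> ?V" "fps_conv_radius (fps_of_poly ([:-\<xi>, 1:] ^ s) * g) \<ge> \<rho>"
        "eval_fps (fps_of_poly ([:-\<xi>, 1:] ^ s) * g) \<xi> \<noteq> 0" by blast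
    have lt: "ereal (norm \<xi>) < ereal \<rho>" using \<rho>(1) by simp
    have sp: "single_pole_on_disk g \<xi> s"
      using single_pole_on_disk_iff_fps[OF \<open>\<xi> \<noteq> 0\<close> s(1)] less_le_trans[OF lt g(2)] g(3) by blast
    have "ereal (norm \<xi> / t) \<le> ereal \<rho>" using \<rho>(3) by simp
    also have "ereal \<rho> \<le> mero_radius s g" by (rule mero_radius_ge[OF sp \<open>\<xi> \<noteq> 0\<close> s(1) g(2) lt])
    finally show ?thesis using g(1) sp by blast
  qed
  have iff: "is_system_pole d f m \<xi> \<tau> \<longleftrightarrow> poly Q \<xi> = 0 \<and> \<tau> = order \<xi> Q" for \<xi> \<tau>
  proof -
    have 1: "is_system_pole d f m \<xi> (order \<xi> Q)" if "poly Q \<xi> = 0"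
      unfolding is_system_pole_def
    proof (intro conjI ballI allI impI)
      show "\<xi> \<noteq> 0" using Q(2) that by auto
      show "order \<xi> Q \<ge> 1" using that \<open>Q \<noteq> 0\<close> by (simp add: order_root Suc_le_eq)
      show "\<exists>g\<in>?V. single_pole_on_disk g \<xi> s" if "s \<in> {1..order \<xi> Q}" for s
        using lower[of s \<xi> \<delta>1] that \<delta>1(1) \<delta>1'(2) by auto
      show "\<not> (\<exists>g\<in>?V. single_pole_on_disk g \<xi> s)" if "s > order \<xi> Q" for s
        using upper \<open>\<xi> \<noteq> 0\<close> that by fastforce
    qed
    have 2: "poly Q \<xi> = 0" if sp: "is_system_pole d f m \<xi> \<tau>"
    proof -
      have "\<xi> \<noteq> 0" "\<tau> \<in> {1..\<tau>}" using sp by (auto simp: is_system_pole_def)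
      then obtain g where "g \<in> ?V" "single_pole_on_disk g \<xi> \<tau>" using sp unfolding is_system_pole_def by blast
      then have "\<tau> \<le> order \<xi> Q" using upper \<open>\<xi> \<noteq> 0\<close> by blast
      then show ?thesis using \<open>\<tau> \<in> {1..\<tau>}\<close> order_0I by fastforce
    qed
    show ?thesis using 1 2 is_system_pole_order_unique by blast
  qed
  have S: "system_poles d f m = {z. poly Q z = 0}" unfolding system_poles_def iff by auto
  have o: "system_pole_order d f m \<xi> = order \<xi> Q" if "poly Q \<xi> = 0" for \<xi>
    by (rule system_pole_order_eq) (simp add: iff that)
  show fin: "finite (system_poles d f m)" unfolding S using poly_roots_finite[OF \<open>Q \<noteq> 0\<close>] .
  have "system_pole_poly d f m = (\<Prod>z | poly Q z = 0. [:-z, 1:] ^ order z Q)"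
    unfolding system_pole_poly_def S by (intro prod.cong) (auto simp: o)
  also have "\<dots> = Q" using complex_poly_decompose[of Q] reg(1) by simp
  finally show QP: "Q = system_pole_poly d f m" by simp
  show "(\<Sum>\<xi>\<in>system_poles d f m. system_pole_order d f m \<xi>) = ?M"
    using system_pole_poly_props(3)[OF fin] Q(1) QP by simp
  show "ereal (norm \<xi>) / char_radius d f m \<xi> \<le> \<theta>" if \<xi>: "poly Q \<xi> = 0" for \<xi>
  proof (rule ccontr)
    assume "\<not> ?thesis"
    then have gt: "\<theta> < ereal (norm \<xi>) / char_radius d f m \<xi>" by simp
    have mem: "\<xi> \<in> system_poles d f m" using \<xi> S by blast
    have "\<xi> \<noteq> 0" using \<xi> Q(2) by auto
    obtain t where t: "\<theta> < ereal t" "ereal t < ereal (norm \<xi>) / char_radius d f m \<xi>"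
      using ereal_dense2[OF gt] by blast
    have "0 < ereal t" using \<open>\<theta> \<ge> 0\<close> t(1) by (rule le_less_trans)
    then have "t > 0" by simp
    have R: "char_radius d f m \<xi> > norm \<xi>" by (rule char_radius_gt_norm[OF mem])
    then have "char_radius d f m \<xi> > 0" by (rule le_less_trans[rotated]) simp
    have "ereal (norm \<xi>) / char_radius d f m \<xi> < ereal 1"
      using \<open>\<xi> \<noteq> 0\<close> R \<open>char_radius d f m \<xi> > 0\<close> by (subst ereal_ratio_less_iff) auto
    with t(2) have "ereal t < ereal 1" by (rule less_trans)
    then have "t < 1" by simp
    have "ereal (norm \<xi> / t) \<le> char_radius_order d f m \<xi> s" if s: "s \<in> {1..order \<xi> Q}" for s
    proof -
      obtain g where "g \<in> ?V" "single_pole_on_disk g \<xi> s" "ereal (norm \<xi> / t) \<le> mero_radius s g"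
        using lower[of s \<xi> t] s t(1) \<open>t < 1\<close> by auto
      then show ?thesis unfolding char_radius_order_def by (intro SUP_upper2[of g]) auto
    qed
    moreover have "order \<xi> Q \<ge> 1" using \<xi> \<open>Q \<noteq> 0\<close> by (simp add: order_root Suc_le_eq)
    ultimately have le: "ereal (norm \<xi> / t) \<le> char_radius d f m \<xi>"
      unfolding char_radius_def o[OF \<xi>] by (subst Min_ge_iff) auto
    show False
    proof (cases "char_radius d f m \<xi>")
      case (real R)
      then have "norm \<xi> / t \<le> R" "R > 0" "t < norm \<xi> / R"
        using le t(2) \<open>char_radius d f m \<xi> > 0\<close> by auto
      then show False using \<open>t > 0\<close> by (simp add: field_simps)
    qed (use t(2) \<open>t > 0\<close> \<open>char_radius d f m \<xi> > 0\<close> in auto)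
  qed
qed

theorem theorem1p3:
  fixes d :: nat
    and f :: "nat \<Rightarrow> complex fps"
    and m :: "nat \<Rightarrow> nat"
    and Qs :: "nat \<Rightarrow> complex poly"
  assumes "d \<ge> 1"
    and "\<forall>k\<in>{1..d}. m k \<ge> 1"
    and "\<forall>n\<ge>mi_size d m. hermite_pade_denom d f m n (Qs n)"
  defines "assertion_a \<equiv> analyticity_radius d f > 0 \<and> finite (system_poles d f m) \<and>
             (\<Sum>\<xi>\<in>system_poles d f m. system_pole_order d f m \<xi>) = mi_size d m"
    and "assertion_b \<equiv> \<exists>Q \<theta>. denoms_converge d f m Qs Q \<theta>"
  shows "(assertion_a \<longleftrightarrow> assertion_b) \<and>
         (assertion_a \<or> assertion_b \<longrightarrow>
            (\<forall>Q \<theta>. denoms_converge d f m Qs Q \<theta> \<longrightarrow>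
               Q = system_pole_poly d f m \<and>
               \<theta> = Max {ereal (norm \<xi>) / char_radius d f m \<xi> | \<xi>.
                          poly (system_pole_poly d f m) \<xi> = 0}))"
proof -
  have "mi_size d m \<ge> m 1" unfolding mi_size_def using assms(1) by (intro member_le_sum) auto
  then have M: "mi_size d m \<ge> 1" using assms(1,2) by force
  note direct = denoms_converge_of_system_poles[OF assms(3) M]
  note inverse = system_poles_of_denoms_converge[OF assms(2,3)]
  have "assertion_b" if "assertion_a"
    using direct that unfolding assertion_a_def assertion_b_def by blast
  moreover have "assertion_a" if "assertion_b"
    using inverse(1-3) that unfolding assertion_a_def assertion_b_def by blast
  moreover have "Q = system_pole_poly d f m \<and> \<theta> = Max (pole_ratios d f m)"
    if conv: "denoms_converge d f m Qs Q \<theta>" for Q \<theta>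
  proof
    note inv = inverse[OF conv]
    show Q: "Q = system_pole_poly d f m" by (rule inv(4))
    obtain \<theta>' where \<theta>': "\<theta>' \<le> Max (pole_ratios d f m)" "denoms_converge d f m Qs Q \<theta>'"
      using direct[OF inv(2,3)] Q by blast
    then have "\<theta> \<le> Max (pole_ratios d f m)" using conv by (simp add: denoms_converge_def)
    moreover have "Max (pole_ratios d f m) \<le> \<theta>"
      using pole_ratios_props(1,2)[OF inv(2,3) M] inv(5) Q by (subst Max_le_iff) (auto simp: pole_ratios_def)
    ultimately show "\<theta> = Max (pole_ratios d f m)" by (rule antisym)
  qed
  ultimately show ?thesis unfolding pole_ratios_def by blast
qed

end
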